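(* Let $H=\left(-\frac{d^2}{dx^2}\right)^{1/2}+x^2$ on $L^2(\mathbb{R})$, and let $\varphi_n$, $n=1,2,\dots$, be its $L^2$-normalized eigenfunctions. Then the eigenfunctions are uniformly bounded: there is a constant $C<\infty$ such that $|\varphi_n(x)|\le C$ for all $n\ge1$ and all $x\in\mathbb{R}$.
   Context: $\left(-\frac{d^2}{dx^2}\right)^{1/2}$ is the Fourier multiplier operator with symbol $|k|$. The operator $H$ is the self-adjoint operator on $L^2(\mathbb{R})$ with $e^{-tH}=T_t$, where $(T_tf)(x)=\mathbb{E}^x\left[e^{-\int_0^t X_s^2\,ds}f(X_t)\right]$ and $(X_t)_{t\ge0}$ is the one-dimensional Cauchy process (the Lévy process with $\mathbb{E}^0[e^{i\xi X_t}]=e^{-t|\xi|}$). The operators $T_t$, $t>0$, are compact, so the spectrum of $H$ is purely discrete, with eigenvalues $0<\lambda_1<\lambda_2\le\lambda_3\le\dots\to\infty$ and an orthonormal basis of $L^2(\mathbb{R})$ of eigenfunctions $\varphi_n$, $H\varphi_n=\lambda_n\varphi_n$; the eigenvalues are simple and each $\varphi_n$ is taken to be its continuous version. *)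

theory Defs
  imports "HOL-Probability.Probability"
begin

text \<open>
  All paths (not just almost all) are cadlag, so that the time integral below is a
  measurable functional on the sample space. This is no loss, since such a version exists.
\<close>

locale cauchy_process = prob_space M
  for M :: "'a measure" and X :: "real \<Rightarrow> 'a \<Rightarrow> real" +
  assumes measurable_X: "\<And>t. 0 \<le> t \<Longrightarrow> X t \<in> borel_measurable M"
    and start: "AE \<omega> in M. X 0 \<omega> = 0"
    and indep_increments:
      "\<And>(\<tau> :: nat \<Rightarrow> real) n. 0 \<le> \<tau> 0 \<Longrightarrow> mono \<tau> \<Longrightarrow>
         indep_vars (\<lambda>_. borel) (\<lambda>i \<omega>. X (\<tau> (Suc i)) \<omega> - X (\<tau> i) \<omega>) {..<n}"
    and stationary_increments:
      "\<And>s t. 0 \<le> s \<Longrightarrow> 0 \<le> t \<Longrightarrow>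
         distr M borel (\<lambda>\<omega>. X (s + t) \<omega> - X s \<omega>) = distr M borel (X t)"
    and char_X:
      "\<And>t \<xi>. 0 \<le> t \<Longrightarrow> char (distr M borel (X t)) \<xi> = of_real (exp (- t * \<bar>\<xi>\<bar>))"
    and right_continuous:
      "\<And>t \<omega>. \<omega> \<in> space M \<Longrightarrow> 0 \<le> t \<Longrightarrow> ((\<lambda>s. X s \<omega>) \<longlongrightarrow> X t \<omega>) (at_right t)"
    and left_limits:
      "\<And>t \<omega>. \<omega> \<in> space M \<Longrightarrow> 0 < t \<Longrightarrow> \<exists>l. ((\<lambda>s. X s \<omega>) \<longlongrightarrow> l) (at_left t)"

text \<open>
  Elements of the complex Hilbert space \<open>L\<^sup>2(\<real>)\<close> are represented by Borel functions. The squared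
  norm is a nonnegative integral, hence infinite (not 0) off \<open>L\<^sup>2\<close>.
\<close>

definition L2_normsq :: "(real \<Rightarrow> complex) \<Rightarrow> ennreal" where
  "L2_normsq f = (\<integral>\<^sup>+x. ennreal ((cmod (f x))\<^sup>2) \<partial>lborel)"

definition L2 :: "(real \<Rightarrow> complex) set" where
  "L2 = {f \<in> borel_measurable borel. L2_normsq f < \<infinity>}"

definition L2_inner :: "(real \<Rightarrow> complex) \<Rightarrow> (real \<Rightarrow> complex) \<Rightarrow> complex" where
  "L2_inner f g = (LINT x|lborel. cnj (f x) * g x)"

text \<open>
  The expectation \<open>\<E>\<^sup>x\<close> is taken with the process started at \<open>x\<close>, that is with \<open>x + X\<close> in place of \<open>X\<close>.
\<close>

definition FK_semigroup ::
    "'a measure \<Rightarrow> (real \<Rightarrow> 'a \<Rightarrow> real) \<Rightarrow> real \<Rightarrow> (real \<Rightarrow> complex) \<Rightarrow> real \<Rightarrow> complex" where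
  "FK_semigroup M X t f x =
     (LINT \<omega>|M. of_real (exp (- (LINT s:{0..t}|lborel. (x + X s \<omega>)\<^sup>2))) * f (x + X t \<omega>))"

text \<open>
  The graph of the unbounded operator \<open>H\<close> with \<open>exp (- t H) = T\<^sub>t\<close>: minus the infinitesimal generator
  of the semigroup, with its full domain. So \<open>oscillator_graph M X f g\<close> says that \<open>f\<close> lies in the domain
  of \<open>H\<close> and \<open>H f = g\<close> as elements of \<open>L\<^sup>2(\<real>)\<close>.
\<close>

definition oscillator_graph ::
    "'a measure \<Rightarrow> (real \<Rightarrow> 'a \<Rightarrow> real) \<Rightarrow> (real \<Rightarrow> complex) \<Rightarrow> (real \<Rightarrow> complex) \<Rightarrow> bool" where
  "oscillator_graph M X f g \<longleftrightarrow> f \<in> L2 \<and> g \<in> L2 \<and>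
     ((\<lambda>t. L2_normsq (\<lambda>x. (f x - FK_semigroup M X t f x) / of_real t - g x)) \<longlongrightarrow> 0) (at_right 0)"

text \<open>Sequences indexed by \<open>n \<ge> 1\<close>; the entries at index 0 are irrelevant.\<close>

definition L2_orthonormal_basis :: "(nat \<Rightarrow> real \<Rightarrow> complex) \<Rightarrow> bool" where
  "L2_orthonormal_basis \<phi> \<longleftrightarrow>
     (\<forall>n\<ge>1. \<phi> n \<in> L2) \<and>
     (\<forall>m\<ge>1. \<forall>n\<ge>1. L2_inner (\<phi> m) (\<phi> n) = (if m = n then 1 else 0)) \<and>
     (\<forall>f\<in>L2. (\<lambda>N. L2_normsq (\<lambda>x. f x - (\<Sum>n=1..N. L2_inner (\<phi> n) f * \<phi> n x))) \<longlonglongrightarrow> 0)"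

definition oscillator_eigensystem ::
    "'a measure \<Rightarrow> (real \<Rightarrow> 'a \<Rightarrow> real) \<Rightarrow> (nat \<Rightarrow> real) \<Rightarrow> (nat \<Rightarrow> real \<Rightarrow> complex) \<Rightarrow> bool" where
  "oscillator_eigensystem M X \<mu> \<phi> \<longleftrightarrow>
     0 < \<mu> 1 \<and> \<mu> 1 < \<mu> 2 \<and> (\<forall>n\<ge>1. \<mu> n \<le> \<mu> (Suc n)) \<and> filterlim \<mu> at_top sequentially \<and>
     L2_orthonormal_basis \<phi> \<and>
     (\<forall>n\<ge>1. continuous_on UNIV (\<phi> n) \<and> oscillator_graph M X (\<phi> n) (\<lambda>x. of_real (\<mu> n) * \<phi> n x))"

end

theory Submission
  imports Defs "HOL-Complex_Analysis.Complex_Analysis"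
begin

text \<open>
  Let \<open>H \<phi> = \<lambda> \<phi>\<close> with \<open>\<phi>\<close> of norm 1. On positive frequencies the operator \<open>\<bar>D\<bar>\<close> is \<open>- \<i> d/dx\<close>,
  so the positive-frequency part of \<open>\<phi>\<close> should satisfy a differential equation of order one. This part
  is, up to a factor \<open>2 \<pi> \<i>\<close>, the boundary value of the Cauchy transform
  \<open>F w = \<integral> \<phi> y / (y - w) dy\<close> from the upper half-plane, and there indeed
  \<open>F' w = \<i> (\<lambda> - w\<^sup>2) F w + \<alpha> + \<beta> w\<close> with two constants \<open>\<alpha>, \<beta>\<close>
  (\<open>eigenfunction_weak_equation\<close>, \<open>cauchy_transform_ODE\<close>). The values of \<open>F\<close> below the real line are the
  conjugates of those above it for the eigenfunction \<open>cnj \<phi>\<close>, and \<open>2 \<pi> \<i> \<phi>\<close> is the jump of \<open>F\<close> across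
  the line. So it suffices to bound \<open>F\<close> just above the real line, uniformly in \<open>\<lambda>\<close>.

  The coefficient \<open>\<i> (\<lambda> - x\<^sup>2)\<close> only rotates \<open>F\<close>, so \<open>\<bar>F\<bar>\<close> changes at most at the rate \<open>\<bar>\<alpha> + \<beta> x\<bar>\<close>.
  The \<open>L\<^sup>2\<close> norm of \<open>F\<close> on horizontal lines is at most a constant (\<open>cauchy_transform_L2\<close>), hence \<open>F\<close> is
  bounded somewhere in every interval of length 1. For \<open>\<bar>x\<bar> \<lesssim> \<surd>\<lambda>\<close> this bounds \<open>F\<close> as soon as
  \<open>\<bar>\<alpha>\<bar> \<le> C\<close> and \<open>\<bar>\<beta>\<bar> \<le> C / \<surd>\<lambda>\<close>; for larger \<open>\<bar>x\<bar>\<close> the same argument applies after subtracting the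
  approximate solution \<open>\<i> (\<alpha> + \<beta> x) / (\<lambda> - x\<^sup>2)\<close> (\<open>cauchy_transform_uniform_bound\<close>).

  The bound on the coefficients comes from a virial identity: with \<open>P = x F + \<i> \<beta>\<close>, multiplying the equation
  by \<open>cnj P\<close> and integrating the real part over the line gives
  \<open>\<pi> (\<lambda> \<bar>\<beta>\<bar>\<^sup>2 + \<bar>\<alpha>\<bar>\<^sup>2) = \<integral> \<bar>F\<bar>\<^sup>2 / 2\<close> (\<open>ODE_coefficient_bound\<close>). In Fourier space this is the classical
  identity \<open>\<psi>'(0)\<^sup>2 + \<lambda> \<psi>(0)\<^sup>2 = \<integral> \<psi>\<^sup>2\<close> for a decaying solution of \<open>- \<psi>'' + k \<psi> = \<lambda> \<psi>\<close> on \<open>k > 0\<close>.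

  The equation for \<open>F\<close> is obtained by testing \<open>(\<phi> - T\<^sub>t \<phi>) / t \<rightarrow> \<lambda> \<phi>\<close> with \<open>(y - w)\<^sup>-\<^sup>3\<close>. The motion of the
  process merely moves \<open>w\<close> to \<open>w + \<i> t\<close>, since \<open>\<E> g (X\<^sub>t) = g (\<i> t)\<close> for every bounded analytic \<open>g\<close> on the
  upper half-plane. The potential contributes \<open>y\<^sup>2 (y - w)\<^sup>-\<^sup>3\<close> in the limit (\<open>potential_term_limit\<close>); there
  one has to control the paths with large jumps, as \<open>X\<^sub>t\<close> has no second moment.
\<close>

section \<open>The Poisson formula of the upper half-plane\<close>

lemma tendsto_integral_symmetric_interval:
  fixes f :: "real \<Rightarrow> 'b::euclidean_space"
  assumes "integrable lborel f"
  shows "(\<lambda>n. integral {- real n .. real n} f) \<longlonglongrightarrow> (LINT x|lborel. f x)"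
proof -
  have "(\<lambda>n. LINT x|lborel. indicator {- real n .. real n} x *\<^sub>R f x) \<longlonglongrightarrow> (LINT x|lborel. f x)"
  proof (rule integral_dominated_convergence[where w = "\<lambda>x. norm (f x)"])
    show "AE x in lborel. (\<lambda>n. indicator {- real n..real n} x *\<^sub>R f x) \<longlonglongrightarrow> f x"
    proof (rule AE_I2)
      fix x :: real
      have "eventually (\<lambda>n. indicator {- real n..real n} x *\<^sub>R f x = f x) sequentially"
        using eventually_ge_at_top[of "nat \<lceil>\<bar>x\<bar>\<rceil>"]
        by eventually_elim (auto simp: indicator_def nat_le_iff ceiling_le_iff abs_le_iff)
      then show "(\<lambda>n. indicator {- real n..real n} x *\<^sub>R f x) \<longlonglongrightarrow> f x"
        by (simp add: tendsto_eventually)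
    qed
  qed (use assms in \<open>auto simp: indicator_def\<close>)
  moreover have "(LINT x|lborel. indicator {- real n .. real n} x *\<^sub>R f x) = integral {- real n .. real n} f" for n
  proof -
    have "set_integrable lborel {- real n .. real n} f"
      unfolding set_integrable_def using assms by (intro integrable_mult_indicator) auto
    from set_borel_integral_eq_integral(2)[OF this] show ?thesis
      by (simp add: set_lebesgue_integral_def)
  qed
  ultimately show ?thesis by simp
qed

lemma integral_derivative_whole_line:
  fixes F :: "real \<Rightarrow> real"
  assumes "\<And>x. (F has_real_derivative f x) (at x)" "integrable lborel f"
    and "(F \<longlongrightarrow> l) at_top" "(F \<longlongrightarrow> m) at_bot"
  shows "(LINT x|lborel. f x) = l - m"
proof -
  have "(f has_integral F (real n) - F (- real n)) {- real n .. real n}" for n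
    by (rule fundamental_theorem_of_calculus)
       (auto simp: has_real_derivative_iff_has_vector_derivative[symmetric] intro: DERIV_subset[OF assms(1)])
  then have "integral {- real n .. real n} f = F (real n) - F (- real n)" for n
    by (rule integral_unique)
  moreover have "(\<lambda>n. F (real n) - F (- real n)) \<longlonglongrightarrow> l - m"
    by (intro tendsto_diff filterlim_compose[OF assms(3) filterlim_real_sequentially]
        filterlim_compose[OF assms(4)] filterlim_compose[OF filterlim_uminus_at_bot_at_top filterlim_real_sequentially])
  ultimately show ?thesis
    using tendsto_integral_symmetric_interval[OF assms(2)] LIMSEQ_unique by simp
qed

lemma poisson_kernel_total:
  assumes N: "(N::real) > 0"
  shows "integrable lborel (\<lambda>x. 1 / ((x - a)^2 + N^2))"
    and "(LINT x|lborel. 1 / ((x - a)^2 + N^2)) = pi / N"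
    and "(\<integral>\<^sup>+x. ennreal (1 / ((x - a)^2 + N^2)) \<partial>lborel) = ennreal (pi / N)"
proof -
  have pos: "u^2 + N^2 > 0" for u using N by (simp add: add_nonneg_pos)
  have d: "((\<lambda>x. arctan (x / N) / N) has_real_derivative 1 / (x^2 + N^2)) (at x)" for x
  proof -
    have "((\<lambda>x. arctan (x / N) / N) has_real_derivative (inverse (1 + (x / N)^2) * (1 / N)) / N) (at x)"
      using N by (auto intro!: derivative_eq_intros)
    moreover have "(inverse (1 + (x / N)^2) * (1 / N)) / N = 1 / (x^2 + N^2)"
      using N by (simp add: power_divide divide_simps) (simp add: algebra_simps power2_eq_square)
    ultimately show ?thesis by simp
  qed
  have top: "((\<lambda>x. arctan (x / N) / N) \<longlongrightarrow> (pi / 2) / N) at_top"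
    using N by (real_asymp simp: field_simps)
  have bot: "((\<lambda>x. arctan (x / N) / N) \<longlongrightarrow> (- pi / 2) / N) at_bot"
    using N by (real_asymp simp: field_simps)
  have "isCont (\<lambda>x. 1 / (x^2 + N^2)) x" for x
    by (intro continuous_intros) (use N in simp)
  note FTC = interval_integral_FTC_nonneg[where a="-\<infinity>" and b="\<infinity>" and F="\<lambda>x. arctan (x / N) / N",
      OF _ d this, unfolded ereal_tendsto_simps1]
  have "set_integrable lborel (einterval (-\<infinity>) \<infinity>) (\<lambda>x. 1 / (x^2 + N^2))"
       "(LBINT x=-\<infinity>..\<infinity>. 1 / (x^2 + N^2)) = (pi / 2) / N - (- pi / 2) / N"
    using FTC[OF _ _ bot top] pos by (simp_all add: less_imp_le o_def)
  then have i: "integrable lborel (\<lambda>x. 1 / (x^2 + N^2))" and e: "(LINT x|lborel. 1 / (x^2 + N^2)) = pi / N"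
    by (simp_all add: interval_lebesgue_integral_def set_lebesgue_integral_def set_integrable_def)
  show 1: "integrable lborel (\<lambda>x. 1 / ((x - a)^2 + N^2))"
    using lborel_integrable_real_affine[OF i, of 1 "-a"] by simp
  show 2: "(LINT x|lborel. 1 / ((x - a)^2 + N^2)) = pi / N"
    using lborel_integral_real_affine[of 1 "\<lambda>x. 1 / (x^2 + N^2)" "-a"] e by simp
  show "(\<integral>\<^sup>+x. ennreal (1 / ((x - a)^2 + N^2)) \<partial>lborel) = ennreal (pi / N)"
    using nn_integral_eq_integral[OF 1] pos 2 by (simp add: less_imp_le)
qed

text \<open>
  After subtraction of the constant \<open>g (\<i> N)\<close> the pole of \<open>1 / (z\<^sup>2 + N\<^sup>2)\<close> at \<open>\<i> N\<close> is removable, so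
  Cauchy's theorem applies on large half-discs, whose arcs contribute \<open>O(1 / R)\<close> because \<open>g\<close> is bounded.
  The formula has three uses: it gives the expectation of \<open>g\<close> under the Cauchy law, yields the
  \<open>L\<^sup>2\<close> bound for Cauchy transforms, and evaluates the integrals in the virial identity.
\<close>

lemma poisson_formula_upper_half_plane:
  assumes holo: "g holomorphic_on {z. - d < Im z}" and d: "d > 0"
    and bound: "\<And>z. 0 \<le> Im z \<Longrightarrow> norm (g z) \<le> B" and N: "(N::real) > 0"
  shows "integrable lborel (\<lambda>x. g (of_real x) / of_real (x^2 + N^2))"
    and "(LINT x|lborel. g (of_real x) / of_real (x^2 + N^2)) = of_real (pi / N) * g (\<i> * of_real N)"
proof -
  define c where "c = \<i> * complex_of_real N"
  define S where "S = {z. - min d N < Im z}"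
  have B: "B \<ge> 0" using bound[of 0] norm_ge_zero[of "g 0"] by (simp, linarith)
  have openS: "open S" unfolding S_def by (rule open_halfspace_Im_gt)
  have convS: "convex S" unfolding S_def by (rule convex_halfspace_Im_gt)
  have holoS: "g holomorphic_on S"
    by (rule holomorphic_on_subset[OF holo]) (auto simp: S_def)
  define q where "q = (\<lambda>z. if z = c then deriv g c else (g z - g c) / (z - c))"
  define k where "k = (\<lambda>z. q z / (z + c))"
  have q: "q holomorphic_on S"
    unfolding q_def by (rule pole_lemma_open[OF holoS openS])
  have nz: "z + c \<noteq> 0" if "z \<in> S" for z
    using that N by (auto simp: S_def c_def complex_eq_iff)
  have k: "k holomorphic_on S"
    unfolding k_def by (intro holomorphic_intros q) (use nz in auto)
  have cc: "c^2 = - of_real (N^2)" by (simp add: c_def power_mult_distrib)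
  have keq: "k z = (g z - g c) / (z^2 + of_real (N^2))" if "z \<noteq> c" for z
  proof -
    have "(z - c) * (z + c) = z^2 + of_real (N^2)"
      using cc by (simp add: algebra_simps power2_eq_square)
    then show ?thesis using that by (simp only: k_def q_def divide_divide_eq_left if_False)
  qed
  define u where "u = (\<lambda>x. k (of_real x))"
  have ux: "u x = g (of_real x) / of_real (x^2 + N^2) - g c * of_real (1 / (x^2 + N^2))" for x
  proof -
    have "of_real x \<noteq> c" using N by (auto simp: c_def complex_eq_iff)
    then show ?thesis unfolding u_def by (subst keq) (auto simp: diff_divide_distrib)
  qed
  note pk = poisson_kernel_total[OF N, of 0, unfolded diff_0_right]
  have pos: "x^2 + N^2 > 0" for x :: real using N by (simp add: add_nonneg_pos)
  have cont: "continuous_on UNIV (\<lambda>x::real. g (of_real x))"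
    by (rule continuous_on_compose2[OF holomorphic_on_imp_continuous_on[OF holo]])
       (use d in \<open>auto intro: continuous_intros\<close>)
  show I: "integrable lborel (\<lambda>x. g (of_real x) / of_real (x^2 + N^2))"
  proof (rule Bochner_Integration.integrable_bound)
    show "integrable lborel (\<lambda>x. B * (1 / (x^2 + N^2)))"
      using pk(1) by (rule integrable_mult_right)
    have "continuous_on UNIV (\<lambda>x::real. g (of_real x) / of_real (x^2 + N^2))"
      by (intro continuous_intros cont) (metis of_real_eq_0_iff less_irrefl pos)
    then show "(\<lambda>x. g (of_real x) / of_real (x^2 + N^2)) \<in> borel_measurable lborel"
      by (simp add: borel_measurable_continuous_onI)
    show "AE x in lborel. norm (g (of_real x) / of_real (x^2 + N^2)) \<le> norm (B * (1 / (x^2 + N^2)))"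
    proof (rule AE_I2)
      fix x :: real
      have "norm (of_real (x^2 + N^2) :: complex) = x^2 + N^2"
        by (metis abs_of_pos norm_of_real pos)
      then have "norm (g (of_real x) / of_real (x^2 + N^2)) = norm (g (of_real x)) / (x^2 + N^2)"
        by (simp only: norm_divide)
      also have "\<dots> \<le> B / (x^2 + N^2)"
        using bound[of "of_real x"] pos[of x] by (intro divide_right_mono) auto
      also have "\<dots> \<le> norm (B * (1 / (x^2 + N^2)))"
        using abs_ge_self[of "B * (1 / (x^2 + N^2))"] by simp
      finally show "norm (g (of_real x) / of_real (x^2 + N^2)) \<le> norm (B * (1 / (x^2 + N^2)))" .
    qed
  qed
  have I2: "integrable lborel (\<lambda>x. g c * of_real (1 / (x^2 + N^2)))"
    using integrable_of_real[OF pk(1)] by (rule integrable_mult_right)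
  have uint: "integrable lborel u"
    using I I2 by (subst ux[abs_def]) (rule Bochner_Integration.integrable_diff)
  have bnd: "norm (integral {- R .. R} u) \<le> 2 * B * R * pi / (R^2 - N^2)" if R: "R > N" for R
  proof -
    define \<gamma>1 where "\<gamma>1 = linepath (- complex_of_real R) (of_real R)"
    define \<gamma>2 where "\<gamma>2 = part_circlepath 0 R 0 pi"
    have R0: "R > 0" and R2: "R^2 > N^2" using R N by (auto intro: power_strict_mono)
    have ends: "pathfinish \<gamma>1 = pathstart \<gamma>2" "pathfinish \<gamma>2 = pathstart \<gamma>1"
      by (simp_all add: \<gamma>1_def \<gamma>2_def exp_eq_polar)
    have val: "valid_path \<gamma>1" "valid_path \<gamma>2" by (simp_all add: \<gamma>1_def \<gamma>2_def)
    have im2: "norm z = R \<and> 0 \<le> Im z" if "z \<in> path_image \<gamma>2" for z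
    proof -
      from that obtain t where t: "t \<in> {0..pi}" "z = 0 + R * exp (\<i> * t)"
        unfolding \<gamma>2_def using R0 by (subst (asm) path_image_part_circlepath) auto
      then show ?thesis using R0 by (auto simp: norm_mult Im_exp sin_ge_zero)
    qed
    have sub1: "path_image \<gamma>1 \<subseteq> S"
    proof -
      have "closed_segment (- complex_of_real R) (of_real R) \<subseteq> S"
        by (rule closed_segment_subset[OF _ _ convS]) (use d N in \<open>auto simp: S_def\<close>)
      then show ?thesis by (simp add: \<gamma>1_def)
    qed
    have sub2: "path_image \<gamma>2 \<subseteq> S" using im2 d N by (force simp: S_def)
    have ci: "k contour_integrable_on \<gamma>1" "k contour_integrable_on \<gamma>2"
      by (rule contour_integrable_holomorphic_simple[OF k openS], fact val, fact sub1)
        (rule contour_integrable_holomorphic_simple[OF k openS], fact val, fact sub2)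
    have "(k has_contour_integral 0) (\<gamma>1 +++ \<gamma>2)"
      by (rule Cauchy_theorem_convex_simple[OF k convS])
         (use val sub1 sub2 ends in \<open>simp_all add: path_image_join\<close>)
    then have "contour_integral (\<gamma>1 +++ \<gamma>2) k = 0" by (rule contour_integral_unique)
    then have sum0: "contour_integral \<gamma>1 k + contour_integral \<gamma>2 k = 0"
      using contour_integral_join[OF ci val] by simp
    have e1: "contour_integral \<gamma>1 k = integral {- R .. R} u"
      unfolding \<gamma>1_def u_def using R0
      by (subst contour_integral_linepath_Reals_eq) auto
    have "norm (contour_integral \<gamma>2 k) \<le> (2 * B / (R^2 - N^2)) * R * \<bar>pi - 0\<bar>"
      unfolding \<gamma>2_def
    proof (rule contour_integral_bound_part_circlepath)
      show "k contour_integrable_on part_circlepath 0 R 0 pi" using ci by (simp add: \<gamma>2_def)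
      show "0 \<le> 2 * B / (R^2 - N^2)" "0 \<le> R" using B R2 R0 by auto
      fix z assume "z \<in> path_image (part_circlepath 0 R 0 pi)"
      then have z: "norm z = R" "0 \<le> Im z" using im2 by (auto simp: \<gamma>2_def)
      have zc: "z \<noteq> c" using z R N by (auto simp: c_def norm_mult)
      have "norm (g z - g c) \<le> 2 * B"
        using norm_triangle_ineq4[of "g z" "g c"] bound[OF z(2)] bound[of c] N by (simp add: c_def)
      moreover have "R^2 - N^2 \<le> norm (z^2 + of_real (N^2))"
        using norm_diff_ineq[of "z^2" "of_real (N^2)"] z
        by (simp only: norm_of_real norm_power) simp
      ultimately show "norm (k z) \<le> 2 * B / (R^2 - N^2)"
        unfolding keq[OF zc] norm_divide using R2 B by (intro frac_le) auto
    qed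
    moreover have "norm (integral {- R .. R} u) = norm (contour_integral \<gamma>2 k)"
      using sum0 e1 by (metis add_eq_0_iff norm_minus_cancel)
    ultimately show ?thesis by simp
  qed
  have "(\<lambda>n. integral {- real n .. real n} u) \<longlonglongrightarrow> 0"
  proof (rule Lim_null_comparison)
    have "eventually (\<lambda>n. real n > N) sequentially"
      using filterlim_real_sequentially by (simp add: filterlim_at_top_dense)
    then show "eventually (\<lambda>n. norm (integral {- real n .. real n} u) \<le> 2 * B * real n * pi / ((real n)^2 - N^2)) sequentially"
      by eventually_elim (rule bnd)
    show "(\<lambda>n. 2 * B * real n * pi / ((real n)^2 - N^2)) \<longlonglongrightarrow> 0"
      by real_asymp
  qed
  with tendsto_integral_symmetric_interval[OF uint] have "(LINT x|lborel. u x) = 0"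
    by (rule LIMSEQ_unique)
  then have "(LINT x|lborel. g (of_real x) / of_real (x^2 + N^2)) = (LINT x|lborel. g c * of_real (1 / (x^2 + N^2)))"
    unfolding ux using I I2 by simp
  also have "\<dots> = g c * of_real (LINT x|lborel. 1 / (x^2 + N^2))"
    by (simp only: integral_mult_right_zero integral_complex_of_real)
  finally show "(LINT x|lborel. g (of_real x) / of_real (x^2 + N^2)) = of_real (pi / N) * g (\<i> * of_real N)"
    by (simp add: pk(2) c_def)
qed

section \<open>Cauchy transforms of square-integrable functions\<close>

text \<open>
  A real-valued copy of the squared norm, for computations with square roots. An infinite norm is sent to 0, so
  its lemmas assume membership in \<open>L2\<close>.
\<close>

definition l2sq :: "(real \<Rightarrow> complex) \<Rightarrow> real" where
  "l2sq f = enn2real (L2_normsq f)"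

lemma l2sq_nonneg [simp]: "0 \<le> l2sq f" by (simp add: l2sq_def)

lemma L2_measurable: "f \<in> L2 \<Longrightarrow> f \<in> borel_measurable borel" by (simp add: L2_def)

lemma L2_normsq_eq: "f \<in> L2 \<Longrightarrow> L2_normsq f = ennreal (l2sq f)"
  by (auto simp: L2_def l2sq_def less_top)

lemma L2_integrable_square:
  assumes "f \<in> L2"
  shows "integrable lborel (\<lambda>x. (cmod (f x))^2)" "(LINT x|lborel. (cmod (f x))^2) = l2sq f"
proof -
  have [measurable]: "f \<in> borel_measurable borel" using assms by (rule L2_measurable)
  have e: "(\<integral>\<^sup>+x. ennreal ((cmod (f x))^2) \<partial>lborel) = ennreal (l2sq f)"
    using L2_normsq_eq[OF assms] by (simp add: L2_normsq_def)
  show "integrable lborel (\<lambda>x. (cmod (f x))^2)"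
    by (rule integrableI_nn_integral_finite[OF _ _ e]) auto
  show "(LINT x|lborel. (cmod (f x))^2) = l2sq f"
    by (subst integral_eq_nn_integral) (auto simp: e)
qed

lemma L2I:
  assumes "f \<in> borel_measurable borel" "integrable lborel g" "\<And>x. (cmod (f x))^2 \<le> g x"
  shows "f \<in> L2" "l2sq f \<le> (LINT x|lborel. g x)"
proof -
  have "L2_normsq f \<le> (\<integral>\<^sup>+x. ennreal (g x) \<partial>lborel)"
    unfolding L2_normsq_def by (intro nn_integral_mono ennreal_leI assms)
  also have "\<dots> = ennreal (LINT x|lborel. g x)"
    by (intro nn_integral_eq_integral assms AE_I2) (meson assms(3) order_trans zero_le_power2)
  finally have le: "L2_normsq f \<le> ennreal (LINT x|lborel. g x)" .
  then show "f \<in> L2" using assms(1) by (auto simp: L2_def intro: le_less_trans)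
  have "0 \<le> (LINT x|lborel. g x)"
    by (intro integral_nonneg_AE AE_I2) (meson assms(3) order_trans zero_le_power2)
  with le show "l2sq f \<le> (LINT x|lborel. g x)"
    unfolding l2sq_def by (intro enn2real_leI)
qed

lemma ennreal_power2_le_imp_le:
  fixes a :: ennreal
  assumes "a^2 \<le> (ennreal b)^2" "0 \<le> b"
  shows "a \<le> ennreal b"
proof (cases a)
  case (real r)
  then show ?thesis using assms by (auto simp: ennreal_power intro: power2_le_imp_le)
next
  case top
  then show ?thesis using assms by (simp add: ennreal_power top_unique)
qed

lemma borel_measurable_cnj [measurable (raw)]:
  "f \<in> borel_measurable M \<Longrightarrow> (\<lambda>x. cnj (f x)) \<in> borel_measurable M"
  by (rule borel_measurable_continuous_on[OF continuous_on_cnj[OF continuous_on_id]])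

lemma L2_Cauchy_Schwarz:
  assumes f: "f \<in> L2" and g: "g \<in> L2"
  shows "integrable lborel (\<lambda>x. f x * g x)"
    and "(LINT x|lborel. cmod (f x) * cmod (g x)) \<le> sqrt (l2sq f) * sqrt (l2sq g)"
    and "(\<integral>\<^sup>+x. ennreal (cmod (f x) * cmod (g x)) \<partial>lborel) \<le> ennreal (sqrt (l2sq f) * sqrt (l2sq g))"
    and "cmod (LINT x|lborel. f x * g x) \<le> sqrt (l2sq f) * sqrt (l2sq g)"
proof -
  have [measurable]: "f \<in> borel_measurable borel" "g \<in> borel_measurable borel"
    using f g by (auto intro: L2_measurable)
  have "(\<integral>\<^sup>+x. ennreal (cmod (f x)) * ennreal (cmod (g x)) \<partial>lborel)^2 \<le> L2_normsq f * L2_normsq g"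
    unfolding L2_normsq_def
    using Cauchy_Schwarz_nn_integral[of "\<lambda>x. ennreal (cmod (f x))" lborel "\<lambda>x. ennreal (cmod (g x))"]
    by (simp add: ennreal_power)
  also have "\<dots> = (ennreal (sqrt (l2sq f) * sqrt (l2sq g)))^2"
    by (simp add: L2_normsq_eq f g ennreal_power power_mult_distrib ennreal_mult)
  finally show le: "(\<integral>\<^sup>+x. ennreal (cmod (f x) * cmod (g x)) \<partial>lborel) \<le> ennreal (sqrt (l2sq f) * sqrt (l2sq g))"
    by (intro ennreal_power2_le_imp_le) (simp_all add: ennreal_mult)
  have fin: "(\<integral>\<^sup>+x. ennreal (cmod (f x) * cmod (g x)) \<partial>lborel) < \<infinity>"
    using le by (rule le_less_trans) simp
  show I: "integrable lborel (\<lambda>x. f x * g x)"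
    by (rule integrableI_bounded) (use fin in \<open>auto simp: norm_mult\<close>)
  have "(LINT x|lborel. cmod (f x) * cmod (g x)) = enn2real (\<integral>\<^sup>+x. ennreal (cmod (f x) * cmod (g x)) \<partial>lborel)"
    by (rule integral_eq_nn_integral) auto
  also have "\<dots> \<le> sqrt (l2sq f) * sqrt (l2sq g)"
    by (rule enn2real_leI) (use le in auto)
  finally show 2: "(LINT x|lborel. cmod (f x) * cmod (g x)) \<le> sqrt (l2sq f) * sqrt (l2sq g)" .
  have "cmod (LINT x|lborel. f x * g x) \<le> (LINT x|lborel. cmod (f x * g x))"
    by (rule integral_norm_bound)
  with 2 show "cmod (LINT x|lborel. f x * g x) \<le> sqrt (l2sq f) * sqrt (l2sq g)"
    by (simp add: norm_mult)
qed

lemma L2_cnj: "f \<in> L2 \<Longrightarrow> (\<lambda>x. cnj (f x)) \<in> L2" "l2sq (\<lambda>x. cnj (f x)) = l2sq f"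
  by (auto simp: L2_def l2sq_def L2_normsq_def)

lemma cmod_of_real_minus: "(cmod (complex_of_real y - w))^2 = (y - Re w)^2 + (Im w)^2"
  by (simp add: cmod_power2)

lemma Im_le_cmod_of_real_minus: "\<bar>Im w\<bar> \<le> cmod (complex_of_real y - w)"
  using abs_Im_le_cmod[of "complex_of_real y - w"] by simp

lemma cauchy_kernel_L2:
  assumes w: "Im w \<noteq> 0"
  shows "(\<lambda>y. 1 / (complex_of_real y - w) ^ Suc m) \<in> L2"
    and "l2sq (\<lambda>y. 1 / (complex_of_real y - w) ^ Suc m) \<le> (pi / \<bar>Im w\<bar>) * (1 / (Im w)^2) ^ m"
proof -
  have pos: "0 < (y - Re w)^2 + (Im w)^2" for y using w by (simp add: add_nonneg_pos)
  have *: "(cmod (1 / (complex_of_real y - w) ^ Suc m))^2 \<le> (1 / (Im w)^2) ^ m * (1 / ((y - Re w)^2 + \<bar>Im w\<bar>^2))" for y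
  proof -
    have "(cmod (1 / (complex_of_real y - w) ^ Suc m))^2 = (1 / ((y - Re w)^2 + (Im w)^2)) ^ Suc m"
      by (simp add: norm_divide norm_mult norm_power power_divide power_mult_distrib cmod_of_real_minus[symmetric] power_mult[symmetric] mult.commute)
    also have "\<dots> \<le> (1 / (Im w)^2) ^ m * (1 / ((y - Re w)^2 + (Im w)^2))"
      unfolding power_Suc2 using w pos[of y]
      by (intro mult_right_mono power_mono divide_left_mono) auto
    finally show ?thesis by simp
  qed
  have W: "\<bar>Im w\<bar> > 0" using w by simp
  note pk = poisson_kernel_total[OF W, of "Re w"]
  have I: "integrable lborel (\<lambda>y. (1 / (Im w)^2) ^ m * (1 / ((y - Re w)^2 + \<bar>Im w\<bar>^2)))"
    by (rule integrable_mult_right[OF pk(1)])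
  have M: "(\<lambda>y. 1 / (complex_of_real y - w) ^ Suc m) \<in> borel_measurable borel"
    by measurable
  show "(\<lambda>y. 1 / (complex_of_real y - w) ^ Suc m) \<in> L2"
    using L2I(1)[OF M I *] .
  show "l2sq (\<lambda>y. 1 / (complex_of_real y - w) ^ Suc m) \<le> (pi / \<bar>Im w\<bar>) * (1 / (Im w)^2) ^ m"
    using L2I(2)[OF M I *] unfolding integral_mult_right_zero pk(2) by (simp add: mult.commute)
qed

text \<open>
  The Cauchy transform is the case \<open>m = 1\<close>; the higher ones are its derivatives up to a factor \<open>(m - 1)!\<close>.
  The lemmas write \<open>m\<close> as a successor because the integral converges on all of \<open>L2\<close> only for \<open>m \<ge> 1\<close>.
\<close>

definition cauchy_transform :: "nat \<Rightarrow> (real \<Rightarrow> complex) \<Rightarrow> complex \<Rightarrow> complex" where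
  "cauchy_transform m \<phi> w = (LINT y|lborel. \<phi> y * (1 / (of_real y - w) ^ m))"

lemma cauchy_transform_integrable:
  assumes "\<phi> \<in> L2" "Im w \<noteq> 0"
  shows "integrable lborel (\<lambda>y. \<phi> y * (1 / (complex_of_real y - w) ^ Suc m))"
  by (rule L2_Cauchy_Schwarz(1)[OF assms(1) cauchy_kernel_L2(1)[OF assms(2)]])

lemma cauchy_transform_bound:
  assumes "\<phi> \<in> L2" "Im w \<noteq> 0"
  shows "cmod (cauchy_transform (Suc m) \<phi> w) \<le> sqrt (l2sq \<phi>) * sqrt ((pi / \<bar>Im w\<bar>) * (1 / (Im w)^2) ^ m)"
  unfolding cauchy_transform_def
  by (rule order_trans[OF L2_Cauchy_Schwarz(4)[OF assms(1) cauchy_kernel_L2(1)[OF assms(2)]]])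
     (intro mult_left_mono real_sqrt_le_mono cauchy_kernel_L2(2) assms, simp)

text \<open>
  Differentiation under the integral sign. On the ball of radius \<open>\<bar>Im w\<bar> / 2\<close> around \<open>w\<close> the distance to
  \<open>y\<close> is at least half of \<open>\<bar>y - w\<bar>\<close>, so the difference quotients have an integrable majorant.
\<close>

lemma cauchy_transform_has_derivative:
  assumes \<phi>: "\<phi> \<in> L2" and w: "Im w \<noteq> 0"
  shows "(cauchy_transform (Suc m) \<phi> has_field_derivative
           of_nat (Suc m) * cauchy_transform (Suc (Suc m)) \<phi> w) (at w)"
proof -
  define \<eta> where "\<eta> = \<bar>Im w\<bar>"
  have \<eta>: "\<eta> > 0" using w by (simp add: \<eta>_def)
  have [measurable]: "\<phi> \<in> borel_measurable borel" using \<phi> by (rule L2_measurable)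
  define k where "k = (\<lambda>(y::real) z. 1 / (complex_of_real y - z) ^ Suc m)"
  define k' where "k' = (\<lambda>(y::real) z. of_nat (Suc m) * (1 / (complex_of_real y - z) ^ Suc (Suc m)))"
  have dk: "(k y has_field_derivative k' y z) (at z)" if "Im z \<noteq> 0" for y z
  proof -
    have nz: "complex_of_real y - z \<noteq> 0" using that by (auto simp: complex_eq_iff)
    have e: "k y = (\<lambda>z. inverse (complex_of_real y - z) ^ Suc m)"
      by (simp add: k_def power_inverse divide_inverse)
    show ?thesis unfolding e k'_def
      apply (rule derivative_eq_intros refl nz)+
      using nz by (simp add: divide_simps) 
  qed
  define B where "B = (\<lambda>y. real (Suc m) * 2 ^ Suc (Suc m) * cmod (1 / (complex_of_real y - w) ^ Suc (Suc m)))"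
  have near: "cmod (complex_of_real y - w) / 2 \<le> cmod (complex_of_real y - z)" "Im z \<noteq> 0" if "z \<in> ball w (\<eta>/2)" for y z
  proof -
    have z: "cmod (w - z) < \<eta>/2" using that by (simp add: dist_norm)
    have "cmod (complex_of_real y - w) \<le> cmod (complex_of_real y - z) + cmod (z - w)"
      using norm_triangle_ineq[of "complex_of_real y - z" "z - w"] by simp
    then show "cmod (complex_of_real y - w) / 2 \<le> cmod (complex_of_real y - z)"
      using z Im_le_cmod_of_real_minus[of w y] by (simp add: \<eta>_def norm_minus_commute)
    show "Im z \<noteq> 0"
    proof
      assume "Im z = 0"
      then show False using abs_Im_le_cmod[of "w - z"] z \<eta> by (simp add: \<eta>_def)
    qed
  qed
  have bound: "cmod (k y z - k y w) \<le> B y * cmod (z - w)" if "z \<in> ball w (\<eta>/2)" for y z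
  proof (rule field_differentiable_bound[of "ball w (\<eta>/2)" "k y" "k' y"])
    fix v assume v: "v \<in> ball w (\<eta>/2)"
    show "(k y has_field_derivative k' y v) (at v within ball w (\<eta>/2))"
      by (rule has_field_derivative_at_within[OF dk[OF near(2)[OF v]]])
    have p: "cmod (complex_of_real y - w) > 0" using Im_le_cmod_of_real_minus[of w y] \<eta> unfolding \<eta>_def by linarith
    have "1 / cmod (complex_of_real y - v) ^ Suc (Suc m) \<le> 1 / (cmod (complex_of_real y - w) / 2) ^ Suc (Suc m)"
      using near(1)[OF v, of y] p by (intro divide_left_mono power_mono mult_pos_pos zero_less_power) auto
    also have "\<dots> = 2 ^ Suc (Suc m) * (1 / cmod (complex_of_real y - w) ^ Suc (Suc m))"
      by (simp add: power_divide)
    finally show "cmod (k' y v) \<le> B y"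
      unfolding k'_def B_def norm_mult norm_divide norm_power norm_of_nat norm_one
      by (metis mult.assoc mult_left_mono of_nat_0_le_iff)
  qed (use that \<eta> in auto)
  have int: "integrable lborel (\<lambda>y. \<phi> y * k y z)" if "Im z \<noteq> 0" for z
    unfolding k_def by (rule cauchy_transform_integrable[OF \<phi> that])
  have "((\<lambda>h. (cauchy_transform (Suc m) \<phi> (w + h) - cauchy_transform (Suc m) \<phi> w) / h) \<longlongrightarrow>
     (LINT y|lborel. \<phi> y * k' y w)) (at 0 within ball 0 (\<eta>/2))"
    unfolding tendsto_at_iff_sequentially o_def
  proof (intro allI impI)
    fix X :: "nat \<Rightarrow> complex"
    assume X: "\<forall>i. X i \<in> ball 0 (\<eta>/2) - {0}" "X \<longlonglongrightarrow> 0"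
    have Xw: "w + X i \<in> ball w (\<eta>/2)" "X i \<noteq> 0" for i using X(1)[rule_format, of i] by (auto simp: dist_norm)
    have eq: "(cauchy_transform (Suc m) \<phi> (w + X i) - cauchy_transform (Suc m) \<phi> w) / X i
        = (LINT y|lborel. \<phi> y * ((k y (w + X i) - k y w) / X i))" for i
    proof -
      have "cauchy_transform (Suc m) \<phi> (w + X i) - cauchy_transform (Suc m) \<phi> w
        = (LINT y|lborel. \<phi> y * k y (w + X i) - \<phi> y * k y w)"
        unfolding cauchy_transform_def
        by (subst Bochner_Integration.integral_diff)
           (use int[OF near(2)[OF Xw(1)[of i]]] int[OF w] in \<open>simp_all add: k_def\<close>)
      then show ?thesis
        by (simp add: right_diff_distrib diff_divide_distrib flip: integral_divide_zero)
    qed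
    show "(\<lambda>i. (cauchy_transform (Suc m) \<phi> (w + X i) - cauchy_transform (Suc m) \<phi> w) / X i)
       \<longlonglongrightarrow> (LINT y|lborel. \<phi> y * k' y w)"
      unfolding eq
    proof (rule integral_dominated_convergence[where w="\<lambda>y. cmod (\<phi> y) * B y"])
      show "(\<lambda>y. \<phi> y * k' y w) \<in> borel_measurable lborel"
        unfolding k'_def by measurable
      show "(\<lambda>y. \<phi> y * ((k y (w + X i) - k y w) / X i)) \<in> borel_measurable lborel" for i
        unfolding k_def by measurable
      have "integrable lborel (\<lambda>y. (real (Suc m) * 2 ^ Suc (Suc m)) * cmod (\<phi> y * (1 / (complex_of_real y - w) ^ Suc (Suc m))))"
        by (intro integrable_mult_right integrable_norm cauchy_transform_integrable \<phi> w)
      then show "integrable lborel (\<lambda>y. cmod (\<phi> y) * B y)"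
        by (simp only: B_def norm_mult mult.commute mult.left_commute)
      show "AE y in lborel. (\<lambda>i. \<phi> y * ((k y (w + X i) - k y w) / X i)) \<longlonglongrightarrow> \<phi> y * k' y w"
      proof (rule AE_I2)
        fix y
        have "((\<lambda>h. (k y (w + h) - k y w) / h) \<longlongrightarrow> k' y w) (at 0)"
          using dk[OF w] by (simp add: DERIV_def)
        then have "(\<lambda>i. (k y (w + X i) - k y w) / X i) \<longlonglongrightarrow> k' y w"
          using X(2) Xw(2) by (auto simp: tendsto_at_iff_sequentially o_def)
        then show "(\<lambda>i. \<phi> y * ((k y (w + X i) - k y w) / X i)) \<longlonglongrightarrow> \<phi> y * k' y w"
          by (intro tendsto_intros)
      qed
      show "AE y in lborel. cmod (\<phi> y * ((k y (w + X i) - k y w) / X i)) \<le> cmod (\<phi> y) * B y" for i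
        using bound[OF Xw(1)[of i]] Xw(2)[of i]
        by (intro AE_I2) (simp add: norm_mult norm_divide divide_simps mult.assoc mult_left_mono)
    qed
  qed
  moreover have "at 0 within ball 0 (\<eta>/2) = at (0::complex)"
    using \<eta> by (intro at_within_open) auto
  moreover have "(LINT y|lborel. \<phi> y * k' y w) = of_nat (Suc m) * cauchy_transform (Suc (Suc m)) \<phi> w"
    unfolding k'_def cauchy_transform_def
    by (subst integral_mult_right_zero[symmetric], intro Bochner_Integration.integral_cong refl) (simp add: mult_ac)
  ultimately show ?thesis by (simp add: DERIV_def)
qed

lemma cauchy_transform_holomorphic:
  assumes "\<phi> \<in> L2" "\<And>z. z \<in> S \<Longrightarrow> Im z \<noteq> 0"
  shows "cauchy_transform (Suc m) \<phi> holomorphic_on S"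
  using cauchy_transform_has_derivative[OF assms(1)] assms(2)
  by (meson field_differentiable_at_within field_differentiable_def holomorphic_on_def)

text \<open>
  With \<open>F\<close> the transform for exponent 1, the assumption says that \<open>- \<i> F' + (w\<^sup>2 - lam) F\<close> has second
  derivative zero on the half-plane. This expression is therefore affine; its coefficients are the two constants.
\<close>

lemma cauchy_transform_ODE:
  assumes \<phi>: "\<phi> \<in> L2"
    and eq: "\<And>w. 0 < Im w \<Longrightarrow>
      - \<i> * (3 * cauchy_transform (Suc (Suc (Suc (Suc 0)))) \<phi> w)
      + (cauchy_transform (Suc 0) \<phi> w + 2 * w * cauchy_transform (Suc (Suc 0)) \<phi> w
         + w^2 * cauchy_transform (Suc (Suc (Suc 0))) \<phi> w)
      = of_real lam * cauchy_transform (Suc (Suc (Suc 0))) \<phi> w"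
  obtains \<alpha> \<beta> where "\<And>w. 0 < Im w \<Longrightarrow>
      cauchy_transform (Suc (Suc 0)) \<phi> w = \<i> * (of_real lam - w^2) * cauchy_transform (Suc 0) \<phi> w + \<alpha> + \<beta> * w"
proof -
  define H where "H = {w. 0 < Im w}"
  have conv: "convex H" unfolding H_def by (rule convex_halfspace_Im_gt)
  define F1 F2 F3 F4 where "F1 = cauchy_transform (Suc 0) \<phi>" and "F2 = cauchy_transform (Suc (Suc 0)) \<phi>"
    and "F3 = cauchy_transform (Suc (Suc (Suc 0))) \<phi>" and "F4 = cauchy_transform (Suc (Suc (Suc (Suc 0)))) \<phi>"
  have d: "(F1 has_field_derivative F2 w) (at w)" "(F2 has_field_derivative 2 * F3 w) (at w)"
      "(F3 has_field_derivative 3 * F4 w) (at w)" if "w \<in> H" for w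
  proof -
    have "Im w \<noteq> 0" using that by (simp add: H_def)
    note D = cauchy_transform_has_derivative[OF \<phi> this]
    show "(F1 has_field_derivative F2 w) (at w)" "(F2 has_field_derivative 2 * F3 w) (at w)"
      "(F3 has_field_derivative 3 * F4 w) (at w)"
      using D[of 0] D[of 1] D[of 2] by (simp_all add: F1_def F2_def F3_def F4_def numeral_eq_Suc)
  qed
  define Q where "Q = (\<lambda>w. - \<i> * F2 w + (w^2 - of_real lam) * F1 w)"
  define Q' where "Q' = (\<lambda>w. - \<i> * (2 * F3 w) + (2 * w * F1 w + (w^2 - of_real lam) * F2 w))"
  have dQ: "(Q has_field_derivative Q' w) (at w)" if "w \<in> H" for w
    unfolding Q_def Q'_def
    by (rule derivative_eq_intros d that refl)+ (simp add: algebra_simps)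
  have dQ': "(Q' has_field_derivative 0) (at w)" if "w \<in> H" for w
  proof -
    have "(Q' has_field_derivative - \<i> * (2 * (3 * F4 w)) + ((2 * F1 w + 2 * w * F2 w) + (2 * w * F2 w + (w^2 - of_real lam) * (2 * F3 w)))) (at w)"
      unfolding Q'_def
      by (rule derivative_eq_intros d that refl)+ (simp add: algebra_simps)
    moreover have "- \<i> * (2 * (3 * F4 w)) + ((2 * F1 w + 2 * w * F2 w) + (2 * w * F2 w + (w^2 - of_real lam) * (2 * F3 w)))
      = 2 * (- \<i> * (3 * F4 w) + (F1 w + 2 * w * F2 w + w^2 * F3 w) - of_real lam * F3 w)"
      by (simp add: algebra_simps)
    moreover have "\<dots> = 0" using eq[of w] that by (simp add: H_def F1_def F2_def F3_def F4_def)
    ultimately show ?thesis by metis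
  qed
  have "\<exists>b. \<forall>w\<in>H. Q' w = b"
    by (rule has_field_derivative_zero_constant[OF conv, where f=Q']) (rule has_field_derivative_at_within[OF dQ'])
  then obtain b where b: "\<forall>w\<in>H. Q' w = b" ..
  have "((\<lambda>w. Q w - b * w) has_field_derivative Q' w - b) (at w)" if "w \<in> H" for w
    using dQ[OF that] by (auto intro!: derivative_eq_intros)
  then have zero: "((\<lambda>w. Q w - b * w) has_field_derivative 0) (at w)" if "w \<in> H" for w
    using b that by force
  have "\<exists>a. \<forall>w\<in>H. Q w - b * w = a"
    by (rule has_field_derivative_zero_constant[OF conv, where f="\<lambda>w. Q w - b * w"])
      (rule has_field_derivative_at_within[OF zero])
  then obtain a where a: "\<forall>w\<in>H. Q w - b * w = a" ..
  show thesis
  proof (rule that[of "\<i> * a" "\<i> * b"])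
    fix w assume "0 < Im w"
    then have "Q w - b * w = a" using a by (simp add: H_def)
    then have "\<i> * (- \<i> * F2 w + (w^2 - of_real lam) * F1 w) = \<i> * (a + b * w)"
      by (simp add: Q_def algebra_simps)
    then show "cauchy_transform (Suc (Suc 0)) \<phi> w = \<i> * (of_real lam - w^2) * cauchy_transform (Suc 0) \<phi> w + \<i> * a + \<i> * b * w"
      unfolding F1_def F2_def by (simp add: algebra_simps)
  qed
qed

lemma cnj_cauchy_transform:
  "cnj (cauchy_transform m \<phi> w) = cauchy_transform m (\<lambda>x. cnj (\<phi> x)) (cnj w)"
  unfolding cauchy_transform_def by (subst Bochner_Integration.integral_cnj[symmetric]) simp

lemma cauchy_transform_bound1:
  assumes "\<phi> \<in> L2" "0 < d" "d \<le> Im w"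
  shows "cmod (cauchy_transform (Suc 0) \<phi> w) \<le> sqrt (l2sq \<phi>) * sqrt (pi / d)"
proof -
  have "cmod (cauchy_transform (Suc 0) \<phi> w) \<le> sqrt (l2sq \<phi>) * sqrt (pi / Im w)"
    using cauchy_transform_bound[OF assms(1), of w 0] assms by simp
  also have "\<dots> \<le> sqrt (l2sq \<phi>) * sqrt (pi / d)"
    using assms by (intro mult_left_mono real_sqrt_le_mono divide_left_mono) auto
  finally show ?thesis .
qed

text \<open>
  The kernels \<open>1 / (y - x \<mp> \<i> e)\<close> differ by \<open>2 \<i>\<close> times the Poisson kernel, so the jump of the transform
  across the real line recovers the function as \<open>e\<close> tends to 0.
\<close>

lemma jump_eq_poisson:
  assumes \<phi>: "\<phi> \<in> L2" and e: "(e::real) > 0"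
  shows "integrable lborel (\<lambda>y. \<phi> y * of_real (e / ((y - x)^2 + e^2)))"
    and "cauchy_transform (Suc 0) \<phi> (Complex x e) - cauchy_transform (Suc 0) \<phi> (Complex x (- e))
      = 2 * \<i> * (LINT y|lborel. \<phi> y * of_real (e / ((y - x)^2 + e^2)))"
proof -
  have I1: "integrable lborel (\<lambda>y. \<phi> y * (1 / (complex_of_real y - Complex x e) ^ Suc 0))"
    and I2: "integrable lborel (\<lambda>y. \<phi> y * (1 / (complex_of_real y - Complex x (-e)) ^ Suc 0))"
    by (rule cauchy_transform_integrable[OF \<phi>]; use e in simp)+
  have eq: "\<phi> y * (1 / (complex_of_real y - Complex x e) ^ Suc 0) - \<phi> y * (1 / (complex_of_real y - Complex x (-e)) ^ Suc 0)
     = 2 * \<i> * (\<phi> y * of_real (e / ((y - x)^2 + e^2)))" for y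
  proof -
    have nz: "complex_of_real y - Complex x e \<noteq> 0" "complex_of_real y - Complex x (-e) \<noteq> 0"
      using e by (auto simp: complex_eq_iff)
    have p: "(complex_of_real y - Complex x e) * (complex_of_real y - Complex x (-e)) = of_real ((y - x)^2 + e^2)"
      by (simp add: complex_eq_iff power2_eq_square)
    have "1 / (complex_of_real y - Complex x e) - 1 / (complex_of_real y - Complex x (-e))
      = (2 * \<i> * of_real e) / ((complex_of_real y - Complex x e) * (complex_of_real y - Complex x (-e)))"
      using nz by (simp add: divide_simps) (simp add: complex_eq_iff)
    then have "\<phi> y * (1 / (complex_of_real y - Complex x e)) - \<phi> y * (1 / (complex_of_real y - Complex x (-e)))
        = \<phi> y * ((2 * \<i> * of_real e) / of_real ((y - x)^2 + e^2))"
      unfolding p by (metis right_diff_distrib)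
    then show ?thesis by (simp add: mult_ac)
  qed
  have "integrable lborel (\<lambda>y. 2 * \<i> * (\<phi> y * of_real (e / ((y - x)^2 + e^2))))"
    using Bochner_Integration.integrable_diff[OF I1 I2] unfolding eq .
  then have "integrable lborel (\<lambda>y. 1 / (2 * \<i>) * (2 * \<i> * (\<phi> y * of_real (e / ((y - x)^2 + e^2)))))"
    by (rule integrable_mult_right)
  then show "integrable lborel (\<lambda>y. \<phi> y * of_real (e / ((y - x)^2 + e^2)))"
    by simp
  show "cauchy_transform (Suc 0) \<phi> (Complex x e) - cauchy_transform (Suc 0) \<phi> (Complex x (- e))
      = 2 * \<i> * (LINT y|lborel. \<phi> y * of_real (e / ((y - x)^2 + e^2)))"
    unfolding cauchy_transform_def
    by (subst Bochner_Integration.integral_diff[OF I1 I2, symmetric])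
       (simp only: eq integral_mult_right_zero)
qed

text \<open>
  Cauchy--Schwarz with the Poisson kernel as weight, which has total mass \<open>\<pi>\<close> in either variable.
\<close>

lemma poisson_integral_L2:
  assumes \<phi>: "\<phi> \<in> L2" and e: "(e::real) > 0"
  shows "(\<integral>\<^sup>+x. ennreal ((cmod (LINT y|lborel. \<phi> y * of_real (e / ((y - x)^2 + e^2))))^2) \<partial>lborel)
           \<le> ennreal (pi^2 * l2sq \<phi>)"
proof -
  have [measurable]: "\<phi> \<in> borel_measurable borel" using \<phi> by (rule L2_measurable)
  define k where "k = (\<lambda>x y. e / ((y - x)^2 + e^2) :: real)"
  have k0: "k x y > 0" for x y unfolding k_def using e by (simp add: add_nonneg_pos)
  have kt: "(\<integral>\<^sup>+y. ennreal (k x y) \<partial>lborel) = ennreal pi" for x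
  proof -
    have "(\<integral>\<^sup>+y. ennreal (k x y) \<partial>lborel) = (\<integral>\<^sup>+y. ennreal e * ennreal (1 / ((y - x)^2 + e^2)) \<partial>lborel)"
      using e by (intro nn_integral_cong) (simp add: k_def flip: ennreal_mult)
    also have "\<dots> = ennreal e * ennreal (pi / e)"
      by (simp add: nn_integral_cmult poisson_kernel_total(3)[OF e])
    finally show ?thesis using e by (simp flip: ennreal_mult)
  qed
  have ks: "k x y = k y x" for x y by (simp add: k_def power2_commute)
  have [measurable]: "(\<lambda>(x,y). k x y) \<in> borel_measurable (borel \<Otimes>\<^sub>M borel)"
    unfolding k_def by measurable
  have km[measurable]: "k x \<in> borel_measurable borel" for x unfolding k_def by measurable
  have pt: "ennreal ((cmod (LINT y|lborel. \<phi> y * of_real (k x y)))^2)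
      \<le> (\<integral>\<^sup>+y. ennreal ((cmod (\<phi> y))^2 * k x y) \<partial>lborel) * ennreal pi" for x
  proof -
    have "ennreal (cmod (LINT y|lborel. \<phi> y * of_real (k x y)))
        \<le> (\<integral>\<^sup>+y. ennreal (cmod (\<phi> y * of_real (k x y))) \<partial>lborel)"
      by (rule integral_norm_bound_ennreal) (use jump_eq_poisson(1)[OF \<phi> e, of x] in \<open>simp add: k_def\<close>)
    also have "\<dots> = (\<integral>\<^sup>+y. ennreal (cmod (\<phi> y) * sqrt (k x y)) * ennreal (sqrt (k x y)) \<partial>lborel)"
    proof (intro nn_integral_cong)
      fix y
      have "cmod (\<phi> y * of_real (k x y)) = cmod (\<phi> y) * sqrt (k x y) * sqrt (k x y)"
        using k0[of x y] by (simp add: norm_mult mult.assoc)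
      then show "ennreal (cmod (\<phi> y * of_real (k x y))) = ennreal (cmod (\<phi> y) * sqrt (k x y)) * ennreal (sqrt (k x y))"
        using k0[of x y] by (simp add: ennreal_mult)
    qed
    finally have "(ennreal (cmod (LINT y|lborel. \<phi> y * of_real (k x y))))^2 \<le> \<dots>^2"
      by (intro power_mono) auto
    also have "\<dots> \<le> (\<integral>\<^sup>+y. (ennreal (cmod (\<phi> y) * sqrt (k x y)))^2 \<partial>lborel) * (\<integral>\<^sup>+y. (ennreal (sqrt (k x y)))^2 \<partial>lborel)"
      by (rule Cauchy_Schwarz_nn_integral) measurable
    also have "\<dots> = (\<integral>\<^sup>+y. ennreal ((cmod (\<phi> y))^2 * k x y) \<partial>lborel) * ennreal pi"
      using k0 by (simp add: ennreal_power power_mult_distrib less_imp_le kt)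
    finally show ?thesis by (simp add: ennreal_power)
  qed
  have "(\<integral>\<^sup>+x. ennreal ((cmod (LINT y|lborel. \<phi> y * of_real (k x y)))^2) \<partial>lborel)
    \<le> (\<integral>\<^sup>+x. (\<integral>\<^sup>+y. ennreal ((cmod (\<phi> y))^2 * k x y) \<partial>lborel) * ennreal pi \<partial>lborel)"
    by (rule nn_integral_mono) (rule pt)
  also have "\<dots> = (\<integral>\<^sup>+x. (\<integral>\<^sup>+y. ennreal ((cmod (\<phi> y))^2 * k x y) \<partial>lborel) \<partial>lborel) * ennreal pi"
    by (rule nn_integral_multc) measurable
  also have "(\<integral>\<^sup>+x. (\<integral>\<^sup>+y. ennreal ((cmod (\<phi> y))^2 * k x y) \<partial>lborel) \<partial>lborel)
     = (\<integral>\<^sup>+y. (\<integral>\<^sup>+x. ennreal ((cmod (\<phi> y))^2 * k x y) \<partial>lborel) \<partial>lborel)"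
    by (rule lborel_pair.Fubini') measurable
  also have "\<dots> = (\<integral>\<^sup>+y. ennreal ((cmod (\<phi> y))^2) * ennreal pi \<partial>lborel)"
  proof (intro nn_integral_cong)
    fix y
    have "(\<integral>\<^sup>+x. ennreal ((cmod (\<phi> y))^2 * k x y) \<partial>lborel) = (\<integral>\<^sup>+x. ennreal ((cmod (\<phi> y))^2) * ennreal (k y x) \<partial>lborel)"
      using k0 by (simp add: ennreal_mult less_imp_le ks[of _ y])
    also have "\<dots> = ennreal ((cmod (\<phi> y))^2) * ennreal pi"
      by (subst nn_integral_cmult) (simp_all add: kt)
    finally show "(\<integral>\<^sup>+x. ennreal ((cmod (\<phi> y))^2 * k x y) \<partial>lborel) = ennreal ((cmod (\<phi> y))^2) * ennreal pi" .
  qed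
  also have "\<dots> = ennreal (l2sq \<phi>) * ennreal pi"
    by (subst nn_integral_multc) (simp_all add: L2_normsq_eq[OF \<phi>, unfolded L2_normsq_def])
  also have "ennreal (l2sq \<phi>) * ennreal pi * ennreal pi = ennreal (pi^2 * l2sq \<phi>)"
    by (simp flip: ennreal_mult add: power2_eq_square mult_ac)
  finally show ?thesis by (simp add: k_def)
qed

lemma cauchy_transform_shift_holomorphic:
  assumes "\<phi> \<in> L2"
  shows "(\<lambda>z. cauchy_transform (Suc m) \<phi> (z + \<i> * of_real e)) holomorphic_on {z. - e < Im z}"
  by (rule holomorphic_on_compose_gen[OF _ cauchy_transform_holomorphic[OF assms, of "{z. 0 < Im z}"], unfolded o_def])
     (auto intro!: holomorphic_intros)

text \<open>
  Let \<open>f\<close> and \<open>f'\<close> be the transform at height \<open>e\<close> and \<open>- e\<close>. The product \<open>f * cnj f'\<close> extends to a bounded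
  analytic function on the upper half-plane, so its integral against \<open>N\<^sup>2 / (x\<^sup>2 + N\<^sup>2)\<close> is known from the
  Poisson formula, and \<open>f - f'\<close> is a Poisson integral. As \<open>\<bar>f\<bar>\<^sup>2 + \<bar>f'\<bar>\<^sup>2 = \<bar>f - f'\<bar>\<^sup>2 + 2 Re (f * cnj f')\<close>, this bounds
  the weighted norm of \<open>f\<close> independently of \<open>N\<close> and of \<open>e\<close>, and the weights increase to 1.
\<close>

lemma cauchy_transform_L2:
  assumes \<phi>: "\<phi> \<in> L2" and e: "(e::real) > 0"
  defines "f \<equiv> \<lambda>x. cauchy_transform (Suc 0) \<phi> (Complex x e)"
  shows "f \<in> L2" "l2sq f \<le> 6 * pi^2 * l2sq \<phi>"
proof -
  have [measurable]: "\<phi> \<in> borel_measurable borel" using \<phi> by (rule L2_measurable)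
  define f' where "f' = (\<lambda>x. cauchy_transform (Suc 0) \<phi> (Complex x (- e)))"
  define \<psi> where "\<psi> = (\<lambda>x. cnj (\<phi> x))"
  have \<psi>: "\<psi> \<in> L2" "l2sq \<psi> = l2sq \<phi>" using L2_cnj \<phi> by (auto simp: \<psi>_def)
  define G where "G = (\<lambda>z. cauchy_transform (Suc 0) \<phi> (z + \<i> * of_real e) * cauchy_transform (Suc 0) \<psi> (z + \<i> * of_real e))"
  have Gx: "G (of_real x) = f x * cnj (f' x)" for x
  proof -
    have "of_real x + \<i> * of_real e = Complex x e" "cnj (Complex x (- e)) = Complex x e" by (simp_all add: complex_eq_iff)
    then show ?thesis by (simp add: G_def f_def f'_def cnj_cauchy_transform \<psi>_def)
  qed
  have Gh: "G holomorphic_on {z. - e < Im z}"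
    unfolding G_def by (intro holomorphic_on_mult cauchy_transform_shift_holomorphic \<phi> \<psi>)
  have Gb: "cmod (G z) \<le> l2sq \<phi> * (pi / d)" if "0 < d" "d \<le> Im z + e" for d z
  proof -
    have "cmod (G z) \<le> (sqrt (l2sq \<phi>) * sqrt (pi / d)) * (sqrt (l2sq \<phi>) * sqrt (pi / d))"
      unfolding G_def norm_mult using that \<psi>
      by (intro mult_mono cauchy_transform_bound1 \<phi>) (auto intro: cauchy_transform_bound1[OF \<psi>(1), unfolded \<psi>(2)])
    also have "\<dots> = (sqrt (l2sq \<phi>))^2 * (sqrt (pi / d))^2" by (simp add: power2_eq_square mult_ac)
    also have "\<dots> = l2sq \<phi> * (pi / d)" using that by simp
    finally show ?thesis .
  qed
  have cont: "continuous_on UNIV (\<lambda>x. cauchy_transform (Suc 0) \<phi> (Complex x d))" if "d \<noteq> 0" for d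
  proof (rule continuous_on_compose2[of "{z. Im z \<noteq> 0}" "cauchy_transform (Suc 0) \<phi>"])
    show "continuous_on {z. Im z \<noteq> 0} (cauchy_transform (Suc 0) \<phi>)"
      by (intro holomorphic_on_imp_continuous_on cauchy_transform_holomorphic \<phi>) auto
    show "continuous_on UNIV (\<lambda>x. Complex x d)"
      unfolding Complex_eq by (intro continuous_intros)
  qed (use that in auto)
  have [measurable]: "f \<in> borel_measurable borel" "f' \<in> borel_measurable borel"
    unfolding f_def f'_def using e by (auto intro!: borel_measurable_continuous_onI cont)
  define D where "D = (\<lambda>x. (cmod (f x - f' x))^2)"
  have Dn: "(\<integral>\<^sup>+x. ennreal (D x) \<partial>lborel) \<le> ennreal (4 * pi^2 * l2sq \<phi>)"
  proof -
    have "(\<integral>\<^sup>+x. ennreal (D x) \<partial>lborel) = (\<integral>\<^sup>+x. 4 * ennreal ((cmod (LINT y|lborel. \<phi> y * of_real (e / ((y - x)^2 + e^2))))^2) \<partial>lborel)"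
    proof (intro nn_integral_cong)
      fix x
      have "D x = 4 * (cmod (LINT y|lborel. \<phi> y * of_real (e / ((y - x)^2 + e^2))))^2"
        unfolding D_def f_def f'_def jump_eq_poisson(2)[OF \<phi> e] by (simp add: norm_mult power_mult_distrib)
      then show "ennreal (D x) = 4 * ennreal ((cmod (LINT y|lborel. \<phi> y * of_real (e / ((y - x)^2 + e^2))))^2)"
        by (simp add: ennreal_mult)
    qed
    also have "\<dots> = 4 * (\<integral>\<^sup>+x. ennreal ((cmod (LINT y|lborel. \<phi> y * of_real (e / ((y - x)^2 + e^2))))^2) \<partial>lborel)"
      by (rule nn_integral_cmult) measurable
    also have "\<dots> \<le> 4 * ennreal (pi^2 * l2sq \<phi>)"
      by (intro mult_left_mono poisson_integral_L2 \<phi> e) auto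
    finally show ?thesis by (simp add: ennreal_mult mult.assoc)
  qed
  have [measurable]: "D \<in> borel_measurable borel" unfolding D_def by measurable
  have Di: "integrable lborel D"
    by (rule integrableI_bounded) (use Dn in \<open>auto simp: D_def intro: le_less_trans\<close>)
  have DI: "(LINT x|lborel. D x) \<le> 4 * pi^2 * l2sq \<phi>"
  proof -
    have "(LINT x|lborel. D x) = enn2real (\<integral>\<^sup>+x. ennreal (D x) \<partial>lborel)"
      by (rule integral_eq_nn_integral) (auto simp: D_def)
    also have "\<dots> \<le> 4 * pi^2 * l2sq \<phi>" by (rule enn2real_leI) (use Dn in auto)
    finally show ?thesis .
  qed
  define \<rho> where "\<rho> = (\<lambda>N x. N^2 / (x^2 + N^2) :: real)"
  have weighted: "(\<integral>\<^sup>+x. ennreal (\<rho> N x * (cmod (f x))^2) \<partial>lborel) \<le> ennreal (6 * pi^2 * l2sq \<phi>)" if N: "N > 0" for N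
  proof -
    have GI: "integrable lborel (\<lambda>x. G (of_real x) / of_real (x^2 + N^2))"
      and GE: "(LINT x|lborel. G (of_real x) / of_real (x^2 + N^2)) = of_real (pi / N) * G (\<i> * of_real N)"
      using poisson_formula_upper_half_plane[OF Gh e _ N, of "l2sq \<phi> * (pi / e)"] Gb[of e] e by auto
    define R where "R = (\<lambda>x. 2 * N^2 * Re (G (of_real x) / of_real (x^2 + N^2)))"
    have RI: "integrable lborel R" unfolding R_def by (intro integrable_mult_right integrable_Re GI)
    have "(LINT x|lborel. R x) = 2 * N^2 * Re (LINT x|lborel. G (of_real x) / of_real (x^2 + N^2))"
      unfolding R_def by (simp only: integral_mult_right_zero integral_Re[OF GI])
    also have "\<dots> \<le> 2 * N^2 * ((pi / N) * (l2sq \<phi> * (pi / N)))"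
    proof (rule mult_left_mono)
      have "Re (of_real (pi / N) * G (\<i> * of_real N)) \<le> cmod (of_real (pi / N) * G (\<i> * of_real N))"
        by (rule complex_Re_le_cmod)
      also have "\<dots> = (pi / N) * cmod (G (\<i> * of_real N))" unfolding norm_mult norm_of_real using N by simp
      also have "\<dots> \<le> (pi / N) * (l2sq \<phi> * (pi / N))"
        using N e by (intro mult_left_mono Gb) auto
      finally show "Re (LINT x|lborel. G (of_real x) / of_real (x^2 + N^2)) \<le> (pi / N) * (l2sq \<phi> * (pi / N))"
        by (simp only: GE)
    qed simp
    also have "\<dots> = 2 * pi^2 * l2sq \<phi>" using N by (simp add: power2_eq_square)
    finally have RE: "(LINT x|lborel. R x) \<le> 2 * pi^2 * l2sq \<phi>" .
    have pw: "\<rho> N x * (cmod (f x))^2 \<le> D x + R x" for x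
    proof -
      have p: "x^2 + N^2 > 0" using N by (simp add: add_nonneg_pos)
      have \<rho>: "0 \<le> \<rho> N x" "\<rho> N x \<le> 1" using p by (auto simp: \<rho>_def divide_simps)
      have "(cmod (f x))^2 \<le> (cmod (f x))^2 + (cmod (f' x))^2" by simp
      also have "\<dots> = D x + 2 * Re (f x * cnj (f' x))"
        unfolding D_def cmod_power2 by (simp add: power2_eq_square algebra_simps)
      finally have "\<rho> N x * (cmod (f x))^2 \<le> \<rho> N x * D x + \<rho> N x * (2 * Re (f x * cnj (f' x)))"
        using \<rho> by (metis mult_left_mono distrib_left)
      moreover have "\<rho> N x * D x \<le> D x" using \<rho> by (simp add: D_def mult_left_le_one_le)
      moreover have "\<rho> N x * (2 * Re (f x * cnj (f' x))) = R x"
        unfolding R_def Gx \<rho>_def Re_divide_of_real by simp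
      ultimately show ?thesis by linarith
    qed
    have "(\<integral>\<^sup>+x. ennreal (\<rho> N x * (cmod (f x))^2) \<partial>lborel) \<le> (\<integral>\<^sup>+x. ennreal (D x + R x) \<partial>lborel)"
      by (intro nn_integral_mono ennreal_leI pw)
    also have "\<dots> = ennreal (LINT x|lborel. D x + R x)"
    proof (rule nn_integral_eq_integral)
      show "integrable lborel (\<lambda>x. D x + R x)" using Di RI by simp
      have "0 \<le> \<rho> N x * (cmod (f x))^2" for x by (simp add: \<rho>_def)
      then show "AE x in lborel. 0 \<le> D x + R x" using pw by (intro AE_I2) (meson order_trans)
    qed
    also have "\<dots> \<le> ennreal (6 * pi^2 * l2sq \<phi>)"
      using Di RI DI RE by (intro ennreal_leI) simp
    finally show ?thesis .
  qed
  have "L2_normsq f = (\<integral>\<^sup>+x. liminf (\<lambda>n. ennreal (\<rho> (real (Suc n)) x * (cmod (f x))^2)) \<partial>lborel)"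
    unfolding L2_normsq_def
  proof (intro nn_integral_cong)
    fix x
    have "(\<lambda>n. \<rho> (real (Suc n)) x) \<longlonglongrightarrow> 1"
      unfolding \<rho>_def by real_asymp
    then have "(\<lambda>n. ennreal (\<rho> (real (Suc n)) x * (cmod (f x))^2)) \<longlonglongrightarrow> ennreal (1 * (cmod (f x))^2)"
      by (intro tendsto_ennrealI tendsto_mult tendsto_const)
    then show "ennreal ((cmod (f x))^2) = liminf (\<lambda>n. ennreal (\<rho> (real (Suc n)) x * (cmod (f x))^2))"
      by (subst lim_imp_Liminf) auto
  qed
  also have "\<dots> \<le> liminf (\<lambda>n. \<integral>\<^sup>+x. ennreal (\<rho> (real (Suc n)) x * (cmod (f x))^2) \<partial>lborel)"
    by (rule nn_integral_liminf) (simp add: \<rho>_def)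
  also have "\<dots> \<le> ennreal (6 * pi^2 * l2sq \<phi>)"
    by (intro Liminf_le always_eventually allI weighted) auto
  finally have le: "L2_normsq f \<le> ennreal (6 * pi^2 * l2sq \<phi>)" .
  then show "f \<in> L2" by (auto simp: L2_def intro: le_less_trans)
  show "l2sq f \<le> 6 * pi^2 * l2sq \<phi>" unfolding l2sq_def[of f] by (intro enn2real_leI le) simp
qed

section \<open>The virial identity\<close>

text \<open>
  Multiplying the equation by \<open>cnj P\<close> eliminates the quadratic coefficient, because
  \<open>\<i> (lam - x\<^sup>2) f + \<alpha> + \<beta> x = \<i> lam f - \<i> x P + \<alpha>\<close> and \<open>\<i> x P * cnj P\<close> is imaginary. The real part then reads
  \<open>S' = \<bar>f\<bar>\<^sup>2 / 2 + lam Re (cnj \<beta> f) + Re (cnj \<alpha> P) + Re (r cnj P)\<close> with \<open>S = x \<bar>f\<bar>\<^sup>2 / 2 + Im (cnj \<beta> f)\<close>.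
  The terms with \<open>\<beta> f\<close> and \<open>\<alpha> P\<close> may decay only like \<open>1 / x\<close>, so the identity is integrated against
  \<open>N\<^sup>2 / (x\<^sup>2 + N\<^sup>2)\<close>, for which their integrals are explicit by the Poisson formula. The perturbation \<open>r\<close>
  accounts for working at height \<open>e\<close> above the real line; it is quadratically large in \<open>x\<close> when multiplied
  by \<open>P\<close>, which the weight compensates at the price of a factor \<open>N\<^sup>2\<close>.
\<close>

lemma weighted_virial_inequality:
  fixes f P r :: "real \<Rightarrow> complex" and lam e N B K :: real
  assumes deriv: "\<And>x. (f has_vector_derivative
        \<i> * of_real (lam - x^2) * f x + (\<alpha> + \<beta> * of_real x + r x)) (at x)"
    and P: "\<And>x. P x = of_real x * f x + \<i> * \<beta>"
    and rdef: "\<And>x. r x = of_real e * ((2 * of_real x + \<i> * of_real e) * f x + \<i> * \<beta>)"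
    and e: "0 \<le> e" "e \<le> 1" and N: "N > 0"
    and bnd: "\<And>x. cmod (f x) \<le> B" and f2: "f \<in> L2" "l2sq f \<le> K"
  shows "- (LINT x|lborel. N^2 / (x^2 + N^2) * (lam * Re (cnj \<beta> * f x) + Re (cnj \<alpha> * P x)))
     \<le> 2 * K + pi * (cmod \<beta>)^2 / (2 * N) + e * ((8 * N^2 + 1) * K + 9 * pi * N * (cmod \<beta>)^2)"
proof -
  define \<rho> \<rho>' where "\<rho> = (\<lambda>x. N^2 / (x^2 + N^2) :: real)" and "\<rho>' = (\<lambda>x. - (2 * x * N^2) / (x^2 + N^2)^2 :: real)"
  have r: "r x = of_real e * (2 * P x - \<i> * \<beta> + \<i> * of_real e * f x)" for x
    unfolding rdef P by (simp add: algebra_simps)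
  have pos: "x^2 + N^2 > 0" for x :: real using N by (simp add: add_nonneg_pos)
  have d\<rho>: "(\<rho> has_real_derivative \<rho>' x) (at x)" for x
    unfolding \<rho>_def \<rho>'_def using pos[of x]
    by (auto intro!: derivative_eq_intros simp: power2_eq_square)
  have \<rho>0: "0 \<le> \<rho> x" and \<rho>1: "\<rho> x \<le> 1" and \<rho>x: "\<rho> x * x^2 \<le> N^2" for x
    using pos[of x] by (auto simp: \<rho>_def divide_simps mult_left_mono)
  have \<rho>'x: "\<bar>\<rho>' x\<bar> * \<bar>x\<bar> \<le> 2 * \<rho> x" for x
  proof -
    have "\<bar>\<rho>' x\<bar> * \<bar>x\<bar> = 2 * \<rho> x * (x^2 / (x^2 + N^2))"
      using pos[of x] by (simp add: \<rho>'_def \<rho>_def abs_mult power2_eq_square)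
    also have "\<dots> \<le> 2 * \<rho> x * 1"
      using pos[of x] \<rho>0[of x] by (intro mult_left_mono) (auto simp: divide_simps)
    finally show ?thesis by simp
  qed
  have \<rho>'N: "\<bar>\<rho>' x\<bar> \<le> \<rho> x / N" for x
  proof -
    have "\<bar>\<rho>' x\<bar> = \<rho> x * (2 * \<bar>x\<bar> / (x^2 + N^2))"
      using pos[of x] by (simp add: \<rho>'_def \<rho>_def abs_mult power2_eq_square)
    also have "\<dots> \<le> \<rho> x * (1 / N)"
    proof (rule mult_left_mono)
      have "0 \<le> (\<bar>x\<bar> - N)^2" by simp
      then show "2 * \<bar>x\<bar> / (x^2 + N^2) \<le> 1 / N"
        using pos[of x] N by (simp add: divide_simps power2_eq_square algebra_simps)
    qed (rule \<rho>0)
    finally show ?thesis by simp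
  qed
  have \<rho>int: "integrable lborel \<rho>" and \<rho>tot: "(LINT x|lborel. \<rho> x) = pi * N"
    using poisson_kernel_total[OF N, of 0] N
    unfolding \<rho>_def by (simp_all only: times_divide_eq_right[of "N^2" 1, unfolded mult_1_right, symmetric] integrable_mult_right integral_mult_right_zero diff_0_right)
      (simp add: power2_eq_square)
  note f2i = L2_integrable_square[OF f2(1)]
  have cf: "continuous_on UNIV f"
    using deriv by (meson continuous_at_imp_continuous_on has_vector_derivative_continuous)
  have [measurable]: "f \<in> borel_measurable borel" using cf by (rule borel_measurable_continuous_onI)
  have [measurable]: "P \<in> borel_measurable borel" unfolding P[abs_def] by measurable
  have [measurable]: "r \<in> borel_measurable borel" unfolding r[abs_def] by measurable
  have [measurable]: "\<rho> \<in> borel_measurable borel" "\<rho>' \<in> borel_measurable borel" unfolding \<rho>_def \<rho>'_def by measurable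
  define S where "S = (\<lambda>x. x * (cmod (f x))^2 / 2 + Im (cnj \<beta> * f x))"
  have [measurable]: "S \<in> borel_measurable borel" unfolding S_def by measurable
  define s where "s = (\<lambda>x. (cmod (f x))^2 / 2 + lam * Re (cnj \<beta> * f x) + Re (cnj \<alpha> * P x) + Re (r x * cnj (P x)))"
  have dS: "(S has_real_derivative s x) (at x)" for x
  proof -
    define f' where "f' = \<i> * of_real (lam - x^2) * f x + (\<alpha> + \<beta> * of_real x + r x)"
    have D: "(f has_vector_derivative f') (at x)" unfolding f'_def by (rule deriv)
    define u v where "u = (\<lambda>x. Re (f x))" and "v = (\<lambda>x. Im (f x))"
    have DR: "(u has_real_derivative Re f') (at x)" and DI: "(v has_real_derivative Im f') (at x)"
      using bounded_linear.has_vector_derivative[OF bounded_linear_Re D]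
        bounded_linear.has_vector_derivative[OF bounded_linear_Im D]
      by (simp_all add: has_real_derivative_iff_has_vector_derivative u_def v_def)
    have eq: "S = (\<lambda>x. x * ((u x)^2 + (v x)^2) / 2 + (Re \<beta> * v x - Im \<beta> * u x))"
      by (simp add: S_def cmod_power2 fun_eq_iff u_def v_def)
    have "(S has_real_derivative
       (((u x)^2 + (v x)^2) + x * (2 * u x * Re f' + 2 * v x * Im f')) / 2 + (Re \<beta> * Im f' - Im \<beta> * Re f')) (at x)"
      unfolding eq by (auto intro!: derivative_eq_intros DR DI simp: algebra_simps)
    then have "(S has_real_derivative
       (((Re (f x))^2 + (Im (f x))^2) + x * (2 * Re (f x) * Re f' + 2 * Im (f x) * Im f')) / 2 + (Re \<beta> * Im f' - Im \<beta> * Re f')) (at x)"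
      by (simp only: u_def v_def)
    moreover have "(((Re (f x))^2 + (Im (f x))^2) + x * (2 * Re (f x) * Re f' + 2 * Im (f x) * Im f')) / 2 + (Re \<beta> * Im f' - Im \<beta> * Re f') = s x"
    proof -
      have R: "Re f' = - (lam - x^2) * Im (f x) + Re \<alpha> + Re \<beta> * x + Re (r x)"
        and I: "Im f' = (lam - x^2) * Re (f x) + Im \<alpha> + Im \<beta> * x + Im (r x)"
        by (simp_all add: f'_def) (simp add: algebra_simps)?
      have S: "s x = ((Re (f x))^2 + (Im (f x))^2) / 2 + lam * (Re \<beta> * Re (f x) + Im \<beta> * Im (f x))
          + (Re \<alpha> * (x * Re (f x) - Im \<beta>) + Im \<alpha> * (x * Im (f x) + Re \<beta>))
          + (Re (r x) * (x * Re (f x) - Im \<beta>) + Im (r x) * (x * Im (f x) + Re \<beta>))"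
        by (simp add: s_def P cmod_power2 algebra_simps)
      show ?thesis unfolding R I S by algebra
    qed
    ultimately show ?thesis by simp
  qed
  define U V where "U = (\<lambda>x. \<rho>' x * S x + \<rho> x * ((cmod (f x))^2 / 2 + Re (r x * cnj (P x))))"
    and "V = (\<lambda>x. \<rho> x * (lam * Re (cnj \<beta> * f x) + Re (cnj \<alpha> * P x)))"
  have dUV: "((\<lambda>x. \<rho> x * S x) has_real_derivative U x + V x) (at x)" for x
    using DERIV_mult[OF d\<rho>[of x] dS[of x]] by (simp add: U_def V_def s_def algebra_simps)
  \<comment> \<open>\<open>W\<close> collects the boundary terms, the error \<open>r\<close> and \<open>\<bar>f\<bar>\<^sup>2 / 2\<close>; it is integrated exactly below.\<close>
  define W where "W = (\<lambda>x. (2 + e * (8 * N^2 + 1)) * (cmod (f x))^2 + ((cmod \<beta>)^2 / (2 * N^2) + 9 * e * (cmod \<beta>)^2) * \<rho> x)"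
  have amgm: "a * b \<le> (a^2 + b^2) / 2" for a b :: real
    using sum_squares_bound[of a b] by simp
  have Px: "cmod (P x) \<le> \<bar>x\<bar> * cmod (f x) + cmod \<beta>" for x
    unfolding P by (rule order_trans[OF norm_triangle_ineq]) (simp add: norm_mult)
  have UW: "\<bar>U x\<bar> \<le> W x" for x
  proof -
    define a b p where "a = cmod (f x)" and "b = cmod \<beta>" and "p = cmod (P x)"
    have nn: "0 \<le> a" "0 \<le> b" "0 \<le> p" by (auto simp: a_def b_def p_def)
    have S: "\<bar>S x\<bar> \<le> \<bar>x\<bar> * a^2 / 2 + b * a"
    proof -
      have "\<bar>Im (cnj \<beta> * f x)\<bar> \<le> b * a"
        using abs_Im_le_cmod[of "cnj \<beta> * f x"] by (simp add: norm_mult a_def b_def)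
      then show ?thesis unfolding S_def a_def[symmetric]
        using abs_triangle_ineq[of "x * a^2 / 2" "Im (cnj \<beta> * f x)"] by (simp add: abs_mult)
    qed
    have "\<bar>\<rho>' x * S x\<bar> \<le> \<bar>\<rho>' x\<bar> * \<bar>x\<bar> * (a^2 / 2) + \<bar>\<rho>' x\<bar> * (b * a)"
      unfolding abs_mult using mult_left_mono[OF S, of "\<bar>\<rho>' x\<bar>"] by (simp add: algebra_simps)
    also have "\<dots> \<le> 2 * \<rho> x * (a^2 / 2) + \<rho> x / N * (b * a)"
      using \<rho>'x[of x] \<rho>'N[of x] nn by (intro add_mono mult_right_mono) auto
    also have "\<rho> x / N * (b * a) = \<rho> x * ((b / N) * a)" by simp
    also have "\<dots> \<le> \<rho> x * (((b / N)^2 + a^2) / 2)"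
      by (intro mult_left_mono amgm \<rho>0)
    finally have 1: "\<bar>\<rho>' x * S x\<bar> \<le> 3 / 2 * (\<rho> x * a^2) + b^2 / (2 * N^2) * \<rho> x"
      by (simp add: power_divide field_simps)
    have "cmod (r x) \<le> e * (2 * p + b + e * a)"
    proof -
      have "cmod (2 * P x - \<i> * \<beta> + \<i> * of_real e * f x) \<le> 2 * p + b + e * a"
        using norm_triangle_ineq[of "2 * P x - \<i> * \<beta>" "\<i> * of_real e * f x"] norm_triangle_ineq4[of "2 * P x" "\<i> * \<beta>"] e
        by (simp add: norm_mult a_def b_def p_def)
      then show ?thesis unfolding r using e by (simp add: norm_mult mult_left_mono)
    qed
    then have "cmod (r x) * p \<le> e * (2 * p + b + e * a) * p" using nn by (intro mult_right_mono)
    also have "\<dots> = e * (2 * p^2 + b * p + e * (a * p))" by (simp add: power2_eq_square algebra_simps)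
    also have "\<dots> \<le> e * (2 * p^2 + (b^2 + p^2) / 2 + 1 * ((a^2 + p^2) / 2))"
      using e nn by (intro mult_left_mono add_mono amgm mult_mono order_refl) auto
    also have "\<dots> \<le> e * (4 * p^2 + b^2 + a^2)"
      by (rule mult_left_mono[OF _ e(1)])
         (use zero_le_power2[of p] zero_le_power2[of a] zero_le_power2[of b] in \<open>simp add: field_simps\<close>)
    finally have rp: "cmod (r x) * p \<le> e * (4 * p^2 + b^2 + a^2)" .
    have "p^2 \<le> (\<bar>x\<bar> * a + b)^2" using Px[of x] nn by (intro power_mono) (auto simp: a_def b_def p_def)
    also have "\<dots> \<le> 2 * (x^2 * a^2) + 2 * b^2"
      using sum_squares_bound[of "\<bar>x\<bar> * a" b] by (simp add: power2_sum power_mult_distrib ac_simps)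
    finally have "\<rho> x * (cmod (r x) * p) \<le> \<rho> x * (e * (4 * (2 * (x^2 * a^2) + 2 * b^2) + b^2 + a^2))"
      by (intro mult_left_mono order_trans[OF rp] \<rho>0 e) auto
    also have "\<dots> = e * (8 * (\<rho> x * x^2) * a^2 + 9 * b^2 * \<rho> x + \<rho> x * a^2)"
      by (simp add: algebra_simps)
    also have "\<dots> \<le> e * (8 * N^2 * a^2 + 9 * b^2 * \<rho> x + 1 * a^2)"
      by (intro mult_left_mono add_mono mult_right_mono \<rho>x \<rho>1 e order_refl) auto
    finally have 2: "\<rho> x * (cmod (r x) * p) \<le> e * (8 * N^2 * a^2 + 9 * b^2 * \<rho> x + a^2)" by simp
    have "\<bar>Re (r x * cnj (P x))\<bar> \<le> cmod (r x) * p"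
      using abs_Re_le_cmod[of "r x * cnj (P x)"] by (simp add: norm_mult p_def)
    then have "\<bar>a^2 / 2 + Re (r x * cnj (P x))\<bar> \<le> a^2 / 2 + cmod (r x) * p"
      by (intro order_trans[OF abs_triangle_ineq]) simp
    from mult_left_mono[OF this \<rho>0[of x]]
    have 3: "\<bar>\<rho> x * (a^2 / 2 + Re (r x * cnj (P x)))\<bar> \<le> \<rho> x * a^2 / 2 + \<rho> x * (cmod (r x) * p)"
      unfolding abs_mult abs_of_nonneg[OF \<rho>0[of x]] by (simp only: distrib_left times_divide_eq_right)
    have 4: "\<rho> x * a^2 \<le> a^2" using \<rho>1[of x] \<rho>0[of x] by (simp add: mult_left_le_one_le)
    have "\<bar>U x\<bar> \<le> \<bar>\<rho>' x * S x\<bar> + \<bar>\<rho> x * (a^2 / 2 + Re (r x * cnj (P x)))\<bar>"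
      unfolding U_def a_def by (rule abs_triangle_ineq)
    also have "\<dots> \<le> 2 * a^2 + b^2 / (2 * N^2) * \<rho> x + e * (8 * N^2 * a^2 + 9 * b^2 * \<rho> x + a^2)"
      using 1 2 3 4 by linarith
    also have "\<dots> = W x" unfolding W_def a_def[symmetric] b_def[symmetric] by (simp add: algebra_simps)
    finally show ?thesis .
  qed
  have Wint: "integrable lborel W"
    unfolding W_def using \<rho>int f2i(1) by (intro Bochner_Integration.integrable_add integrable_mult_right)
  have Uint: "integrable lborel U"
    by (rule Bochner_Integration.integrable_bound[OF Wint])
       (use UW in \<open>auto simp: U_def intro: order_trans[OF _ abs_ge_self]\<close>)
  have Vint: "integrable lborel V"
  proof (rule Bochner_Integration.integrable_bound)
    define C where "C = (\<bar>lam\<bar> * cmod \<beta>)^2 + (cmod \<alpha> * N)^2 + cmod \<alpha> * cmod \<beta>"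
    show "integrable lborel (\<lambda>x. (cmod (f x))^2 + C * \<rho> x)"
      using \<rho>int f2i(1) by (intro Bochner_Integration.integrable_add integrable_mult_right)
    show "V \<in> borel_measurable lborel" unfolding V_def by measurable
    show "AE x in lborel. norm (V x) \<le> norm ((cmod (f x))^2 + C * \<rho> x)"
    proof (rule AE_I2)
      fix x
      define a where "a = cmod (f x)"
      have a0: "a \<ge> 0" by (simp add: a_def)
      have "\<bar>lam * Re (cnj \<beta> * f x)\<bar> \<le> \<bar>lam\<bar> * cmod \<beta> * a"
        using abs_Re_le_cmod[of "cnj \<beta> * f x"] by (simp add: abs_mult norm_mult a_def mult_left_mono mult.assoc)
      moreover have "\<bar>Re (cnj \<alpha> * P x)\<bar> \<le> cmod \<alpha> * (\<bar>x\<bar> * a + cmod \<beta>)"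
        using abs_Re_le_cmod[of "cnj \<alpha> * P x"] mult_left_mono[OF Px[of x], of "cmod \<alpha>"] by (simp add: norm_mult a_def)
      ultimately have "\<bar>V x\<bar> \<le> \<rho> x * (\<bar>lam\<bar> * cmod \<beta> * a + cmod \<alpha> * (\<bar>x\<bar> * a + cmod \<beta>))"
        unfolding V_def abs_mult[of "\<rho> x"] abs_of_nonneg[OF \<rho>0[of x]]
        by (intro mult_left_mono[OF _ \<rho>0[of x]] order_trans[OF abs_triangle_ineq] add_mono)
      also have "\<dots> = (\<rho> x * (\<bar>lam\<bar> * cmod \<beta>)) * a + (\<rho> x * cmod \<alpha> * \<bar>x\<bar>) * a + cmod \<alpha> * cmod \<beta> * \<rho> x"
        by (simp add: algebra_simps)
      also have "\<dots> \<le> ((\<rho> x * (\<bar>lam\<bar> * cmod \<beta>))^2 + a^2) / 2 + ((\<rho> x * cmod \<alpha> * \<bar>x\<bar>)^2 + a^2) / 2 + cmod \<alpha> * cmod \<beta> * \<rho> x"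
        by (intro add_mono amgm order_refl)
      also have "\<dots> \<le> a^2 + (\<rho> x * (\<bar>lam\<bar> * cmod \<beta>))^2 + (\<rho> x * cmod \<alpha> * \<bar>x\<bar>)^2 + cmod \<alpha> * cmod \<beta> * \<rho> x"
        using zero_le_power2[of "\<rho> x * (\<bar>lam\<bar> * cmod \<beta>)"] zero_le_power2[of "\<rho> x * cmod \<alpha> * \<bar>x\<bar>"]
        by (simp add: field_simps)
      also have "\<dots> = a^2 + \<rho> x * \<rho> x * (\<bar>lam\<bar> * cmod \<beta>)^2 + (\<rho> x * x^2) * ((cmod \<alpha>)^2 * \<rho> x) + cmod \<alpha> * cmod \<beta> * \<rho> x"
        by (simp add: power_mult_distrib power2_eq_square[of "\<rho> x"] mult_ac)
      also have "\<dots> \<le> a^2 + 1 * \<rho> x * (\<bar>lam\<bar> * cmod \<beta>)^2 + N^2 * ((cmod \<alpha>)^2 * \<rho> x) + cmod \<alpha> * cmod \<beta> * \<rho> x"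
        using \<rho>0[of x] by (intro add_mono mult_right_mono \<rho>x \<rho>1 order_refl) auto
      also have "\<dots> = a^2 + C * \<rho> x" by (simp add: C_def algebra_simps power_mult_distrib)
      finally show "norm (V x) \<le> norm ((cmod (f x))^2 + C * \<rho> x)" by (simp add: a_def)
    qed
  qed
  have B: "B \<ge> 0" using bnd[of 0] norm_ge_zero order_trans by blast
  have lim: "((\<lambda>x. \<rho> x * S x) \<longlongrightarrow> 0) F" if F: "((\<lambda>x. \<rho> x * (\<bar>x\<bar> * B^2 / 2 + cmod \<beta> * B)) \<longlongrightarrow> 0) F" for F
  proof (rule Lim_null_comparison[OF always_eventually F], rule allI)
    fix x
    have "\<bar>S x\<bar> \<le> \<bar>x * (cmod (f x))^2 / 2\<bar> + \<bar>Im (cnj \<beta> * f x)\<bar>"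
      unfolding S_def by (rule abs_triangle_ineq)
    also have "\<dots> \<le> \<bar>x\<bar> * B^2 / 2 + cmod \<beta> * B"
    proof (rule add_mono)
      show "\<bar>x * (cmod (f x))^2 / 2\<bar> \<le> \<bar>x\<bar> * B^2 / 2"
        using bnd[of x] by (simp add: abs_mult mult_left_mono power_mono)
      show "\<bar>Im (cnj \<beta> * f x)\<bar> \<le> cmod \<beta> * B"
        using abs_Im_le_cmod[of "cnj \<beta> * f x"] mult_left_mono[OF bnd[of x], of "cmod \<beta>"] by (simp add: norm_mult)
    qed
    finally show "norm (\<rho> x * S x) \<le> \<rho> x * (\<bar>x\<bar> * B^2 / 2 + cmod \<beta> * B)"
      using \<rho>0[of x] by (simp add: abs_mult mult_left_mono)
  qed
  have "(LINT x|lborel. U x + V x) = 0 - 0"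
  proof (rule integral_derivative_whole_line[OF dUV])
    show "integrable lborel (\<lambda>x. U x + V x)" using Uint Vint by (rule Bochner_Integration.integrable_add)
    show "((\<lambda>x. \<rho> x * S x) \<longlongrightarrow> 0) at_top"
    proof (rule lim)
      show "((\<lambda>x. \<rho> x * (\<bar>x\<bar> * B^2 / 2 + cmod \<beta> * B)) \<longlongrightarrow> 0) at_top"
        unfolding \<rho>_def by real_asymp
    qed
    show "((\<lambda>x. \<rho> x * S x) \<longlongrightarrow> 0) at_bot"
    proof (rule lim)
      show "((\<lambda>x. \<rho> x * (\<bar>x\<bar> * B^2 / 2 + cmod \<beta> * B)) \<longlongrightarrow> 0) at_bot"
        unfolding \<rho>_def by real_asymp
    qed
  qed
  then have "- (LINT x|lborel. V x) = (LINT x|lborel. U x)" using Uint Vint by simp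
  also have "\<dots> \<le> (LINT x|lborel. W x)"
    using UW by (intro integral_mono Uint Wint) (meson abs_le_D1)
  also have "\<dots> = (2 + e * (8 * N^2 + 1)) * l2sq f + ((cmod \<beta>)^2 / (2 * N^2) + 9 * e * (cmod \<beta>)^2) * (pi * N)"
    unfolding W_def using \<rho>int f2i \<rho>tot
    by (subst Bochner_Integration.integral_add) (auto intro: integrable_mult_right)
  also have "\<dots> \<le> (2 + e * (8 * N^2 + 1)) * K + ((cmod \<beta>)^2 / (2 * N^2) + 9 * e * (cmod \<beta>)^2) * (pi * N)"
    using f2(2) e by (intro add_mono mult_left_mono order_refl) auto
  also have "\<dots> = 2 * K + pi * (cmod \<beta>)^2 / (2 * N) + e * ((8 * N^2 + 1) * K + 9 * pi * N * (cmod \<beta>)^2)"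
    using N by (simp add: field_simps power2_eq_square)
  finally show ?thesis by (simp add: V_def \<rho>_def)
qed

text \<open>
  The equation on the line of height \<open>e\<close>, with the powers of \<open>x + \<i> e\<close> expanded: all deviations from the
  equation on the real line are collected in the last term.
\<close>

lemma cauchy_transform_horizontal_line:
  assumes \<phi>: "\<phi> \<in> L2" and e: "0 < e"
    and ode: "\<And>w. 0 < Im w \<Longrightarrow> cauchy_transform (Suc (Suc 0)) \<phi> w
        = \<i> * (of_real lam - w^2) * cauchy_transform (Suc 0) \<phi> w + \<alpha> + \<beta> * w"
  defines "f \<equiv> \<lambda>x. cauchy_transform (Suc 0) \<phi> (Complex x e)"
  shows "(f has_vector_derivative \<i> * of_real (lam - x^2) * f x
      + (\<alpha> + \<beta> * of_real x + of_real e * ((2 * of_real x + \<i> * of_real e) * f x + \<i> * \<beta>))) (at x)"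
proof -
  have "((\<lambda>x. of_real x + \<i> * of_real e) has_vector_derivative 1) (at x)"
    by (auto intro!: derivative_eq_intros simp: has_vector_derivative_def scaleR_conv_of_real)
  then have "((\<lambda>x. Complex x e) has_vector_derivative 1) (at x)"
    by (simp add: Complex_eq)
  from field_vector_diff_chain_at[OF this cauchy_transform_has_derivative[OF \<phi>, of _ 0]] e
  have "(f has_vector_derivative cauchy_transform (Suc (Suc 0)) \<phi> (Complex x e)) (at x)"
    by (simp add: f_def o_def)
  also have "cauchy_transform (Suc (Suc 0)) \<phi> (Complex x e) = \<i> * (of_real lam - (Complex x e)^2) * f x + \<alpha> + \<beta> * Complex x e"
    using ode[of "Complex x e"] e by (simp add: f_def)
  also have "\<dots> = \<i> * of_real (lam - x^2) * f x
      + (\<alpha> + \<beta> * of_real x + of_real e * ((2 * of_real x + \<i> * of_real e) * f x + \<i> * \<beta>))"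
    unfolding Complex_eq by (simp add: power2_eq_square algebra_simps)
  finally show ?thesis .
qed

text \<open>
  The Poisson formula turns the left side of the weighted virial inequality into
  \<open>- \<pi> N Re (lam cnj \<beta> F + cnj \<alpha> (\<i> N F + \<i> \<beta>))\<close> at \<open>\<i> N\<close>, once \<open>e\<close> has tended to 0. By the equation
  \<open>N (\<i> N F + \<i> \<beta>) = F' - \<i> lam F - \<alpha>\<close> at \<open>\<i> N\<close>, and \<open>F\<close>, \<open>F'\<close> vanish at infinity along the imaginary axis.
  So \<open>N F\<close> tends to \<open>- \<beta>\<close> and \<open>N (\<i> N F + \<i> \<beta>)\<close> to \<open>- \<alpha>\<close>, and the left side to
  \<open>\<pi> (lam \<bar>\<beta>\<bar>\<^sup>2 + \<bar>\<alpha>\<bar>\<^sup>2)\<close>.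
\<close>

lemma ODE_coefficient_bound:
  assumes \<phi>: "\<phi> \<in> L2"
    and ode: "\<And>w. 0 < Im w \<Longrightarrow> cauchy_transform (Suc (Suc 0)) \<phi> w
        = \<i> * (of_real lam - w^2) * cauchy_transform (Suc 0) \<phi> w + \<alpha> + \<beta> * w"
  shows "lam * (cmod \<beta>)^2 + (cmod \<alpha>)^2 \<le> 12 * pi * l2sq \<phi>"
proof -
  define F F2 where "F = cauchy_transform (Suc 0) \<phi>" and "F2 = cauchy_transform (Suc (Suc 0)) \<phi>"
  define K where "K = 6 * pi^2 * l2sq \<phi>"
  define s where "s = sqrt (l2sq \<phi>)"
  have s0: "s \<ge> 0" by (simp add: s_def)
  have dF: "(F has_field_derivative F2 w) (at w)" if "0 < Im w" for w
    using cauchy_transform_has_derivative[OF \<phi>, of w 0] that by (simp add: F_def F2_def)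
  have Fb: "cmod (F w) \<le> s * sqrt (pi / d)" if "0 < d" "d \<le> Im w" for w d
    using cauchy_transform_bound1[OF \<phi> that] by (simp add: F_def s_def)
  have F2b: "cmod (F2 w) \<le> s * sqrt (pi / d * (1 / d^2))" if "0 < d" "d \<le> Im w" for w d
  proof -
    have "cmod (F2 w) \<le> s * sqrt (pi / \<bar>Im w\<bar> * (1 / (Im w)^2))"
      using cauchy_transform_bound[OF \<phi>, of w 1] that by (simp add: F2_def s_def)
    also have "\<dots> \<le> s * sqrt (pi / d * (1 / d^2))"
      using that s0 by (intro mult_left_mono real_sqrt_le_mono mult_mono divide_left_mono power_mono) auto
    finally show ?thesis .
  qed
  define L where "L = (\<lambda>N e. - (pi * N) * Re (of_real lam * cnj \<beta> * F (\<i> * of_real (N + e))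
      + cnj \<alpha> * (\<i> * of_real N * F (\<i> * of_real (N + e)) + \<i> * \<beta>)))"
  have main: "L N e \<le> 2 * K + pi * (cmod \<beta>)^2 / (2 * N) + e * ((8 * N^2 + 1) * K + 9 * pi * N * (cmod \<beta>)^2)"
    if N: "N > 0" and e: "0 < e" "e \<le> 1" for N e
  proof -
    define f where "f = (\<lambda>x. F (Complex x e))"
    define P where "P = (\<lambda>x. of_real x * f x + \<i> * \<beta>)"
    define r where "r = (\<lambda>x. of_real e * ((2 * of_real x + \<i> * of_real e) * f x + \<i> * \<beta>))"
    \<comment> \<open>Bounded, as the equation expresses \<open>w F + \<i> \<beta>\<close> by bounded functions divided by \<open>w\<close>.\<close>
    define g where "g = (\<lambda>z. of_real lam * cnj \<beta> * F (z + \<i> * of_real e) + cnj \<alpha> * (z * F (z + \<i> * of_real e) + \<i> * \<beta>))"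
    have vir: "- (LINT x|lborel. N^2 / (x^2 + N^2) * (lam * Re (cnj \<beta> * f x) + Re (cnj \<alpha> * P x)))
     \<le> 2 * K + pi * (cmod \<beta>)^2 / (2 * N) + e * ((8 * N^2 + 1) * K + 9 * pi * N * (cmod \<beta>)^2)"
    proof (rule weighted_virial_inequality)
      fix x
      show "(f has_vector_derivative \<i> * of_real (lam - x^2) * f x + (\<alpha> + \<beta> * of_real x + r x)) (at x)"
        using cauchy_transform_horizontal_line[OF \<phi> e(1) ode] by (simp only: f_def F_def r_def)
      show "cmod (f x) \<le> s * sqrt (pi / e)" unfolding f_def using e by (intro Fb) auto
    next
      show "f \<in> L2" "l2sq f \<le> K"
        using cauchy_transform_L2[OF \<phi> e(1)] by (auto simp: f_def F_def K_def)
    qed (use e N in \<open>auto simp: P_def r_def\<close>)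
    have gh: "g holomorphic_on {z. - e < Im z}"
      unfolding g_def F_def
      by (intro holomorphic_intros cauchy_transform_shift_holomorphic \<phi>)
    have gb: "cmod (g z) \<le> \<bar>lam\<bar> * cmod \<beta> * (s * sqrt (pi / e))
        + cmod \<alpha> * ((s * sqrt (pi / e * (1 / e^2)) + \<bar>lam\<bar> * (s * sqrt (pi / e)) + cmod \<alpha>) / e + e * (s * sqrt (pi / e)))"
      if z: "0 \<le> Im z" for z
    proof -
      define w where "w = z + \<i> * of_real e"
      have w: "e \<le> Im w" using z by (simp add: w_def)
      have w0: "e \<le> cmod w" using w abs_Im_le_cmod[of w] by linarith
      have wn: "w \<noteq> 0" using w0 e by auto
      have "F2 w = \<i> * (of_real lam - w^2) * F w + \<alpha> + \<beta> * w"
        using ode[of w] w e by (simp add: F2_def F_def)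
      then have "w * (w * F w + \<i> * \<beta>) = \<i> * F2 w + of_real lam * F w - \<i> * \<alpha>"
        by (simp only:) (simp add: power2_eq_square algebra_simps)
      then have eq: "w * F w + \<i> * \<beta> = (\<i> * F2 w + of_real lam * F w - \<i> * \<alpha>) / w"
        using wn by (simp add: nonzero_eq_divide_eq mult.commute)
      have x1: "cmod (w * F w + \<i> * \<beta>) \<le> (s * sqrt (pi / e * (1 / e^2)) + \<bar>lam\<bar> * (s * sqrt (pi / e)) + cmod \<alpha>) / e"
        unfolding eq norm_divide
      proof (rule frac_le)
        show "cmod (\<i> * F2 w + of_real lam * F w - \<i> * \<alpha>) \<le> s * sqrt (pi / e * (1 / e^2)) + \<bar>lam\<bar> * (s * sqrt (pi / e)) + cmod \<alpha>"
        proof (rule order_trans[OF norm_triangle_ineq4 add_mono[OF order_trans[OF norm_triangle_ineq add_mono]]])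
          show "cmod (\<i> * F2 w) \<le> s * sqrt (pi / e * (1 / e^2))"
            using F2b[OF e(1) w] by (simp add: norm_mult)
          show "cmod (of_real lam * F w) \<le> \<bar>lam\<bar> * (s * sqrt (pi / e))"
            unfolding norm_mult norm_of_real by (intro mult_left_mono Fb e w) auto
        qed (simp add: norm_mult)
      qed (use e s0 w0 in \<open>auto intro!: add_nonneg_nonneg\<close>)
      have x2: "cmod (\<i> * of_real e * F w) \<le> e * (s * sqrt (pi / e))"
        using Fb[OF e(1) w] e by (simp add: norm_mult)
      have x3: "z * F w + \<i> * \<beta> = (w * F w + \<i> * \<beta>) - \<i> * of_real e * F w"
        by (simp add: w_def algebra_simps)
      have 1: "cmod (z * F w + \<i> * \<beta>) \<le> (s * sqrt (pi / e * (1 / e^2)) + \<bar>lam\<bar> * (s * sqrt (pi / e)) + cmod \<alpha>) / e + e * (s * sqrt (pi / e))"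
        unfolding x3 by (rule order_trans[OF norm_triangle_ineq4 add_mono[OF x1 x2]])
      show ?thesis unfolding g_def w_def[symmetric]
      proof (rule order_trans[OF norm_triangle_ineq add_mono])
        show "cmod (of_real lam * cnj \<beta> * F w) \<le> \<bar>lam\<bar> * cmod \<beta> * (s * sqrt (pi / e))"
          unfolding norm_mult norm_of_real complex_mod_cnj by (intro mult_left_mono Fb e w) auto
        show "cmod (cnj \<alpha> * (z * F w + \<i> * \<beta>)) \<le> cmod \<alpha> * ((s * sqrt (pi / e * (1 / e^2)) + \<bar>lam\<bar> * (s * sqrt (pi / e)) + cmod \<alpha>) / e + e * (s * sqrt (pi / e)))"
          unfolding norm_mult complex_mod_cnj by (intro mult_left_mono 1) auto
      qed
    qed
    note pf = poisson_formula_upper_half_plane[OF gh e(1) gb N]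
    have "(LINT x|lborel. N^2 / (x^2 + N^2) * (lam * Re (cnj \<beta> * f x) + Re (cnj \<alpha> * P x)))
       = (LINT x|lborel. N^2 * Re (g (of_real x) / of_real (x^2 + N^2)))"
    proof (intro Bochner_Integration.integral_cong refl)
      fix x
      have "g (of_real x) = of_real lam * (cnj \<beta> * f x) + cnj \<alpha> * P x"
        by (simp add: g_def f_def P_def Complex_eq mult.assoc)
      then show "N^2 / (x^2 + N^2) * (lam * Re (cnj \<beta> * f x) + Re (cnj \<alpha> * P x)) = N^2 * Re (g (of_real x) / of_real (x^2 + N^2))"
        unfolding Re_divide_of_real by simp
    qed
    also have "\<dots> = N^2 * Re (of_real (pi / N) * g (\<i> * of_real N))"
      by (simp only: integral_mult_right_zero integral_Re[OF pf(1)] pf(2))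
    also have "\<dots> = - L N e"
    proof -
      have "\<i> * of_real N + \<i> * of_real e = \<i> * complex_of_real (N + e)" by (simp add: algebra_simps)
      then have "Re (of_real (pi / N) * g (\<i> * of_real N)) = (pi / N) * Re (of_real lam * cnj \<beta> * F (\<i> * of_real (N + e))
      + cnj \<alpha> * (\<i> * of_real N * F (\<i> * of_real (N + e)) + \<i> * \<beta>))"
        unfolding g_def by (simp only: Re_complex_of_real Im_complex_of_real times_complex.sel mult_zero_left diff_0_right)
      then show ?thesis unfolding L_def using N by (simp add: power2_eq_square)
    qed
    finally show ?thesis using vir by simp
  qed
  have cF: "isCont F w" if "0 < Im w" for w using dF[OF that] by (rule DERIV_isCont)
  have lim_e: "L N 0 \<le> 2 * K + pi * (cmod \<beta>)^2 / (2 * N)" if N: "N > 0" for N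
  proof (rule tendsto_le[where F="at_right (0::real)"])
    show "((\<lambda>e. L N e) \<longlongrightarrow> L N 0) (at_right 0)"
    proof -
      have "((\<lambda>e. F (\<i> * of_real (N + e))) \<longlongrightarrow> F (\<i> * of_real (N + 0))) (at_right 0)"
      proof (rule isCont_tendsto_compose[OF cF])
        show "((\<lambda>e. \<i> * complex_of_real (N + e)) \<longlongrightarrow> \<i> * of_real (N + 0)) (at_right 0)"
          by (intro tendsto_intros)
      qed (use N in simp)
      then show ?thesis unfolding L_def by (intro tendsto_intros)
    qed
    have "((\<lambda>e. 2 * K + pi * (cmod \<beta>)^2 / (2 * N) + e * ((8 * N^2 + 1) * K + 9 * pi * N * (cmod \<beta>)^2))
       \<longlongrightarrow> 2 * K + pi * (cmod \<beta>)^2 / (2 * N) + 0 * ((8 * N^2 + 1) * K + 9 * pi * N * (cmod \<beta>)^2)) (at_right 0)"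
      by (intro tendsto_intros)
    then show "((\<lambda>e. 2 * K + pi * (cmod \<beta>)^2 / (2 * N) + e * ((8 * N^2 + 1) * K + 9 * pi * N * (cmod \<beta>)^2))
       \<longlongrightarrow> 2 * K + pi * (cmod \<beta>)^2 / (2 * N)) (at_right 0)" by simp
    show "eventually (\<lambda>e. L N e \<le> 2 * K + pi * (cmod \<beta>)^2 / (2 * N) + e * ((8 * N^2 + 1) * K + 9 * pi * N * (cmod \<beta>)^2)) (at_right 0)"
      unfolding eventually_at_right_field
      by (intro exI[of _ 1]) (use main[OF N] in auto)
  qed simp
  have Flim: "((\<lambda>N. F (\<i> * of_real N)) \<longlongrightarrow> 0) at_top"
  proof (rule Lim_null_comparison)
    show "eventually (\<lambda>N. norm (F (\<i> * of_real N)) \<le> s * sqrt (pi / N)) at_top"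
      using eventually_gt_at_top[of 0] by eventually_elim (rule Fb, auto)
    show "((\<lambda>N. s * sqrt (pi / N)) \<longlongrightarrow> 0) at_top" by real_asymp
  qed
  have F2lim: "((\<lambda>N. F2 (\<i> * of_real N)) \<longlongrightarrow> 0) at_top"
  proof (rule Lim_null_comparison)
    show "eventually (\<lambda>N. norm (F2 (\<i> * of_real N)) \<le> s * sqrt (pi / N * (1 / N^2))) at_top"
      using eventually_gt_at_top[of 0] by eventually_elim (rule F2b, auto)
    show "((\<lambda>N. s * sqrt (pi / N * (1 / N^2))) \<longlongrightarrow> 0) at_top" by real_asymp
  qed
  define A where "A = (\<lambda>N. F2 (\<i> * of_real N) - \<i> * of_real lam * F (\<i> * of_real N) - \<alpha>)"
  have Alim: "(A \<longlongrightarrow> 0 - \<i> * of_real lam * 0 - \<alpha>) at_top"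
    unfolding A_def by (intro tendsto_intros Flim F2lim)
  have AN: "of_real N * (\<i> * of_real N * F (\<i> * of_real N) + \<i> * \<beta>) = A N" if "N > 0" for N
    using ode[of "\<i> * of_real N"] that
    by (simp add: A_def F_def F2_def power2_eq_square algebra_simps)
  have NF: "of_real N * F (\<i> * of_real N) = - \<i> * A N * of_real (1 / N) - \<beta>" if "N > 0" for N
  proof -
    have "\<i> * (of_real N * F (\<i> * of_real N) + \<beta>) = A N * of_real (1 / N)"
      using AN[OF that] that by (simp add: field_simps)
    then have "- \<i> * (\<i> * (of_real N * F (\<i> * of_real N) + \<beta>)) = - \<i> * (A N * of_real (1 / N))" by simp
    then show ?thesis by (simp add: algebra_simps)
  qed
  define L' where "L' = (\<lambda>N. - pi * Re (of_real lam * cnj \<beta> * (- \<i> * A N * of_real (1 / N) - \<beta>) + cnj \<alpha> * A N))"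
  have L': "L N 0 = L' N" if "N > 0" for N
  proof -
    have "L N 0 = - pi * Re (of_real N * (of_real lam * cnj \<beta> * F (\<i> * of_real N)
      + cnj \<alpha> * (\<i> * of_real N * F (\<i> * of_real N) + \<i> * \<beta>)))"
      unfolding L_def by (simp only: Re_complex_of_real Im_complex_of_real times_complex.sel mult_zero_left diff_0_right add_0_right mult.assoc mult_minus_left)
    also have "of_real N * (of_real lam * cnj \<beta> * F (\<i> * of_real N)
      + cnj \<alpha> * (\<i> * of_real N * F (\<i> * of_real N) + \<i> * \<beta>))
      = of_real lam * cnj \<beta> * (of_real N * F (\<i> * of_real N)) + cnj \<alpha> * (of_real N * (\<i> * of_real N * F (\<i> * of_real N) + \<i> * \<beta>))"
      by (simp add: algebra_simps)
    finally show ?thesis unfolding AN[OF that] NF[OF that] L'_def .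
  qed
  have inv: "((\<lambda>N::real. complex_of_real (1 / N)) \<longlongrightarrow> of_real 0) at_top"
    by (intro tendsto_of_real) real_asymp
  have "(L' \<longlongrightarrow> - pi * Re (of_real lam * cnj \<beta> * (- \<i> * (0 - \<i> * of_real lam * 0 - \<alpha>) * of_real 0 - \<beta>)
          + cnj \<alpha> * (0 - \<i> * of_real lam * 0 - \<alpha>))) at_top"
    unfolding L'_def by (intro tendsto_intros Alim inv)
  then have "(L' \<longlongrightarrow> pi * (lam * ((Re \<beta>)^2 + (Im \<beta>)^2) + ((Re \<alpha>)^2 + (Im \<alpha>)^2))) at_top"
    by (simp add: power2_eq_square algebra_simps)
  then have "(L' \<longlongrightarrow> pi * (lam * (cmod \<beta>)^2 + (cmod \<alpha>)^2)) at_top"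
    unfolding cmod_power2 .
  moreover have "((\<lambda>N. 2 * K + pi * (cmod \<beta>)^2 / (2 * N)) \<longlongrightarrow> 2 * K) at_top"
    by real_asymp
  moreover have "eventually (\<lambda>N. L' N \<le> 2 * K + pi * (cmod \<beta>)^2 / (2 * N)) at_top"
    using eventually_gt_at_top[of 0] by eventually_elim (use lim_e L' in simp)
  ultimately have "pi * (lam * (cmod \<beta>)^2 + (cmod \<alpha>)^2) \<le> 2 * K"
    by (intro tendsto_le[of at_top]) auto
  also have "2 * K = pi * (12 * pi * l2sq \<phi>)" by (simp add: K_def power2_eq_square)
  finally show ?thesis by simp
qed

section \<open>Pointwise bounds from the first-order equation\<close>

text \<open>
  The integrating factor \<open>exp (- \<i> (lam u - u\<^sup>3 / 3))\<close> has modulus 1, so only \<open>s\<close> can change the modulus of \<open>G\<close>.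
\<close>

lemma oscillatory_ODE_cmod_le:
  fixes G s :: "real \<Rightarrow> complex"
  assumes deriv: "\<And>u. a \<le> u \<Longrightarrow> u \<le> a + 1 \<Longrightarrow>
        (G has_vector_derivative \<i> * of_real (lam - u^2) * G u + s u) (at u)"
    and s: "\<And>u. a \<le> u \<Longrightarrow> u \<le> a + 1 \<Longrightarrow> cmod (s u) \<le> S"
    and y: "a \<le> y" "y \<le> a + 1"
  shows "cmod (G a) \<le> cmod (G y) + S"
proof -
  define E where "E = (\<lambda>u. exp (- \<i> * of_real (lam * u - u ^ 3 / 3)))"
  have nE: "cmod (E u) = 1" for u
    unfolding E_def by (simp add: norm_exp_eq_Re del: of_real_diff of_real_mult of_real_power of_real_divide)
  have dE: "(E has_vector_derivative - \<i> * of_real (lam - u^2) * E u) (at u)" for u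
  proof -
    have "((\<lambda>u. lam * u - u ^ 3 / 3) has_real_derivative lam - u^2) (at u)"
      by (auto intro!: derivative_eq_intros)
    then have "((\<lambda>u. complex_of_real (lam * u - u ^ 3 / 3)) has_vector_derivative of_real (lam - u^2)) (at u)"
      by (simp add: has_vector_derivative_of_real has_real_derivative_iff_has_vector_derivative del: of_real_diff of_real_mult of_real_power of_real_divide)
    then have "((\<lambda>u. - \<i> * complex_of_real (lam * u - u ^ 3 / 3)) has_vector_derivative - \<i> * of_real (lam - u^2)) (at u)"
      by (rule has_vector_derivative_mult_right)
    from field_vector_diff_chain_at[OF this DERIV_exp] show ?thesis
      by (simp add: E_def o_def)
  qed
  define h where "h = (\<lambda>u. E u * G u)"
  have dh: "(h has_vector_derivative E u * s u) (at u)" if "a \<le> u" "u \<le> a + 1" for u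
  proof -
    have "(h has_vector_derivative E u * (\<i> * of_real (lam - u^2) * G u + s u) + (- \<i> * of_real (lam - u^2) * E u) * G u) (at u)"
      unfolding h_def by (rule has_vector_derivative_mult[OF dE deriv[OF that]])
    then show ?thesis by (simp add: algebra_simps)
  qed
  have S0: "0 \<le> S" using s[of a] norm_ge_zero[of "s a"] by linarith
  have "norm (h y - h a) \<le> S * norm (y - a)"
  proof (rule differentiable_bound[of "{a..a+1}" h "\<lambda>u x. x *\<^sub>R (E u * s u)"])
    fix u assume u: "u \<in> {a..a+1}"
    show "(h has_derivative (\<lambda>x. x *\<^sub>R (E u * s u))) (at u within {a..a+1})"
      using dh[of u] u by (simp add: has_vector_derivative_def has_derivative_at_withinI)
    show "onorm (\<lambda>x. x *\<^sub>R (E u * s u)) \<le> S"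
      using s[of u] u S0 by (intro onorm_bound) (simp_all add: norm_mult nE mult.commute[of S] mult_left_mono)
  qed (use y in auto)
  also have "\<dots> \<le> S * 1" using y S0 by (intro mult_left_mono) auto
  finally have "norm (h a) \<le> norm (h y) + S"
    using norm_triangle_ineq2[of "h a" "h y"] by (simp add: norm_minus_commute)
  then show ?thesis by (simp add: h_def norm_mult nE)
qed

lemma L2_small_somewhere:
  assumes f: "f \<in> L2" and K: "l2sq f \<le> K"
  shows "\<exists>y. a \<le> y \<and> y \<le> a + 1 \<and> cmod (f y) \<le> sqrt (K + 1)"
proof (rule ccontr)
  assume n: "\<not> ?thesis"
  have K0: "0 \<le> K" using K l2sq_nonneg order_trans by blast
  have big: "K + 1 \<le> (cmod (f y))^2" if "y \<in> {a..a+1}" for y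
  proof -
    have "sqrt (K + 1) \<le> cmod (f y)" using n that by force
    then have "(sqrt (K + 1))^2 \<le> (cmod (f y))^2" using K0 by (intro power_mono) auto
    then show ?thesis using K0 by simp
  qed
  have "ennreal (K + 1) = (\<integral>\<^sup>+y. ennreal (K + 1) * indicator {a..a+1} y \<partial>lborel)"
    by (simp add: nn_integral_cmult_indicator)
  also have "\<dots> \<le> L2_normsq f"
    unfolding L2_normsq_def
  proof (intro nn_integral_mono)
    fix y
    show "ennreal (K + 1) * indicator {a..a+1} y \<le> ennreal ((cmod (f y))^2)"
      using big[of y] by (auto simp: indicator_def intro: ennreal_leI)
  qed
  also have "\<dots> \<le> ennreal K" unfolding L2_normsq_eq[OF f] by (intro ennreal_leI K)
  finally show False using K0 by (subst (asm) ennreal_le_iff) auto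
qed

text \<open>
  The constant \<open>c\<close> bounds \<open>\<bar>\<alpha>\<bar>\<close> and \<open>\<surd>lam \<bar>\<beta>\<bar>\<close>; the first summand is the bound at the good point of an interval
  of length 1. The remaining summands dominate the variation of the modulus over that interval and the size of the
  approximate solution that is subtracted far from the origin.
\<close>

definition uniform_bound :: "real \<Rightarrow> real" where
  "uniform_bound lam0 =
     (let c = sqrt (12 * pi) in sqrt (6 * pi^2 + 1) + 3 * c + 2 * c / sqrt lam0 + 2 * (c / lam0) + 2 * (c / (lam0 * sqrt lam0)) + 1)"

text \<open>
  For \<open>\<bar>a\<bar> \<le> 2 \<surd>lam + 1\<close> the source term \<open>\<alpha> + \<beta> u\<close> is bounded near \<open>a\<close>, as \<open>\<bar>\<beta>\<bar> \<le> c / \<surd>lam\<close>. For larger \<open>\<bar>a\<bar>\<close>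
  it need not be, but then \<open>lam - u\<^sup>2\<close> is of the size of \<open>u\<^sup>2\<close>, and subtracting
  \<open>p = \<i> (\<alpha> + \<beta> u) / (lam - u\<^sup>2)\<close> replaces the source term by \<open>p'\<close>, which is small.
\<close>

lemma cauchy_transform_uniform_bound:
  assumes \<phi>: "\<phi> \<in> L2" "l2sq \<phi> \<le> 1" and lam: "0 < lam0" "lam0 \<le> lam"
    and ode: "\<And>w. 0 < Im w \<Longrightarrow> cauchy_transform (Suc (Suc 0)) \<phi> w
        = \<i> * (of_real lam - w^2) * cauchy_transform (Suc 0) \<phi> w + \<alpha> + \<beta> * w"
  shows "eventually (\<lambda>e. cmod (cauchy_transform (Suc 0) \<phi> (Complex a e)) \<le> uniform_bound lam0) (at_right 0)"
proof -
  define c where "c = sqrt (12 * pi)"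
  define K where "K = 6 * pi^2"
  have c0: "c \<ge> 0" and lp: "lam > 0" using lam by (auto simp: c_def)
  have coef: "lam * (cmod \<beta>)^2 + (cmod \<alpha>)^2 \<le> c^2"
    using order_trans[OF ODE_coefficient_bound[OF \<phi>(1) ode] mult_left_mono[OF \<phi>(2), of "12 * pi"]]
    by (simp add: c_def)
  have \<alpha>: "cmod \<alpha> \<le> c"
  proof (rule power2_le_imp_le[OF _ c0])
    have "0 \<le> lam * (cmod \<beta>)^2" using lp by simp
    then show "(cmod \<alpha>)^2 \<le> c^2" using coef by linarith
  qed
  have "(cmod \<beta> * sqrt lam)^2 \<le> c^2"
    using coef lp by (simp add: power_mult_distrib mult.commute) (smt (verit) zero_le_power2)
  then have "cmod \<beta> * sqrt lam \<le> c" using c0 by (rule power2_le_imp_le)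
  then have \<beta>: "cmod \<beta> \<le> c / sqrt lam" using lp by (simp add: pos_le_divide_eq)
  define q where "q = (\<lambda>u::real. \<alpha> + \<beta> * of_real u)"
  have q: "cmod (q u) \<le> c + c / sqrt lam * \<bar>u\<bar>" for u
    unfolding q_def
    by (rule order_trans[OF norm_triangle_ineq add_mono[OF \<alpha>]])
       (simp only: norm_mult norm_of_real, intro mult_right_mono \<beta>, simp)
  \<comment> \<open>\<open>R e\<close> bounds the perturbation caused by the height \<open>e\<close>; it is of order \<open>\<surd>e\<close> since the transform is \<open>O(1 / \<surd>e)\<close>.\<close>
  define R where "R = (\<lambda>e. e * ((2 * (\<bar>a\<bar> + 1) + e) * sqrt (pi / e) + cmod \<beta>))"
  have "(R \<longlongrightarrow> 0) (at_right 0)" unfolding R_def by real_asymp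
  then have "eventually (\<lambda>e. R e < 1) (at_right 0)" by (rule order_tendstoD) simp
  moreover have "eventually (\<lambda>e. e > (0::real)) (at_right 0)" by (simp add: eventually_at_right_less)
  ultimately show ?thesis
  proof eventually_elim
    fix e :: real assume Re1: "R e < 1" and e: "0 < e"
    define f where "f = (\<lambda>x. cauchy_transform (Suc 0) \<phi> (Complex x e))"
    define r where "r = (\<lambda>u. of_real e * ((2 * of_real u + \<i> * of_real e) * f u + \<i> * \<beta>))"
    have f2: "f \<in> L2" "l2sq f \<le> K"
      using cauchy_transform_L2[OF \<phi>(1) e] order_trans[OF _ mult_left_mono[OF \<phi>(2), of "6 * pi^2"]]
      by (auto simp: f_def K_def)
    have df: "(f has_vector_derivative \<i> * of_real (lam - u^2) * f u + (q u + r u)) (at u)" for u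
      using cauchy_transform_horizontal_line[OF \<phi>(1) e ode] by (simp only: f_def q_def r_def)
    have fb: "cmod (f u) \<le> sqrt (pi / e)" for u
    proof -
      have "cmod (f u) \<le> sqrt (l2sq \<phi>) * sqrt (pi / e)"
        unfolding f_def using e by (intro cauchy_transform_bound1 \<phi>) auto
      also have "\<dots> \<le> 1 * sqrt (pi / e)" using \<phi> e by (intro mult_right_mono) auto
      finally show ?thesis by simp
    qed
    have r1: "cmod (r u) \<le> 1" if "a \<le> u" "u \<le> a + 1" for u
    proof -
      have "cmod (2 * of_real u + \<i> * of_real e) \<le> 2 * (\<bar>a\<bar> + 1) + e"
        using that e by (intro order_trans[OF norm_triangle_ineq]) (auto simp: norm_mult)
      then have "cmod ((2 * of_real u + \<i> * of_real e) * f u + \<i> * \<beta>) \<le> (2 * (\<bar>a\<bar> + 1) + e) * sqrt (pi / e) + cmod \<beta>"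
        using e fb[of u] by (intro order_trans[OF norm_triangle_ineq] add_mono) (auto simp: norm_mult intro!: mult_mono)
      then have "cmod (r u) \<le> R e" unfolding r_def R_def using e by (simp add: norm_mult mult_left_mono)
      then show ?thesis using Re1 by simp
    qed
    obtain y where y: "a \<le> y" "y \<le> a + 1" "cmod (f y) \<le> sqrt (K + 1)"
      using L2_small_somewhere[OF f2] by blast
    have sq: "0 < sqrt lam0" "sqrt lam0 \<le> sqrt lam" "lam0 * sqrt lam0 \<le> lam * sqrt lam"
      using lam by (auto intro!: mult_mono)
    have mono: "c / sqrt lam \<le> c / sqrt lam0" "c / lam \<le> c / lam0" "c / (lam * sqrt lam) \<le> c / (lam0 * sqrt lam0)"
      using sq lam c0 by (auto intro!: divide_left_mono mult_pos_pos)
    have ub: "uniform_bound lam0 = sqrt (K + 1) + 3 * c + 2 * (c / sqrt lam0) + 2 * (c / lam0) + 2 * (c / (lam0 * sqrt lam0)) + 1"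
      by (simp add: uniform_bound_def c_def K_def Let_def)
    have nn: "0 \<le> c / sqrt lam0" "0 \<le> c / lam0" "0 \<le> c / (lam0 * sqrt lam0)" using c0 lam by auto
    show "cmod (f a) \<le> uniform_bound lam0"
    proof (cases "\<bar>a\<bar> \<le> 2 * sqrt lam + 1")
      case True
      have "cmod (f a) \<le> cmod (f y) + (3 * c + 2 * (c / sqrt lam) + 1)"
      proof (rule oscillatory_ODE_cmod_le[OF df _ y(1,2)])
        fix u assume u: "a \<le> u" "u \<le> a + 1"
        have "cmod (q u) \<le> c + c / sqrt lam * (2 * sqrt lam + 2)"
          using q[of u] mult_left_mono[of "\<bar>u\<bar>" "2 * sqrt lam + 2" "c / sqrt lam"] u True c0 lp by fastforce
        also have "\<dots> = 3 * c + 2 * (c / sqrt lam)" using lp by (simp add: field_simps)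
        finally show "cmod (q u + r u) \<le> 3 * c + 2 * (c / sqrt lam) + 1"
          using r1[OF u] by (intro order_trans[OF norm_triangle_ineq]) simp
      qed
      then show ?thesis using y(3) mono nn unfolding ub by linarith
    next
      case False
      define om where "om = (\<lambda>u::real. complex_of_real (lam - u^2))"
      \<comment> \<open>\<open>p\<close> solves the equation without the derivative: \<open>\<i> * om u * p u + q u = 0\<close>.\<close>
      define p where "p = (\<lambda>u. \<i> * q u / om u)"
      define p' where "p' = (\<lambda>u. \<i> * (\<beta> / om u + 2 * of_real u * q u / (om u)^2))"
      have u4: "2 * sqrt lam \<le> \<bar>u\<bar>" if "a \<le> u" "u \<le> a + 1" for u using False that by linarith
      have om: "cmod (om u) = u^2 - lam" "3 * lam \<le> u^2 - lam" "3/4 * u^2 \<le> u^2 - lam" if "a \<le> u" "u \<le> a + 1" for u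
      proof -
        have "(2 * sqrt lam)^2 \<le> \<bar>u\<bar>^2" using u4[OF that] lp by (intro power_mono) auto
        then have *: "4 * lam \<le> u^2" using lp by (simp add: power_mult_distrib)
        then show "3 * lam \<le> u^2 - lam" "3/4 * u^2 \<le> u^2 - lam" by auto
        show "cmod (om u) = u^2 - lam" unfolding om_def norm_of_real using * lp by simp
      qed
      have cancel: "b * \<bar>u\<bar> / (3/4 * u^2) = 4/3 * b / \<bar>u\<bar>" if "0 < \<bar>u\<bar>" for b u :: real
      proof -
        have "b * v / (3/4 * (v * v)) = 4/3 * b / v" if "0 < v" for v :: real
          using that by (simp add: field_simps)
        from this[OF that] show ?thesis by (simp add: power2_eq_square)
      qed
      have omp: "cmod (om u) > 0" "om u \<noteq> 0" if "a \<le> u" "u \<le> a + 1" for u using om(1,2)[OF that] lp by auto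
      have pb: "cmod (p u) \<le> c / lam" if u: "a \<le> u" "u \<le> a + 1" for u
      proof -
        have U: "0 < \<bar>u\<bar>" using u4[OF u] lp by (smt (verit) real_sqrt_gt_zero)
        have "cmod (p u) = cmod (q u) / cmod (om u)" by (simp add: p_def norm_divide norm_mult)
        also have "\<dots> \<le> (c + c / sqrt lam * \<bar>u\<bar>) / cmod (om u)"
          using q omp[OF u] by (intro divide_right_mono) auto
        also have "\<dots> = c / cmod (om u) + c / sqrt lam * \<bar>u\<bar> / cmod (om u)" by (rule add_divide_distrib)
        also have "\<dots> \<le> c / (3 * lam) + c / sqrt lam * \<bar>u\<bar> / (3/4 * u^2)"
          using om[OF u] omp[OF u] lp c0 U by (intro add_mono divide_left_mono mult_pos_pos) auto
        also have "c / sqrt lam * \<bar>u\<bar> / (3/4 * u^2) = 4/3 * (c / sqrt lam) / \<bar>u\<bar>"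
          by (rule cancel[OF U])
        also have "\<dots> \<le> 4/3 * (c / sqrt lam) / (2 * sqrt lam)"
          using u4[OF u] lp c0 U by (intro divide_left_mono) auto
        also have "\<dots> = 2/3 * (c / lam)" using lp by (simp add: field_simps)
        finally show ?thesis by (simp add: field_simps)
      qed
      have p'b: "cmod (p' u) \<le> 2 * (c / (lam * sqrt lam))" if u: "a \<le> u" "u \<le> a + 1" for u
      proof -
        have U: "0 < \<bar>u\<bar>" using u4[OF u] lp by (smt (verit) real_sqrt_gt_zero)
        have e2: "p' u = \<i> * \<beta> / om u + 2 * of_real u / om u * p u"
          by (simp add: p'_def p_def power2_eq_square algebra_simps)
        have "cmod (p' u) \<le> cmod \<beta> / cmod (om u) + 2 * \<bar>u\<bar> / cmod (om u) * cmod (p u)"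
          unfolding e2 by (rule order_trans[OF norm_triangle_ineq]) (simp add: norm_mult norm_divide)
        also have "\<dots> \<le> (c / sqrt lam) / (3 * lam) + (2 * \<bar>u\<bar> / (3/4 * u^2)) * (c / lam)"
          using om[OF u] omp[OF u] lp c0 U \<beta> pb[OF u]
          by (intro add_mono mult_mono frac_le order_refl) (auto intro!: mult_pos_pos)
        also have "2 * \<bar>u\<bar> / (3/4 * u^2) = 8/3 / \<bar>u\<bar>"
          using cancel[OF U, of 2] by simp
        also have "(c / sqrt lam) / (3 * lam) + 8/3 / \<bar>u\<bar> * (c / lam) \<le> (c / sqrt lam) / (3 * lam) + 8/3 / (2 * sqrt lam) * (c / lam)"
        proof (rule add_left_mono, rule mult_right_mono)
          show "8/3 / \<bar>u\<bar> \<le> 8/3 / (2 * sqrt lam)"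
            using u4[OF u] lp U by (intro divide_left_mono) auto
        qed (use c0 lp in auto)
        also have "\<dots> = 5/3 * (c / (lam * sqrt lam))" using lp by (simp add: field_simps)
        also have "\<dots> \<le> 2 * (c / (lam * sqrt lam))" using lp c0 by (intro mult_right_mono) auto
        finally show ?thesis .
      qed
      have dp: "(p has_vector_derivative p' u) (at u)" if u: "a \<le> u" "u \<le> a + 1" for u
      proof -
        define P where "P = (\<lambda>z. \<i> * (\<alpha> + \<beta> * z) / (of_real lam - z^2))"
        have nz: "of_real lam - (complex_of_real u)^2 \<noteq> 0"
          using omp(2)[OF u] by (simp add: om_def)
        have "(P has_field_derivative (\<i> * \<beta> * (of_real lam - (of_real u)^2) + \<i> * (\<alpha> + \<beta> * of_real u) * (2 * of_real u)) / (of_real lam - (of_real u)^2)^2) (at (of_real u))"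
          unfolding P_def by (rule derivative_eq_intros refl nz)+ (simp add: power2_eq_square algebra_simps)
        also have "(\<i> * \<beta> * (of_real lam - (of_real u)^2) + \<i> * (\<alpha> + \<beta> * of_real u) * (2 * of_real u)) / (of_real lam - (of_real u)^2)^2 = p' u"
          unfolding p'_def om_def q_def using nz by (simp add: power2_eq_square divide_simps) (simp add: algebra_simps)
        finally have dP: "(P has_field_derivative p' u) (at (of_real u))" .
        have "(complex_of_real has_vector_derivative 1) (at u)"
          by (auto intro!: derivative_eq_intros simp: has_vector_derivative_def scaleR_conv_of_real)
        from field_vector_diff_chain_at[OF this dP] show ?thesis
          by (simp add: P_def p_def q_def om_def o_def)
      qed
      define G where "G = (\<lambda>u. f u - p u)"
      have "cmod (G a) \<le> cmod (G y) + (1 + 2 * (c / (lam * sqrt lam)))"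
      proof (rule oscillatory_ODE_cmod_le[OF _ _ y(1,2)])
        fix u assume u: "a \<le> u" "u \<le> a + 1"
        have "\<i> * om u * p u = - q u" using omp(2)[OF u] by (simp add: p_def)
        then have "\<i> * om u * f u + (q u + r u) - p' u = \<i> * om u * G u + (r u - p' u)"
          by (simp add: G_def algebra_simps)
        moreover have "(G has_vector_derivative \<i> * om u * f u + (q u + r u) - p' u) (at u)"
          unfolding G_def om_def by (rule has_vector_derivative_diff[OF df[of u] dp[OF u]])
        ultimately show "(G has_vector_derivative \<i> * of_real (lam - u^2) * G u + (r u - p' u)) (at u)"
          by (simp only: om_def)
        show "cmod (r u - p' u) \<le> 1 + 2 * (c / (lam * sqrt lam))"
          by (rule order_trans[OF norm_triangle_ineq4 add_mono[OF r1[OF u] p'b[OF u]]])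
      qed
      moreover have "cmod (G y) \<le> sqrt (K + 1) + c / lam"
        unfolding G_def by (rule order_trans[OF norm_triangle_ineq4 add_mono[OF y(3) pb[OF y(1,2)]]])
      moreover have "cmod (f a) \<le> cmod (G a) + cmod (p a)"
        using norm_triangle_ineq[of "G a" "p a"] by (simp add: G_def)
      ultimately show ?thesis using pb[of a] mono nn c0 unfolding ub by simp
    qed
  qed
qed

text \<open>
  As \<open>\<phi>\<close> need not be bounded, dominated convergence is applied only on the interval of radius 1 around \<open>x\<close>.
  On the complement the Poisson kernel is at most \<open>e\<close> times an \<open>L\<^sup>2\<close> function.
\<close>

lemma poisson_integral_tendsto:
  assumes \<phi>: "\<phi> \<in> L2" and cont: "continuous_on UNIV \<phi>" and e: "\<And>n. 0 < e n" "e \<longlonglongrightarrow> (0::real)"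
  shows "(\<lambda>n. LINT y|lborel. \<phi> y * of_real (e n / ((y - x)^2 + (e n)^2))) \<longlonglongrightarrow> of_real pi * \<phi> x"
proof -
  have [measurable]: "\<phi> \<in> borel_measurable borel" using \<phi> by (rule L2_measurable)
  define I where "I = {x - 1..x + 1}"
  obtain M where M: "\<And>y. y \<in> I \<Longrightarrow> cmod (\<phi> y) \<le> M"
  proof -
    have "bounded (\<phi> ` I)"
      by (intro compact_imp_bounded compact_continuous_image continuous_on_subset[OF cont]) (auto simp: I_def)
    then show ?thesis using that unfolding bounded_iff by blast
  qed
  have M0: "0 \<le> M" using order_trans[OF norm_ge_zero M[of x]] by (simp add: I_def)
  define k where "k = (\<lambda>n y. e n / ((y - x)^2 + (e n)^2))"
  define \<phi>1 \<phi>2 where "\<phi>1 = (\<lambda>y. indicator I y *\<^sub>R \<phi> y)" and "\<phi>2 = (\<lambda>y. indicator (- I) y *\<^sub>R \<phi> y)"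
  have [measurable]: "I \<in> sets borel" by (simp add: I_def)
  have int: "integrable lborel (\<lambda>y. \<phi> y * of_real (k n y))" for n
    unfolding k_def by (rule jump_eq_poisson(1)[OF \<phi> e(1)])
  have i1: "integrable lborel (\<lambda>y. \<phi>1 y * of_real (k n y))" and i2: "integrable lborel (\<lambda>y. \<phi>2 y * of_real (k n y))" for n
    using integrable_mult_indicator[OF _ int[of n], of I] integrable_mult_indicator[OF _ int[of n], of "- I"]
    by (simp_all add: \<phi>1_def \<phi>2_def)
  have eq: "(LINT y|lborel. \<phi> y * of_real (k n y)) = (LINT y|lborel. \<phi>1 y * of_real (k n y)) + (LINT y|lborel. \<phi>2 y * of_real (k n y))" for n
    by (subst Bochner_Integration.integral_add[OF i1 i2, symmetric])
       (auto intro!: Bochner_Integration.integral_cong simp: \<phi>1_def \<phi>2_def indicator_def)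
  have near: "(\<lambda>n. LINT y|lborel. \<phi>1 y * of_real (k n y)) \<longlonglongrightarrow> of_real pi * \<phi> x"
  proof -
    have sub: "(LINT y|lborel. \<phi>1 y * of_real (k n y)) = (LINT u|lborel. \<phi>1 (x + e n * u) * of_real (1 / (u^2 + 1)))" for n
    proof -
      have pu: "u^2 + 1 \<noteq> 0" for u :: real by (smt (verit) zero_le_power2)
      have "e n *\<^sub>R (\<phi>1 (x + e n * u) * of_real (k n (x + e n * u))) = \<phi>1 (x + e n * u) * of_real (1 / (u^2 + 1))" for u
      proof -
        have "e n * k n (x + e n * u) = 1 / (u^2 + 1)"
        proof -
          have "(e n * u)^2 + (e n)^2 = (e n)^2 * (u^2 + 1)" by (simp add: power_mult_distrib algebra_simps)
          then show ?thesis using e(1)[of n] pu[of u] by (simp add: k_def power2_eq_square)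
        qed
        then show ?thesis by (metis mult.left_commute of_real_mult scaleR_conv_of_real)
      qed
      then show ?thesis
        using e(1)[of n] by (subst lborel_integral_real_affine[of "e n" _ x]) (auto simp flip: integral_scaleR_right)
    qed
    have pk: "integrable lborel (\<lambda>u::real. 1 / (u^2 + 1))" "(LINT u|lborel. 1 / (u^2 + 1)) = pi"
      using poisson_kernel_total[of 1 0] by simp_all
    have "(\<lambda>n. LINT u|lborel. \<phi>1 (x + e n * u) * of_real (1 / (u^2 + 1))) \<longlonglongrightarrow> (LINT u|lborel. \<phi> x * of_real (1 / (u^2 + 1)))"
    proof (rule integral_dominated_convergence[where w="\<lambda>u. M * (1 / (u^2 + 1))"])
      show "integrable lborel (\<lambda>u. M * (1 / (u^2 + 1)))" by (rule integrable_mult_right[OF pk(1)])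
      show "AE u in lborel. (\<lambda>n. \<phi>1 (x + e n * u) * of_real (1 / (u^2 + 1))) \<longlonglongrightarrow> \<phi> x * of_real (1 / (u^2 + 1))"
      proof (rule AE_I2)
        fix u :: real
        have xu: "(\<lambda>n. x + e n * u) \<longlonglongrightarrow> x"
          using tendsto_add[OF tendsto_const tendsto_mult[OF e(2) tendsto_const], of x u] by simp
        have "eventually (\<lambda>n. x + e n * u \<in> {x - 1<..<x + 1}) sequentially"
          by (rule topological_tendstoD[OF xu]) auto
        then have ev: "eventually (\<lambda>n. \<phi> (x + e n * u) = \<phi>1 (x + e n * u)) sequentially"
          by eventually_elim (auto simp: \<phi>1_def I_def indicator_def)
        have "isCont \<phi> x" using cont by (simp add: continuous_on_eq_continuous_at)
        then have "(\<lambda>n. \<phi> (x + e n * u)) \<longlonglongrightarrow> \<phi> x" using xu by (rule isCont_tendsto_compose)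
        from Lim_transform_eventually[OF this ev] have "(\<lambda>n. \<phi>1 (x + e n * u)) \<longlonglongrightarrow> \<phi> x" .
        then show "(\<lambda>n. \<phi>1 (x + e n * u) * of_real (1 / (u^2 + 1))) \<longlonglongrightarrow> \<phi> x * of_real (1 / (u^2 + 1))"
          by (intro tendsto_intros)
      qed
      fix n
      show "AE u in lborel. norm (\<phi>1 (x + e n * u) * of_real (1 / (u^2 + 1))) \<le> M * (1 / (u^2 + 1))"
      proof (rule AE_I2)
        fix u :: real
        have "cmod (\<phi>1 v) \<le> M" for v using M[of v] M0 by (auto simp: \<phi>1_def indicator_def)
        then show "norm (\<phi>1 (x + e n * u) * of_real (1 / (u^2 + 1))) \<le> M * (1 / (u^2 + 1))"
          unfolding norm_mult norm_of_real using M0 by (intro mult_mono) auto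
      qed
    qed (auto simp: \<phi>1_def)
    also have "(LINT u|lborel. \<phi> x * of_real (1 / (u^2 + 1))) = of_real pi * \<phi> x"
      by (simp only: integral_mult_right_zero integral_complex_of_real pk(2) mult.commute)
    finally show ?thesis by (simp add: sub)
  qed
  have far: "(\<lambda>n. LINT y|lborel. \<phi>2 y * of_real (k n y)) \<longlonglongrightarrow> 0"
  proof (rule Lim_null_comparison[OF always_eventually])
    have J: "integrable lborel (\<lambda>y. 2 * cmod (\<phi> y * of_real (1 / ((y - x)^2 + 1^2))))"
      using jump_eq_poisson(1)[OF \<phi>, of 1 x] by (intro integrable_mult_right integrable_norm) simp
    define J where "J = (LINT y|lborel. 2 * cmod (\<phi> y * of_real (1 / ((y - x)^2 + 1^2))))"
    show "\<forall>n. norm (LINT y|lborel. \<phi>2 y * of_real (k n y)) \<le> e n * J"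
    proof
      fix n
      have "norm (LINT y|lborel. \<phi>2 y * of_real (k n y)) \<le> (LINT y|lborel. e n * (2 * cmod (\<phi> y * of_real (1 / ((y - x)^2 + 1^2)))))"
      proof (rule order_trans[OF integral_norm_bound integral_mono])
        show "integrable lborel (\<lambda>y. norm (\<phi>2 y * of_real (k n y)))" using i2 by (rule integrable_norm)
        show "integrable lborel (\<lambda>y. e n * (2 * cmod (\<phi> y * of_real (1 / ((y - x)^2 + 1^2)))))"
          by (rule integrable_mult_right[OF J])
        fix y
        show "norm (\<phi>2 y * of_real (k n y)) \<le> e n * (2 * cmod (\<phi> y * of_real (1 / ((y - x)^2 + 1^2))))"
        proof (cases "y \<in> I")
          case True then show ?thesis using e(1)[of n] by (simp add: \<phi>2_def)
        next
          case False
          then have "1 \<le> \<bar>y - x\<bar>" by (auto simp: I_def)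
          then have y1: "1 \<le> (y - x)^2" by (simp add: abs_le_square_iff[of 1, simplified])
          have "k n y \<le> e n / (y - x)^2" unfolding k_def using y1 e(1)[of n]
            by (intro divide_left_mono) (auto intro!: mult_pos_pos add_pos_nonneg)
          also have "\<dots> \<le> e n * (2 / ((y - x)^2 + 1^2))"
            using y1 e(1)[of n] by (simp add: divide_simps)
          finally have "k n y \<le> e n * (2 * (1 / ((y - x)^2 + 1^2)))" by simp
          moreover have "0 \<le> k n y" using e(1)[of n] by (simp add: k_def)
          ultimately have "cmod (\<phi> y) * \<bar>k n y\<bar> \<le> cmod (\<phi> y) * (e n * (2 * (1 / ((y - x)^2 + 1^2))))"
            by (intro mult_left_mono) auto
          moreover have "\<bar>1 / ((y - x)^2 + 1^2)\<bar> = 1 / ((y - x)^2 + 1^2)" by simp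
          ultimately show ?thesis using False
            unfolding norm_mult norm_of_real by (simp add: \<phi>2_def mult_ac)
        qed
      qed
      also have "\<dots> = e n * J" unfolding J_def by (rule integral_mult_right_zero)
      finally show "norm (LINT y|lborel. \<phi>2 y * of_real (k n y)) \<le> e n * J" .
    qed
    show "(\<lambda>n. e n * J) \<longlonglongrightarrow> 0" using tendsto_mult[OF e(2) tendsto_const, of J] by simp
  qed
  show ?thesis using tendsto_add[OF near far] unfolding eq[symmetric] unfolding k_def by simp
qed

section \<open>The law and the measurability of the Cauchy process\<close>

definition cauchy_density :: "real \<Rightarrow> real \<Rightarrow> real" where
  "cauchy_density t x = t / pi * (1 / (x^2 + t^2))"

lemma cauchy_density_nonneg: "0 < t \<Longrightarrow> 0 \<le> cauchy_density t x"
  by (simp add: cauchy_density_def)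

lemma cauchy_density_measurable [measurable]: "cauchy_density t \<in> borel_measurable borel"
  unfolding cauchy_density_def by measurable

lemma cauchy_density_expectation:
  assumes t: "0 < t" and holo: "g holomorphic_on {z. - d < Im z}" "0 < d"
    and bound: "\<And>z. 0 \<le> Im z \<Longrightarrow> cmod (g z) \<le> B"
  shows "(LINT x|density lborel (cauchy_density t). g (of_real x)) = g (\<i> * of_real t)"
proof -
  note P = poisson_formula_upper_half_plane[OF holo bound t]
  have cont: "continuous_on UNIV (\<lambda>x::real. g (of_real x))"
    by (rule continuous_on_compose2[OF holomorphic_on_imp_continuous_on[OF holo(1)]])
       (use holo(2) in \<open>auto intro: continuous_intros\<close>)
  have "(LINT x|density lborel (cauchy_density t). g (of_real x)) = (LINT x|lborel. cauchy_density t x *\<^sub>R g (of_real x))"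
    by (rule integral_density)
       (use cont t in \<open>auto intro: borel_measurable_continuous_onI cauchy_density_nonneg\<close>)
  also have "\<dots> = (LINT x|lborel. of_real (t / pi) * (g (of_real x) / of_real (x^2 + t^2)))"
    by (intro Bochner_Integration.integral_cong refl) (simp add: cauchy_density_def scaleR_conv_of_real)
  also have "\<dots> = of_real (t / pi) * (of_real (pi / t) * g (\<i> * of_real t))"
    by (simp only: integral_mult_right_zero P(2))
  also have "\<dots> = g (\<i> * of_real t)" using t by simp
  finally show ?thesis .
qed

lemma real_distribution_cauchy:
  assumes t: "0 < t"
  shows "real_distribution (density lborel (cauchy_density t))"
proof -
  have "emeasure (density lborel (cauchy_density t)) (space (density lborel (cauchy_density t)))
      = (\<integral>\<^sup>+x. ennreal (t / pi) * ennreal (1 / ((x - 0)^2 + t^2)) \<partial>lborel)"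
    using t by (simp add: emeasure_density cauchy_density_def ennreal_mult'[symmetric])
  also have "\<dots> = ennreal (t / pi) * ennreal (pi / t)"
    by (subst nn_integral_cmult) (simp_all only: poisson_kernel_total(3)[OF t], simp)
  also have "\<dots> = 1" using t by (simp flip: ennreal_mult)
  finally show ?thesis
    unfolding real_distribution_def real_distribution_axioms_def by (auto intro: prob_spaceI)
qed

text \<open>
  For \<open>\<xi> \<ge> 0\<close> the function \<open>exp (\<i> \<xi> z)\<close> is bounded and analytic on the upper half-plane; the other sign
  follows by conjugation.
\<close>

lemma char_cauchy:
  assumes t: "0 < t"
  shows "char (density lborel (cauchy_density t)) \<xi> = of_real (exp (- t * \<bar>\<xi>\<bar>))"
proof -
  have pos: "char (density lborel (cauchy_density t)) \<xi> = of_real (exp (- t * \<xi>))" if "0 \<le> \<xi>" for \<xi>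
  proof -
    have "cmod (exp (\<i> * (of_real \<xi> * z))) \<le> 1" if "0 \<le> Im z" for z
      using \<open>0 \<le> \<xi>\<close> that by (simp add: norm_exp_eq_Re)
    then have "(LINT x|density lborel (cauchy_density t). exp (\<i> * (of_real \<xi> * of_real x))) = exp (\<i> * (of_real \<xi> * (\<i> * of_real t)))"
      by (intro cauchy_density_expectation[OF t, of _ 1 1]) (auto intro!: holomorphic_intros)
    also have "\<i> * (of_real \<xi> * (\<i> * of_real t)) = complex_of_real (- t * \<xi>)"
      by (simp add: mult_ac)
    finally show ?thesis
      unfolding char_def by (simp only: of_real_mult exp_of_real[symmetric])
  qed
  show ?thesis
  proof (cases "0 \<le> \<xi>")
    case False
    have "char (density lborel (cauchy_density t)) \<xi> = cnj (char (density lborel (cauchy_density t)) (- \<xi>))"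
      unfolding char_def by (subst Bochner_Integration.integral_cnj[symmetric]) (simp add: exp_cnj)
    then show ?thesis using pos[of "- \<xi>"] False by simp
  qed (simp add: pos)
qed

context cauchy_process
begin

lemma distr_X:
  assumes t: "0 < t"
  shows "distr M borel (X t) = density lborel (cauchy_density t)"
proof (rule Levy_uniqueness)
  have [measurable]: "X t \<in> borel_measurable M" using t by (intro measurable_X) simp
  show "real_distribution (distr M borel (X t))"
    unfolding real_distribution_def real_distribution_axioms_def by (simp add: prob_space_distr)
  show "real_distribution (density lborel (cauchy_density t))" by (rule real_distribution_cauchy[OF t])
  show "char (distr M borel (X t)) = char (density lborel (cauchy_density t))"
    using char_X[of t] char_cauchy[OF t] t by (auto simp: fun_eq_iff)
qed

lemma expectation_X:
  assumes t: "0 < t" and holo: "g holomorphic_on {z. - d < Im z}" "0 < d"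
    and bound: "\<And>z. 0 \<le> Im z \<Longrightarrow> cmod (g z) \<le> B"
  shows "(LINT \<omega>|M. g (of_real (X t \<omega>))) = g (\<i> * of_real t)"
proof -
  have [measurable]: "X t \<in> borel_measurable M" using t by (intro measurable_X) simp
  have cont: "continuous_on UNIV (\<lambda>x::real. g (of_real x))"
    by (rule continuous_on_compose2[OF holomorphic_on_imp_continuous_on[OF holo(1)]])
       (use holo(2) in \<open>auto intro: continuous_intros\<close>)
  have "(LINT \<omega>|M. g (of_real (X t \<omega>))) = (LINT x|distr M borel (X t). g (of_real x))"
    by (rule integral_distr[symmetric]) (auto intro: borel_measurable_continuous_onI cont)
  then show ?thesis
    unfolding distr_X[OF t] by (rule trans[OF _ cauchy_density_expectation[OF t holo bound]])
qed

text \<open>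
  The integrand is the imaginary part of \<open>1 / (y - X\<^sub>t - \<i>)\<close>. This is the semigroup law of the Cauchy kernels.
\<close>

lemma expectation_cauchy_kernel_X:
  assumes t: "0 < t"
  shows "(\<integral>\<^sup>+\<omega>. ennreal (1 / (1 + (y - X t \<omega>)^2)) \<partial>M) = ennreal ((1 + t) / (y^2 + (1 + t)^2))"
proof -
  have [measurable]: "X t \<in> borel_measurable M" using t by (intro measurable_X) simp
  define g where "g = (\<lambda>z. 1 / (of_real y - z - \<i>))"
  have nz: "of_real y - z - \<i> \<noteq> 0" if "- 1 < Im z" for z using that by (auto simp: complex_eq_iff)
  have gb: "cmod (g z) \<le> 1" if "0 \<le> Im z" for z
  proof -
    have "1 \<le> cmod (of_real y - z - \<i>)" using abs_Im_le_cmod[of "of_real y - z - \<i>"] that by simp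
    then show ?thesis by (simp add: g_def norm_divide divide_le_eq)
  qed
  have gh: "g holomorphic_on {z. - 1 < Im z}"
    unfolding g_def by (intro holomorphic_intros) (use nz in auto)
  have Img: "Im (g (of_real x)) = 1 / (1 + (y - x)^2)" for x
    by (simp add: g_def Im_divide power2_eq_square add.commute)
  have "integrable M (\<lambda>\<omega>. g (of_real (X t \<omega>)))"
  proof (rule integrable_const_bound[where B=1])
    have "g \<circ> of_real \<in> borel_measurable borel" unfolding g_def o_def by measurable
    then show "(\<lambda>\<omega>. g (of_real (X t \<omega>))) \<in> borel_measurable M" unfolding o_def by measurable
  qed (rule AE_I2, rule gb, simp)
  then have I: "integrable M (\<lambda>\<omega>. Im (g (of_real (X t \<omega>))))"
    and E: "(LINT \<omega>|M. Im (g (of_real (X t \<omega>)))) = Im (g (\<i> * of_real t))"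
    using expectation_X[OF t gh _ gb] by simp_all
  have "Im (g (\<i> * of_real t)) = (1 + t) / (y^2 + (1 + t)^2)"
    by (simp add: g_def Im_divide power2_eq_square algebra_simps)
  then show ?thesis using nn_integral_eq_integral[OF I] E unfolding Img by simp
qed

lemma indep_increment:
  assumes "0 \<le> s" "s \<le> t"
  shows "indep_var borel (\<lambda>\<omega>. X s \<omega> - X 0 \<omega>) borel (\<lambda>\<omega>. X t \<omega> - X s \<omega>)"
proof -
  define \<tau> :: "nat \<Rightarrow> real" where "\<tau> = (\<lambda>i. if i = 0 then 0 else if i = 1 then s else t)"
  have "mono \<tau>" using assms by (auto simp: mono_def \<tau>_def)
  then have iv: "indep_vars (\<lambda>_. borel) (\<lambda>i \<omega>. X (\<tau> (Suc i)) \<omega> - X (\<tau> i) \<omega>) {..<2}"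
    by (intro indep_increments) (auto simp: \<tau>_def)
  have "indep_var (PiM {0} (\<lambda>_. borel)) (\<lambda>\<omega>. restrict (\<lambda>i. X (\<tau> (Suc i)) \<omega> - X (\<tau> i) \<omega>) {0})
                  (PiM {1} (\<lambda>_. borel)) (\<lambda>\<omega>. restrict (\<lambda>i. X (\<tau> (Suc i)) \<omega> - X (\<tau> i) \<omega>) {1})"
    by (rule indep_var_restrict[OF iv]) auto
  from indep_var_compose[OF this, of "\<lambda>f. f 0" borel "\<lambda>f. f 1" borel]
  show ?thesis by (simp add: o_def \<tau>_def)
qed

lemma nn_expectation_increment:
  assumes s: "0 < s" "s \<le> t" and [measurable]: "case_prod g \<in> borel_measurable (borel \<Otimes>\<^sub>M borel)"
  shows "(\<integral>\<^sup>+\<omega>. g (X s \<omega>) (X t \<omega> - X s \<omega>) \<partial>M)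
     = (\<integral>\<^sup>+v. (\<integral>\<^sup>+z. ennreal (cauchy_density s z) * g z v \<partial>lborel) \<partial>distr M borel (\<lambda>\<omega>. X t \<omega> - X s \<omega>))"
proof -
  have [measurable]: "X s \<in> borel_measurable M" "X t \<in> borel_measurable M" "X 0 \<in> borel_measurable M"
    using s by (auto intro: measurable_X)
  define U V where "U = (\<lambda>\<omega>. X s \<omega> - X 0 \<omega>)" and "V = (\<lambda>\<omega>. X t \<omega> - X s \<omega>)"
  have [measurable]: "U \<in> borel_measurable M" "V \<in> borel_measurable M" unfolding U_def V_def by measurable
  have dU: "distr M borel U = density lborel (cauchy_density s)"
    using stationary_increments[of 0 s] s distr_X by (simp add: U_def)
  have prod: "distr M borel U \<Otimes>\<^sub>M distr M borel V = distr M (borel \<Otimes>\<^sub>M borel) (\<lambda>\<omega>. (U \<omega>, V \<omega>))"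
    using indep_increment[of s t] s unfolding indep_var_distribution_eq U_def V_def by simp
  interpret U: prob_space "distr M borel U" by (rule prob_space_distr) measurable
  interpret V: prob_space "distr M borel V" by (rule prob_space_distr) measurable
  interpret UV: pair_sigma_finite "distr M borel U" "distr M borel V" ..
  have "(\<integral>\<^sup>+\<omega>. g (X s \<omega>) (X t \<omega> - X s \<omega>) \<partial>M) = (\<integral>\<^sup>+\<omega>. g (U \<omega>) (V \<omega>) \<partial>M)"
    by (rule nn_integral_cong_AE) (use start in eventually_elim, simp add: U_def V_def)
  also have "\<dots> = (\<integral>\<^sup>+p. case_prod g p \<partial>distr M (borel \<Otimes>\<^sub>M borel) (\<lambda>\<omega>. (U \<omega>, V \<omega>)))"
    by (subst nn_integral_distr) simp_all
  also have "\<dots> = (\<integral>\<^sup>+v. (\<integral>\<^sup>+z. g z v \<partial>distr M borel U) \<partial>distr M borel V)"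
    unfolding prod[symmetric]
    by (subst UV.nn_integral_snd[symmetric]) simp_all
  also have "\<dots> = (\<integral>\<^sup>+v. (\<integral>\<^sup>+z. ennreal (cauchy_density s z) * g z v \<partial>lborel) \<partial>distr M borel V)"
    unfolding dU by (intro nn_integral_cong nn_integral_density) auto
  finally show ?thesis by (simp add: V_def)
qed

text \<open>
  Joint measurability: by right-continuity the process is the limit of its values at the next point of the
  grid of width \<open>1 / (n + 1)\<close>, and this point takes countably many values.
\<close>

lemma process_measurable [measurable]:
  "(\<lambda>p. X (max 0 (fst p)) (snd p)) \<in> borel_measurable (borel \<Otimes>\<^sub>M M)"
proof -
  define r where "r = (\<lambda>n s. (real_of_int \<lfloor>real (Suc n) * max 0 s\<rfloor> + 1) / real (Suc n))"
  have r: "max 0 s < r n s" "r n s \<le> max 0 s + 1 / real (Suc n)" for n s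
  proof -
    have "real (Suc n) * max 0 s < real_of_int \<lfloor>real (Suc n) * max 0 s\<rfloor> + 1" by linarith
    then show "max 0 s < r n s" by (simp only: r_def pos_less_divide_eq of_nat_0_less_iff zero_less_Suc mult.commute)
    have "r n s \<le> (real (Suc n) * max 0 s + 1) / real (Suc n)"
      unfolding r_def by (intro divide_right_mono) auto
    also have "\<dots> = max 0 s + 1 / real (Suc n)" by (simp add: add_divide_distrib)
    finally show "r n s \<le> max 0 s + 1 / real (Suc n)" .
  qed
  show ?thesis
  proof (rule borel_measurable_LIMSEQ_metric[where f="\<lambda>n p. X (r n (fst p)) (snd p)"])
    fix n
    have "(\<lambda>p. X (max 0 ((real_of_int \<lfloor>real (Suc n) * max 0 (fst p)\<rfloor> + 1) / real (Suc n))) (snd p))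
        \<in> borel_measurable (borel \<Otimes>\<^sub>M M)"
    proof (rule measurable_compose_countable[where f="\<lambda>k p. X (max 0 ((real_of_int k + 1) / real (Suc n))) (snd p)"
          and g="\<lambda>p. \<lfloor>real (Suc n) * max 0 (fst p)\<rfloor>"])
      show "(\<lambda>p. X (max 0 ((real_of_int k + 1) / real (Suc n))) (snd p)) \<in> borel_measurable (borel \<Otimes>\<^sub>M M)" for k :: int
        by (rule measurable_compose[OF measurable_snd measurable_X]) simp
    qed measurable
    moreover have "max 0 (r n s) = r n s" for s using r(1)[of s n] by simp
    ultimately show "(\<lambda>p. X (r n (fst p)) (snd p)) \<in> borel_measurable (borel \<Otimes>\<^sub>M M)"
      unfolding r_def by simp
  next
    fix p :: "real \<times> 'a" assume "p \<in> space (borel \<Otimes>\<^sub>M M)"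
    then have \<omega>: "snd p \<in> space M" by (auto simp: space_pair_measure)
    define m where "m = max 0 (fst p)"
    have "(\<lambda>n. m + 1 / real (Suc n)) \<longlonglongrightarrow> m"
      using tendsto_add[OF tendsto_const LIMSEQ_Suc[OF lim_inverse_n'], of m] by (simp add: inverse_eq_divide)
    moreover have r': "m < r n (fst p)" "r n (fst p) \<le> m + 1 / real (Suc n)" for n
      unfolding m_def by (rule r)+
    ultimately have "(\<lambda>n. r n (fst p)) \<longlonglongrightarrow> m"
      by (intro tendsto_sandwich[of "\<lambda>_. m" "\<lambda>n. r n (fst p)" sequentially "\<lambda>n. m + 1 / real (Suc n)"])
         (auto intro!: always_eventually less_imp_le[OF r'(1)])
    moreover have "r n (fst p) \<in> {m<..} \<and> r n (fst p) \<noteq> m" for n using r'(1)[of n] by simp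
    ultimately have "filterlim (\<lambda>n. r n (fst p)) (at_right (max 0 (fst p))) sequentially"
      unfolding filterlim_at m_def by (auto simp del: greaterThan_iff)
    then show "(\<lambda>n. X (r n (fst p)) (snd p)) \<longlonglongrightarrow> X (max 0 (fst p)) (snd p)"
      using right_continuous[OF \<omega>, of "max 0 (fst p)"] by (auto intro: filterlim_compose)
  qed
qed

end

section \<open>The Feynman--Kac weight for short times\<close>

lemma L2_translate:
  assumes "f \<in> L2"
  shows "(\<lambda>x. f (x + a)) \<in> L2" "l2sq (\<lambda>x. f (x + a)) = l2sq f"
proof -
  have [measurable]: "f \<in> borel_measurable borel" using assms by (rule L2_measurable)
  have "L2_normsq f = L2_normsq (\<lambda>x. f (x + a))"
    unfolding L2_normsq_def
    by (subst nn_integral_real_affine[where c=1 and t=a]) (simp_all add: add.commute)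
  then show "(\<lambda>x. f (x + a)) \<in> L2" "l2sq (\<lambda>x. f (x + a)) = l2sq f"
    using assms by (auto simp: L2_def l2sq_def)
qed

context cauchy_process
begin

definition action :: "real \<Rightarrow> real \<Rightarrow> 'a \<Rightarrow> real" where
  "action t x \<omega> = (LINT s:{0..t}|lborel. (x + X s \<omega>)^2)"

lemma action_eq: "action t x \<omega> = (LINT s|lborel. indicator {0..t} s * (x + X (max 0 s) \<omega>)^2)"
  unfolding action_def set_lebesgue_integral_def
  by (intro Bochner_Integration.integral_cong refl) (auto simp: indicator_def)

lemma action_nonneg: "0 \<le> action t x \<omega>"
  unfolding action_eq by (intro integral_nonneg_AE AE_I2) simp

text \<open>
  If the integrand is not integrable then the Bochner integral on the left is 0, so the inequality is trivial.
\<close>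

lemma action_le: "ennreal (action t x \<omega>) \<le> (\<integral>\<^sup>+s. ennreal (indicator {0..t} s * (x + X (max 0 s) \<omega>)^2) \<partial>lborel)"
proof (cases "integrable lborel (\<lambda>s. indicator {0..t} s * (x + X (max 0 s) \<omega>)^2)")
  case True
  then show ?thesis unfolding action_eq by (subst nn_integral_eq_integral) auto
next
  case False
  then show ?thesis unfolding action_eq by (simp add: not_integrable_integral_eq)
qed

lemma action_measurable [measurable]: "(\<lambda>p. action t (fst p) (snd p)) \<in> borel_measurable (borel \<Otimes>\<^sub>M M)"
proof -
  have "(\<lambda>q. X (max 0 (fst (snd q, snd (fst q)))) (snd (snd q, snd (fst q))))
      \<in> borel_measurable ((borel \<Otimes>\<^sub>M M) \<Otimes>\<^sub>M lborel)"
    by (rule measurable_compose[OF _ process_measurable]) measurable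
  then have [measurable]: "(\<lambda>q. X (max 0 (snd q)) (snd (fst q))) \<in> borel_measurable ((borel \<Otimes>\<^sub>M M) \<Otimes>\<^sub>M lborel)"
    by simp
  have "(\<lambda>(p, s). indicator {0..t} s * (fst p + X (max 0 s) (snd p))^2) \<in> borel_measurable ((borel \<Otimes>\<^sub>M M) \<Otimes>\<^sub>M lborel)"
    unfolding case_prod_beta by measurable
  from lborel.borel_measurable_lebesgue_integral[OF this] show ?thesis by (simp add: action_eq)
qed

lemma FK_semigroup_eq: "FK_semigroup M X t f x = (LINT \<omega>|M. of_real (exp (- action t x \<omega>)) * f (x + X t \<omega>))"
  unfolding FK_semigroup_def action_def ..

text \<open>
  The substitution \<open>x = y - X\<^sub>t\<close> moves the random shift from \<open>\<phi>\<close>, of which only the \<open>L\<^sup>2\<close> norm is known, to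
  the test function \<open>h\<close>, which is explicit.
\<close>

lemma Fubini_shift:
  assumes h: "h \<in> L2" and \<phi>: "\<phi> \<in> L2" and t: "0 < t"
    and c[measurable]: "(\<lambda>p. c (fst p) (snd p)) \<in> borel_measurable (borel \<Otimes>\<^sub>M M)"
    and C: "\<And>x \<omega>. \<bar>c x \<omega>\<bar> \<le> (C::real)"
  shows "integrable lborel (\<lambda>x. h x * (LINT \<omega>|M. of_real (c x \<omega>) * \<phi> (x + X t \<omega>)))"
    and "integrable M (\<lambda>\<omega>. LINT y|lborel. h (y - X t \<omega>) * (of_real (c (y - X t \<omega>) \<omega>) * \<phi> y))"
    and "(LINT x|lborel. h x * (LINT \<omega>|M. of_real (c x \<omega>) * \<phi> (x + X t \<omega>)))
       = (LINT \<omega>|M. LINT y|lborel. h (y - X t \<omega>) * (of_real (c (y - X t \<omega>) \<omega>) * \<phi> y))"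
proof -
  interpret P: pair_sigma_finite lborel M ..
  have [measurable]: "X t \<in> borel_measurable M" using t by (intro measurable_X) simp
  have [measurable]: "h \<in> borel_measurable borel" "\<phi> \<in> borel_measurable borel" using h \<phi> by (auto intro: L2_measurable)
  have C0: "0 \<le> C" using C[of 0 undefined] by (meson abs_ge_zero order_trans)
  define k where "k = (\<lambda>x \<omega>. h x * (of_real (c x \<omega>) * \<phi> (x + X t \<omega>)))"
  have [measurable]: "(\<lambda>p. complex_of_real (c (fst p) (snd p))) \<in> borel_measurable (lborel \<Otimes>\<^sub>M M)"
    by measurable
  have km[measurable]: "case_prod k \<in> borel_measurable (lborel \<Otimes>\<^sub>M M)"
    unfolding k_def case_prod_beta by measurable
  have "(\<integral>\<^sup>+p. ennreal (norm (case_prod k p)) \<partial>(lborel \<Otimes>\<^sub>M M))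
      = (\<integral>\<^sup>+\<omega>. (\<integral>\<^sup>+x. ennreal (norm (k x \<omega>)) \<partial>lborel) \<partial>M)"
    by (subst P.nn_integral_snd[symmetric]) (simp_all add: case_prod_beta)
  also have "\<dots> \<le> (\<integral>\<^sup>+\<omega>. ennreal C * ennreal (sqrt (l2sq h) * sqrt (l2sq \<phi>)) \<partial>M)"
  proof (intro nn_integral_mono)
    fix \<omega>
    have "(\<integral>\<^sup>+x. ennreal (norm (k x \<omega>)) \<partial>lborel) \<le> (\<integral>\<^sup>+x. ennreal C * ennreal (cmod (h x) * cmod (\<phi> (x + X t \<omega>))) \<partial>lborel)"
    proof (intro nn_integral_mono)
      fix x
      have "norm (k x \<omega>) = \<bar>c x \<omega>\<bar> * (cmod (h x) * cmod (\<phi> (x + X t \<omega>)))"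
        by (simp add: k_def norm_mult)
      also have "\<dots> \<le> C * (cmod (h x) * cmod (\<phi> (x + X t \<omega>)))"
        by (intro mult_right_mono C) auto
      finally show "ennreal (norm (k x \<omega>)) \<le> ennreal C * ennreal (cmod (h x) * cmod (\<phi> (x + X t \<omega>)))"
        using C0 by (simp flip: ennreal_mult add: ennreal_leI)
    qed
    also have "\<dots> = ennreal C * (\<integral>\<^sup>+x. ennreal (cmod (h x) * cmod (\<phi> (x + X t \<omega>))) \<partial>lborel)"
      by (rule nn_integral_cmult) measurable
    also have "\<dots> \<le> ennreal C * ennreal (sqrt (l2sq h) * sqrt (l2sq \<phi>))"
      using L2_Cauchy_Schwarz(3)[OF h L2_translate(1)[OF \<phi>, of "X t \<omega>"]] unfolding L2_translate(2)[OF \<phi>]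
      by (intro mult_left_mono) auto
    finally show "(\<integral>\<^sup>+x. ennreal (norm (k x \<omega>)) \<partial>lborel) \<le> ennreal C * ennreal (sqrt (l2sq h) * sqrt (l2sq \<phi>))" .
  qed
  also have "\<dots> < \<infinity>" by (simp add: emeasure_space_1 ennreal_mult_less_top)
  finally have kint: "integrable (lborel \<Otimes>\<^sub>M M) (case_prod k)"
    by (intro integrableI_bounded km) auto
  have sub: "(LINT x|lborel. k x \<omega>) = (LINT y|lborel. h (y - X t \<omega>) * (of_real (c (y - X t \<omega>) \<omega>) * \<phi> y))" for \<omega>
    using lborel_integral_real_affine[of 1 "\<lambda>x. k x \<omega>" "- X t \<omega>"] by (simp add: k_def add.commute)
  show "integrable lborel (\<lambda>x. h x * (LINT \<omega>|M. of_real (c x \<omega>) * \<phi> (x + X t \<omega>)))"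
    using P.integrable_fst[OF kint] by (simp add: k_def)
  show "integrable M (\<lambda>\<omega>. LINT y|lborel. h (y - X t \<omega>) * (of_real (c (y - X t \<omega>) \<omega>) * \<phi> y))"
    using P.integrable_snd[OF kint] unfolding sub .
  show "(LINT x|lborel. h x * (LINT \<omega>|M. of_real (c x \<omega>) * \<phi> (x + X t \<omega>)))
       = (LINT \<omega>|M. LINT y|lborel. h (y - X t \<omega>) * (of_real (c (y - X t \<omega>) \<omega>) * \<phi> y))"
    using P.Fubini_integral[OF kint] unfolding sub by (simp add: k_def)
qed

text \<open>
  The free motion translates the pole \<open>w\<close> by \<open>\<i> t\<close>, exactly and for every \<open>t\<close>.
\<close>

lemma expectation_resolvent_kernel:
  assumes t: "0 < t" and w: "0 < Im w"
  shows "(LINT \<omega>|M. 1 / (of_real (y - X t \<omega>) - w) ^ 3) = 1 / (of_real y - (w + \<i> * of_real t)) ^ 3"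
proof -
  define g where "g = (\<lambda>z. 1 / (of_real y - z - w) ^ 3)"
  have nz: "of_real y - z - w \<noteq> 0" if "- Im w < Im z" for z using that by (auto simp: complex_eq_iff)
  have gb: "cmod (g z) \<le> 1 / (Im w) ^ 3" if "0 \<le> Im z" for z
  proof -
    have "Im w \<le> cmod (of_real y - z - w)" using abs_Im_le_cmod[of "of_real y - z - w"] that w by simp
    then show ?thesis using w by (simp add: g_def norm_divide norm_power frac_le power_mono)
  qed
  have gh: "g holomorphic_on {z. - Im w < Im z}"
    unfolding g_def by (intro holomorphic_intros) (use nz in auto)
  show ?thesis using expectation_X[OF t gh w gb] by (simp add: g_def algebra_simps)
qed

text \<open>
  A majorant for the part of \<open>(1 - exp (- action)) / t\<close> that is due to values of the path of modulus greater than 1.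
  The cap \<open>1 / t\<close> is the trivial bound; without it the expectation would not decay in the space variable.
\<close>

definition excess :: "real \<Rightarrow> 'a \<Rightarrow> ennreal" where
  "excess t \<omega> = min (ennreal (1 / t))
     (ennreal (2 / t) * (\<integral>\<^sup>+s. ennreal (indicator {0..t} s * ((X (max 0 s) \<omega>)^2 * indicator {z. 1 < \<bar>z\<bar>} (X (max 0 s) \<omega>))) \<partial>lborel))"

lemma big_jump_measurable:
  "(\<lambda>q. ennreal (indicator {0..t} (snd q) * ((X (max 0 (snd q)) (fst q))^2 * indicator {z. 1 < \<bar>z\<bar>} (X (max 0 (snd q)) (fst q)))))
     \<in> borel_measurable (M \<Otimes>\<^sub>M lborel)"
proof -
  have "(\<lambda>q. X (max 0 (fst (snd q, fst q))) (snd (snd q, fst q))) \<in> borel_measurable (M \<Otimes>\<^sub>M lborel)"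
    by (rule measurable_compose[OF _ process_measurable]) measurable
  then have [measurable]: "(\<lambda>q. X (max 0 (snd q)) (fst q)) \<in> borel_measurable (M \<Otimes>\<^sub>M lborel)" by simp
  have [measurable]: "{z::real. 1 < \<bar>z\<bar>} \<in> sets borel" by measurable
  show ?thesis by measurable
qed

lemma excess_measurable [measurable]: "excess t \<in> borel_measurable M"
proof -
  have "(\<lambda>\<omega>. \<integral>\<^sup>+s. ennreal (indicator {0..t} s * ((X (max 0 s) \<omega>)^2 * indicator {z. 1 < \<bar>z\<bar>} (X (max 0 s) \<omega>))) \<partial>lborel)
     \<in> borel_measurable M"
    using lborel.borel_measurable_nn_integral_fst[OF big_jump_measurable] by simp
  then show ?thesis unfolding excess_def[abs_def] by measurable
qed

text \<open>
  Two bounds are combined. For fixed \<open>s\<close> the increment \<open>X\<^sub>t - X\<^sub>s\<close> is independent of \<open>X\<^sub>s\<close>, whose density times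
  \<open>z\<^sup>2\<close> is at most \<open>s / \<pi>\<close>; hence \<open>X\<^sub>s\<^sup>2\<close> has a finite expectation against \<open>1 / (1 + (y - X\<^sub>t)\<^sup>2)\<close>, although its
  expectation is infinite, and this gives \<open>O(t)\<close>. The trivial bound \<open>1 / t\<close> for the excess gives \<open>O(1 / (t y\<^sup>2))\<close>.
  Together they decay in \<open>y\<close> and tend to 0 in \<open>L\<^sup>2\<close>, which neither does alone.
\<close>

lemma expectation_excess:
  assumes t: "0 < t" "t \<le> 1"
  shows "(\<integral>\<^sup>+\<omega>. ennreal (1 / (1 + (y - X t \<omega>)^2)) * excess t \<omega> \<partial>M) \<le> ennreal (4 * t / (1 + t^2 * y^2))"
proof -
  interpret P: pair_sigma_finite M lborel ..
  have [measurable]: "X t \<in> borel_measurable M" using t by (intro measurable_X) simp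
  have [measurable]: "{z::real. 1 < \<bar>z\<bar>} \<in> sets borel" by measurable
  define j where "j = (\<lambda>u. 1 / (1 + u^2) :: real)"
  define b where "b = (\<lambda>z. z^2 * indicator {z. 1 < \<bar>z\<bar>} z :: real)"
  have [measurable]: "j \<in> borel_measurable borel" "b \<in> borel_measurable borel" unfolding j_def b_def by measurable
  have j0: "0 \<le> j u" and b0: "0 \<le> b u" for u by (auto simp: j_def b_def)
  have jtot: "(\<integral>\<^sup>+z. ennreal (j (a - z)) \<partial>lborel) = ennreal pi" for a
    using poisson_kernel_total(3)[of 1 a] by (simp add: j_def power2_commute add.commute)
  have dens: "cauchy_density s z * b z \<le> s / pi" if "0 < s" for s z
  proof -
    have "cauchy_density s z * b z \<le> s / pi * (1 / (z^2 + s^2) * z^2)"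
      using that by (auto simp: cauchy_density_def b_def indicator_def)
    also have "\<dots> \<le> s / pi * 1"
    proof (rule mult_left_mono)
      have "0 < z^2 + s^2" using that by (simp add: add_nonneg_pos)
      then show "1 / (z^2 + s^2) * z^2 \<le> 1" by (simp add: divide_le_eq)
    qed (use that in simp)
    finally show ?thesis by simp
  qed
  have fixed: "(\<integral>\<^sup>+\<omega>. ennreal (j (y - X t \<omega>) * b (X s \<omega>)) \<partial>M) \<le> ennreal t" if s: "0 < s" "s \<le> t" for s
  proof -
    have [measurable]: "X s \<in> borel_measurable M" using s by (intro measurable_X) simp
    have "(\<integral>\<^sup>+\<omega>. ennreal (j (y - X t \<omega>) * b (X s \<omega>)) \<partial>M)
        = (\<integral>\<^sup>+\<omega>. ennreal (j (y - (X t \<omega> - X s \<omega>) - X s \<omega>) * b (X s \<omega>)) \<partial>M)" by simp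
    also have "\<dots> = (\<integral>\<^sup>+v. (\<integral>\<^sup>+z. ennreal (cauchy_density s z) * ennreal (j (y - v - z) * b z) \<partial>lborel) \<partial>distr M borel (\<lambda>\<omega>. X t \<omega> - X s \<omega>))"
      by (rule nn_expectation_increment[OF s, of "\<lambda>z v. ennreal (j (y - v - z) * b z)"]) measurable
    also have "\<dots> \<le> (\<integral>\<^sup>+v. ennreal s \<partial>distr M borel (\<lambda>\<omega>. X t \<omega> - X s \<omega>))"
    proof (intro nn_integral_mono)
      fix v
      have "(\<integral>\<^sup>+z. ennreal (cauchy_density s z) * ennreal (j (y - v - z) * b z) \<partial>lborel)
          \<le> (\<integral>\<^sup>+z. ennreal (s / pi) * ennreal (j (y - v - z)) \<partial>lborel)"
      proof (intro nn_integral_mono)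
        fix z
        have "cauchy_density s z * (j (y - v - z) * b z) \<le> s / pi * j (y - v - z)"
          using mult_right_mono[OF dens[OF s(1), of z] j0[of "y - v - z"]] by (simp add: mult_ac)
        then show "ennreal (cauchy_density s z) * ennreal (j (y - v - z) * b z) \<le> ennreal (s / pi) * ennreal (j (y - v - z))"
          using s j0 b0 cauchy_density_nonneg[OF s(1), of z]
          by (simp flip: ennreal_mult add: ennreal_leI)
      qed
      also have "\<dots> = ennreal (s / pi) * ennreal pi" by (subst nn_integral_cmult) (simp_all add: jtot)
      also have "\<dots> = ennreal s" using s by (simp flip: ennreal_mult)
      finally show "(\<integral>\<^sup>+z. ennreal (cauchy_density s z) * ennreal (j (y - v - z) * b z) \<partial>lborel) \<le> ennreal s" .
    qed
    also have "\<dots> = ennreal s"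
    proof -
      interpret V: prob_space "distr M borel (\<lambda>\<omega>. X t \<omega> - X s \<omega>)" by (rule prob_space_distr) measurable
      show ?thesis using V.emeasure_space_1 by simp
    qed
    also have "\<dots> \<le> ennreal t" using s by (intro ennreal_leI)
    finally show ?thesis .
  qed
  define B where "B = (\<lambda>\<omega>. \<integral>\<^sup>+s. ennreal (indicator {0..t} s * b (X (max 0 s) \<omega>)) \<partial>lborel)"
  note bm = big_jump_measurable[of t, folded b_def]
  have [measurable]: "B \<in> borel_measurable M"
    unfolding B_def using lborel.borel_measurable_nn_integral_fst[OF big_jump_measurable[of t]] by (simp add: b_def)
  have ex: "excess t \<omega> = min (ennreal (1 / t)) (ennreal (2 / t) * B \<omega>)" for \<omega>
    by (simp add: excess_def B_def b_def)
  have bound1: "(\<integral>\<^sup>+\<omega>. ennreal (j (y - X t \<omega>)) * excess t \<omega> \<partial>M) \<le> ennreal (2 * t)"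
  proof -
    have "(\<integral>\<^sup>+\<omega>. ennreal (j (y - X t \<omega>)) * excess t \<omega> \<partial>M)
        \<le> (\<integral>\<^sup>+\<omega>. ennreal (2 / t) * (ennreal (j (y - X t \<omega>)) * B \<omega>) \<partial>M)"
      unfolding ex by (intro nn_integral_mono) (metis min.cobounded2 mult.left_commute mult_left_mono zero_le)
    also have "\<dots> = ennreal (2 / t) * (\<integral>\<^sup>+\<omega>. ennreal (j (y - X t \<omega>)) * B \<omega> \<partial>M)"
      by (rule nn_integral_cmult) measurable
    also have "(\<integral>\<^sup>+\<omega>. ennreal (j (y - X t \<omega>)) * B \<omega> \<partial>M)
       = (\<integral>\<^sup>+\<omega>. (\<integral>\<^sup>+s. ennreal (j (y - X t \<omega>)) * ennreal (indicator {0..t} s * b (X (max 0 s) \<omega>)) \<partial>lborel) \<partial>M)"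
    proof (intro nn_integral_cong)
      fix \<omega> assume "\<omega> \<in> space M"
      then have "(\<lambda>s. ennreal (indicator {0..t} s * b (X (max 0 s) \<omega>))) \<in> borel_measurable lborel"
        using measurable_Pair2[OF big_jump_measurable[of t], of \<omega>] by (simp add: b_def)
      then show "ennreal (j (y - X t \<omega>)) * B \<omega> = (\<integral>\<^sup>+s. ennreal (j (y - X t \<omega>)) * ennreal (indicator {0..t} s * b (X (max 0 s) \<omega>)) \<partial>lborel)"
        unfolding B_def by (rule nn_integral_cmult[symmetric])
    qed
    also have "\<dots> = (\<integral>\<^sup>+s. (\<integral>\<^sup>+\<omega>. ennreal (j (y - X t \<omega>)) * ennreal (indicator {0..t} s * b (X (max 0 s) \<omega>)) \<partial>M) \<partial>lborel)"
    proof (rule P.Fubini'[symmetric])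
      have "(\<lambda>q. ennreal (indicator {0..t} (snd q) * b (X (max 0 (snd q)) (fst q)))) \<in> borel_measurable (M \<Otimes>\<^sub>M lborel)"
        using big_jump_measurable[of t] by (simp add: b_def)
      note [measurable] = this
      show "(\<lambda>(\<omega>, s). ennreal (j (y - X t \<omega>)) * ennreal (indicator {0..t} s * b (X (max 0 s) \<omega>))) \<in> borel_measurable (M \<Otimes>\<^sub>M lborel)"
        unfolding case_prod_beta by measurable
    qed
    also have "\<dots> \<le> (\<integral>\<^sup>+s. ennreal t * indicator {0..t} s \<partial>lborel)"
    proof (rule nn_integral_mono_AE)
      show "AE s in lborel. (\<integral>\<^sup>+\<omega>. ennreal (j (y - X t \<omega>)) * ennreal (indicator {0..t} s * b (X (max 0 s) \<omega>)) \<partial>M) \<le> ennreal t * indicator {0..t} s"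
        \<comment> \<open>The bound for fixed \<open>s\<close> uses the density of \<open>X s\<close>, hence \<open>s > 0\<close>.\<close>
        using AE_lborel_singleton[of 0]
      proof eventually_elim
        fix s :: real assume "s \<noteq> 0"
        show "(\<integral>\<^sup>+\<omega>. ennreal (j (y - X t \<omega>)) * ennreal (indicator {0..t} s * b (X (max 0 s) \<omega>)) \<partial>M) \<le> ennreal t * indicator {0..t} s"
        proof (cases "s \<in> {0..t}")
          case True
          with \<open>s \<noteq> 0\<close> have "0 < s" "s \<le> t" "max 0 s = s" by auto
          with fixed[of s] show ?thesis by (simp add: ennreal_mult j0 b0)
        qed simp
      qed
    qed
    also have "\<dots> = ennreal (t * t)" using t by (simp add: nn_integral_cmult_indicator ennreal_mult)
    finally have "(\<integral>\<^sup>+\<omega>. ennreal (j (y - X t \<omega>)) * excess t \<omega> \<partial>M) \<le> ennreal (2 / t) * ennreal (t * t)"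
      by (simp add: mult_left_mono)
    also have "\<dots> = ennreal (2 * t)" using t by (simp flip: ennreal_mult)
    finally show ?thesis .
  qed
  have bound2: "(\<integral>\<^sup>+\<omega>. ennreal (j (y - X t \<omega>)) * excess t \<omega> \<partial>M) \<le> ennreal (2 / (t * (1 + y^2)))"
  proof -
    have "(\<integral>\<^sup>+\<omega>. ennreal (j (y - X t \<omega>)) * excess t \<omega> \<partial>M) \<le> (\<integral>\<^sup>+\<omega>. ennreal (1 / t) * ennreal (j (y - X t \<omega>)) \<partial>M)"
      unfolding ex by (intro nn_integral_mono) (metis min.cobounded1 mult.commute mult_left_mono zero_le)
    also have "\<dots> = ennreal (1 / t) * ennreal ((1 + t) / (y^2 + (1 + t)^2))"
      using expectation_cauchy_kernel_X[OF t(1), of y] by (subst nn_integral_cmult) (simp_all add: j_def)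
    also have "\<dots> = ennreal (1 / t * ((1 + t) / (y^2 + (1 + t)^2)))" using t by (simp flip: ennreal_mult)
    also have "\<dots> \<le> ennreal (1 / t * (2 / (1 + y^2)))"
    proof (intro ennreal_leI mult_left_mono frac_le)
      have "1 * 1 \<le> (1 + t) * (1 + t)" using t by (intro mult_mono) auto
      then show "1 + y^2 \<le> y^2 + (1 + t)^2" by (simp add: power2_eq_square)
      show "0 < 1 + y^2" by (simp add: add_pos_nonneg)
    qed (use t in auto)
    finally show ?thesis by simp
  qed
  have ty: "0 < 1 + t^2 * y^2" by (simp add: add_pos_nonneg)
  show ?thesis
  proof (cases "t^2 * y^2 \<le> 1")
    case True
    have "2 * t \<le> 4 * t / (1 + t^2 * y^2)"
      using True ty t by (simp add: pos_le_divide_eq)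
    then show ?thesis using bound1 by (auto simp: j_def intro: order_trans ennreal_leI)
  next
    case False
    have "2 / (t * (1 + y^2)) \<le> 4 * t / (1 + t^2 * y^2)"
    proof -
      have "2 * (1 + t^2 * y^2) \<le> 4 * (t^2 * y^2)" using False by simp
      also have "\<dots> \<le> 4 * t * (t * (1 + y^2))" using t by (simp add: power2_eq_square algebra_simps)
      finally have le: "2 * (1 + t^2 * y^2) \<le> 4 * t * (t * (1 + y^2))" .
      have "0 < t * (1 + y^2)" using t by (intro mult_pos_pos add_pos_nonneg) auto
      then show ?thesis
        using le by (simp only: pos_divide_le_eq times_divide_eq_left pos_le_divide_eq[OF ty])
    qed
    then show ?thesis using bound2 by (auto simp: j_def intro: order_trans ennreal_leI)
  qed
qed

end

lemma one_plus_square_le: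
  assumes w: "0 < Im w"
  shows "1 + u^2 \<le> (2 + (1 + 2 * (cmod w)^2) / (Im w)^2) * (cmod (complex_of_real u - w))^2"
proof -
  define v where "v = complex_of_real u - w"
  have "\<bar>Im w\<bar> \<le> cmod v" unfolding v_def by (rule Im_le_cmod_of_real_minus)
  then have "(Im w)^2 \<le> (cmod v)^2" using w by (intro power_mono) auto
  then have 1: "1 \<le> (cmod v)^2 / (Im w)^2" using w by simp
  have "\<bar>u\<bar> \<le> cmod v + cmod w"
    using norm_triangle_ineq[of v w] by (simp add: v_def)
  then have "u^2 \<le> (cmod v + cmod w)^2" by (metis abs_ge_zero power2_abs power_mono)
  also have "\<dots> \<le> 2 * (cmod v)^2 + 2 * (cmod w)^2"
    using sum_squares_bound[of "cmod v" "cmod w"] by (simp add: power2_sum)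
  finally have "1 + u^2 \<le> 2 * (cmod v)^2 + (1 + 2 * (cmod w)^2) * 1" by simp
  also have "\<dots> \<le> 2 * (cmod v)^2 + (1 + 2 * (cmod w)^2) * ((cmod v)^2 / (Im w)^2)"
    by (intro add_left_mono mult_left_mono 1) auto
  also have "\<dots> = (2 + (1 + 2 * (cmod w)^2) / (Im w)^2) * (cmod v)^2"
    by (simp add: distrib_right)
  finally show ?thesis by (simp add: v_def)
qed

lemma one_minus_exp_bounds:
  assumes "0 \<le> (a::real)"
  shows "1 - exp (- a) \<le> a" "a / (1 + a) \<le> 1 - exp (- a)"
proof -
  show "1 - exp (- a) \<le> a" using exp_ge_add_one_self[of "- a"] by simp
  have "1 + a \<le> exp a" by (rule exp_ge_add_one_self)
  then have "exp (- a) \<le> 1 / (1 + a)" using assms by (simp add: exp_minus field_simps)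
  moreover have "a / (1 + a) = 1 - 1 / (1 + a)" using assms by (simp add: field_simps)
  ultimately show "a / (1 + a) \<le> 1 - exp (- a)" by linarith
qed

context cauchy_process
begin

lemma path_measurable:
  assumes "\<omega> \<in> space M"
  shows "(\<lambda>s. X (max 0 s) \<omega>) \<in> borel_measurable borel"
proof -
  have "(\<lambda>s. (s, \<omega>)) \<in> borel \<rightarrow>\<^sub>M borel \<Otimes>\<^sub>M M" using assms by measurable
  from measurable_compose[OF this process_measurable] show ?thesis by simp
qed

lemma action_short_time:
  assumes \<omega>: "\<omega> \<in> space M" "X 0 \<omega> = 0" and t: "\<And>n. 0 < t n" "t \<longlonglongrightarrow> 0" and u: "u \<longlonglongrightarrow> y"
  shows "(\<lambda>n. action (t n) (u n) \<omega> / t n) \<longlonglongrightarrow> y^2"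
proof (rule LIMSEQ_I)
  fix e :: real assume e: "0 < e"
  have "isCont (\<lambda>v::real. v^2) y" by (intro continuous_intros)
  then obtain d where d: "0 < d" "\<And>v. \<bar>v - y\<bar> < d \<Longrightarrow> \<bar>v^2 - y^2\<bar> < e / 2"
    using e unfolding continuous_at_eps_delta by (metis dist_real_def half_gt_zero)
  have "((\<lambda>s. X s \<omega>) \<longlongrightarrow> 0) (at_right 0)" using right_continuous[OF \<omega>(1), of 0] \<omega>(2) by simp
  then have "eventually (\<lambda>s. \<bar>X s \<omega>\<bar> < d / 2) (at_right 0)"
    using tendstoD[of "\<lambda>s. X s \<omega>" 0 "at_right 0" "d / 2"] d(1) by (simp add: dist_real_def)
  then obtain r where r: "0 < r" "\<And>s. 0 < s \<Longrightarrow> s < r \<Longrightarrow> \<bar>X s \<omega>\<bar> < d / 2"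
    by (auto simp: eventually_at_right_field)
  have "eventually (\<lambda>n. t n < r) sequentially" using t(2) r(1) by (rule order_tendstoD)
  moreover have "eventually (\<lambda>n. \<bar>u n - y\<bar> < d / 2) sequentially"
    using tendstoD[OF u, of "d / 2"] d(1) by (simp add: dist_real_def)
  ultimately have "eventually (\<lambda>n. \<bar>action (t n) (u n) \<omega> / t n - y^2\<bar> < e) sequentially"
  proof eventually_elim
    case (elim n)
    define F where "F = (\<lambda>s. indicator {0..t n} s * (u n + X (max 0 s) \<omega>)^2 :: real)"
    have [measurable]: "(\<lambda>s. X (max 0 s) \<omega>) \<in> borel_measurable borel" by (rule path_measurable[OF \<omega>(1)])
    have close: "\<bar>F s - indicator {0..t n} s * y^2\<bar> \<le> indicator {0..t n} s * (e / 2)" for s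
    proof (cases "s \<in> {0..t n}")
      case True
      then have "\<bar>X s \<omega>\<bar> < d / 2" using r(2)[of s] elim(1) \<omega>(2) d(1) by (cases "s = 0") auto
      then have "\<bar>(u n + X s \<omega>) - y\<bar> < d" using elim(2) by linarith
      from d(2)[OF this] True show ?thesis by (simp add: F_def max_def)
    qed (simp add: F_def)
    have i1: "integrable lborel (\<lambda>s. indicator {0..t n} s * c)" for c :: real
      using t(1)[of n] by (intro integrable_mult_left) (simp add: integrable_indicator_iff)
    have F: "integrable lborel F"
    proof (rule Bochner_Integration.integrable_bound[OF i1[of "y^2 + e / 2"]])
      show "F \<in> borel_measurable lborel" unfolding F_def by measurable
      show "AE s in lborel. norm (F s) \<le> norm (indicator {0..t n} s * (y^2 + e / 2))"
      proof (rule AE_I2)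
        fix s
        have "\<bar>F s\<bar> \<le> indicator {0..t n} s * y^2 + indicator {0..t n} s * (e / 2)"
        proof -
          have "\<bar>indicator {0..t n} s * y^2\<bar> = indicator {0..t n} s * y^2" by (simp add: abs_mult)
          then show ?thesis using close[of s] by linarith
        qed
        then show "norm (F s) \<le> norm (indicator {0..t n} s * (y^2 + e / 2))"
          using e by (simp add: distrib_left)
      qed
    qed
    have tot: "(LINT s|lborel. indicator {0..t n} s * c) = t n * c" for c :: real
      using t(1)[of n] by (simp add: less_imp_le)
    have "\<bar>action (t n) (u n) \<omega> - t n * y^2\<bar> = \<bar>LINT s|lborel. F s - indicator {0..t n} s * y^2\<bar>"
      unfolding action_eq F_def[symmetric] Bochner_Integration.integral_diff[OF F i1] tot ..
    also have "\<dots> \<le> (LINT s|lborel. \<bar>F s - indicator {0..t n} s * y^2\<bar>)" by (rule integral_abs_bound)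
    also have "\<dots> \<le> (LINT s|lborel. indicator {0..t n} s * (e / 2))"
      by (intro integral_mono close integrable_abs Bochner_Integration.integrable_diff F i1)
    also have "\<dots> = t n * (e / 2)" by (rule tot)
    finally have le: "\<bar>action (t n) (u n) \<omega> - t n * y^2\<bar> \<le> t n * (e / 2)" .
    have "action (t n) (u n) \<omega> / t n - y^2 = (action (t n) (u n) \<omega> - t n * y^2) / t n"
      using t(1)[of n] by (simp add: diff_divide_distrib)
    then have "\<bar>action (t n) (u n) \<omega> / t n - y^2\<bar> = \<bar>action (t n) (u n) \<omega> - t n * y^2\<bar> / t n"
      using t(1)[of n] by (simp add: abs_div)
    also have "\<dots> \<le> t n * (e / 2) / t n" using le t(1)[of n] by (intro divide_right_mono) auto
    also have "\<dots> < e" using t(1)[of n] e by simp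
    finally show ?case .
  qed
  then show "\<exists>no. \<forall>n\<ge>no. norm (action (t n) (u n) \<omega> / t n - y^2) < e"
    by (simp add: eventually_sequentially)
qed

text \<open>
  The amount of damping per unit of time; for short times it approximates the potential \<open>x\<^sup>2\<close>.
\<close>

definition rate :: "real \<Rightarrow> real \<Rightarrow> 'a \<Rightarrow> real" where
  "rate t x \<omega> = (1 - exp (- action t x \<omega>)) / t"

lemma rate_bounds:
  assumes "0 < t"
  shows "0 \<le> rate t x \<omega>" "rate t x \<omega> \<le> 1 / t" "rate t x \<omega> \<le> action t x \<omega> / t"
  using assms action_nonneg[of t x \<omega>] one_minus_exp_bounds(1)[OF action_nonneg, of t x \<omega>]
  by (auto simp: rate_def divide_simps)

lemma rate_measurable [measurable]: "(\<lambda>p. rate t (fst p) (snd p)) \<in> borel_measurable (borel \<Otimes>\<^sub>M M)"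
  unfolding rate_def by measurable

lemma rate_short_time:
  assumes \<omega>: "\<omega> \<in> space M" "X 0 \<omega> = 0" and t: "\<And>n. 0 < t n" "t \<longlonglongrightarrow> 0" and u: "u \<longlonglongrightarrow> y"
  shows "(\<lambda>n. rate (t n) (u n) \<omega>) \<longlonglongrightarrow> y^2"
proof -
  note P = action_short_time[OF assms]
  have "(\<lambda>n. action (t n) (u n) \<omega> / t n * t n) \<longlonglongrightarrow> y^2 * 0" by (intro tendsto_mult P t)
  moreover have "action (t n) (u n) \<omega> / t n * t n = action (t n) (u n) \<omega>" for n using t(1)[of n] by simp
  ultimately have P0: "(\<lambda>n. action (t n) (u n) \<omega>) \<longlonglongrightarrow> 0" by simp
  show ?thesis
  proof (rule tendsto_sandwich[OF _ _ _ P])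
    have "(\<lambda>n. (action (t n) (u n) \<omega> / t n) / (1 + action (t n) (u n) \<omega>)) \<longlonglongrightarrow> y^2 / (1 + 0)"
      by (intro tendsto_intros P P0) simp
    then show "(\<lambda>n. (action (t n) (u n) \<omega> / t n) / (1 + action (t n) (u n) \<omega>)) \<longlonglongrightarrow> y^2" by simp
    show "\<forall>\<^sub>F n in sequentially. action (t n) (u n) \<omega> / t n / (1 + action (t n) (u n) \<omega>) \<le> rate (t n) (u n) \<omega>"
    proof (intro always_eventually allI)
      fix n
      have "action (t n) (u n) \<omega> / (1 + action (t n) (u n) \<omega>) / t n \<le> rate (t n) (u n) \<omega>"
        unfolding rate_def using t(1)[of n]
        by (intro divide_right_mono one_minus_exp_bounds(2) action_nonneg) auto
      then show "action (t n) (u n) \<omega> / t n / (1 + action (t n) (u n) \<omega>) \<le> rate (t n) (u n) \<omega>"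
        by (simp add: mult.commute)
    qed
    show "\<forall>\<^sub>F n in sequentially. rate (t n) (u n) \<omega> \<le> action (t n) (u n) \<omega> / t n"
      by (intro always_eventually allI rate_bounds(3) t)
  qed
qed

text \<open>
  Because \<open>(x + z)\<^sup>2 \<le> 2 x\<^sup>2 + 2 + 2 z\<^sup>2\<close>, where the last term may be dropped if \<open>\<bar>z\<bar> \<le> 1\<close>.
\<close>

lemma rate_excess:
  assumes t: "0 < t" and \<omega>: "\<omega> \<in> space M"
  shows "ennreal (rate t x \<omega> - min (rate t x \<omega>) (2 * x^2 + 2)) \<le> excess t \<omega>"
proof (cases "rate t x \<omega> \<le> 2 * x^2 + 2")
  case True
  then show ?thesis by simp
next
  case False
  have [measurable]: "(\<lambda>s. X (max 0 s) \<omega>) \<in> borel_measurable borel" by (rule path_measurable[OF \<omega>])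
  have [measurable]: "{z::real. 1 < \<bar>z\<bar>} \<in> sets borel" by measurable
  define b where "b = (\<lambda>z. z^2 * indicator {z. 1 < \<bar>z\<bar>} z :: real)"
  have [measurable]: "b \<in> borel_measurable borel" unfolding b_def by measurable
  have b0: "0 \<le> b z" for z by (simp add: b_def)
  define B where "B = (\<integral>\<^sup>+s. ennreal (indicator {0..t} s * b (X (max 0 s) \<omega>)) \<partial>lborel)"
  have sq: "(x + z)^2 \<le> (2 * x^2 + 2) + 2 * b z" for z
  proof -
    have "(x + z)^2 \<le> 2 * x^2 + 2 * z^2" using sum_squares_bound[of x z] by (simp add: power2_sum)
    also have "z^2 \<le> 1 + b z"
      by (auto simp: b_def indicator_def not_less abs_square_le_1)
    finally show ?thesis by simp
  qed
  have "ennreal (action t x \<omega>) \<le> (\<integral>\<^sup>+s. ennreal (indicator {0..t} s * (x + X (max 0 s) \<omega>)^2) \<partial>lborel)" by (rule action_le)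
  also have "\<dots> \<le> (\<integral>\<^sup>+s. ennreal (2 * x^2 + 2) * indicator {0..t} s + ennreal 2 * ennreal (indicator {0..t} s * b (X (max 0 s) \<omega>)) \<partial>lborel)"
  proof (intro nn_integral_mono)
    fix s :: real
    show "ennreal (indicator {0..t} s * (x + X (max 0 s) \<omega>)^2) \<le> ennreal (2 * x^2 + 2) * indicator {0..t} s + ennreal 2 * ennreal (indicator {0..t} s * b (X (max 0 s) \<omega>))"
    proof (cases "s \<in> {0..t}")
      case True
      have "ennreal ((x + X (max 0 s) \<omega>)^2) \<le> ennreal ((2 * x^2 + 2) + 2 * b (X (max 0 s) \<omega>))"
        by (intro ennreal_leI sq)
      also have "\<dots> = ennreal (2 * x^2 + 2) + ennreal 2 * ennreal (b (X (max 0 s) \<omega>))"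
        using b0[of "X (max 0 s) \<omega>"] by (subst ennreal_plus) (simp_all add: ennreal_mult)
      finally show ?thesis using True by simp
    qed simp
  qed
  also have "\<dots> = ennreal (2 * x^2 + 2) * ennreal t + ennreal 2 * B"
    unfolding B_def using t
    by (subst nn_integral_add) (auto simp: nn_integral_cmult nn_integral_cmult_indicator)
  finally have le: "ennreal (action t x \<omega>) \<le> ennreal (2 * x^2 + 2) * ennreal t + ennreal 2 * B" .
  have "ennreal (rate t x \<omega> - (2 * x^2 + 2)) \<le> ennreal (2 / t) * B"
  proof (cases B)
    case (real r)
    have "ennreal (action t x \<omega>) \<le> ennreal ((2 * x^2 + 2) * t + 2 * r)"
    proof -
      have "ennreal ((2 * x^2 + 2) * t + 2 * r) = ennreal ((2 * x^2 + 2) * t) + ennreal (2 * r)"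
        using real t by (intro ennreal_plus) auto
      also have "\<dots> = ennreal (2 * x^2 + 2) * ennreal t + ennreal 2 * B"
        using real t by (simp add: ennreal_mult)
      finally show ?thesis using le by simp
    qed
    moreover have "0 \<le> (2 * x^2 + 2) * t + 2 * r" using real t by simp
    ultimately have "action t x \<omega> \<le> (2 * x^2 + 2) * t + 2 * r"
      by (simp only: ennreal_le_iff)
    then have "action t x \<omega> / t \<le> ((2 * x^2 + 2) * t + 2 * r) / t" using t by (intro divide_right_mono) auto
    also have "\<dots> = (2 * x^2 + 2) + 2 / t * r" using t by (simp add: add_divide_distrib)
    finally have "rate t x \<omega> - (2 * x^2 + 2) \<le> 2 / t * r" using rate_bounds(3)[OF t, of x \<omega>] by simp
    then show ?thesis using real t by (simp flip: ennreal_mult add: ennreal_leI)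
  next
    case top
    then show ?thesis using t by (simp add: ennreal_mult_top)
  qed
  moreover have "ennreal (rate t x \<omega> - (2 * x^2 + 2)) \<le> ennreal (1 / t)"
  proof (rule ennreal_leI)
    have "0 \<le> 2 * x^2 + 2" by simp
    then show "rate t x \<omega> - (2 * x^2 + 2) \<le> 1 / t" using rate_bounds(2)[OF t, of x \<omega>] by linarith
  qed
  ultimately show ?thesis using False by (simp add: excess_def B_def b_def)
qed

end

section \<open>The eigenvalue equation for the Cauchy transform\<close>

lemma cmod_resolvent_kernel_i: "cmod (1 / (complex_of_real u - \<i>)) = 1 / sqrt (1 + u^2)"
proof -
  have "cmod (complex_of_real u - \<i>) = sqrt (1 + u^2)" by (simp add: cmod_def add.commute)
  then show ?thesis by (simp only: norm_divide norm_one)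
qed

text \<open>
  Cubic decay is what makes \<open>u\<^sup>2\<close> times the kernel square-integrable, so that it can be paired with \<open>\<phi>\<close>.
\<close>

lemma cubic_kernel_decay:
  assumes w: "0 < Im w"
  obtains K where "0 \<le> K"
    and "\<And>u. cmod (1 / (complex_of_real u - w) ^ 3) \<le> K * (1 / (1 + u^2))"
    and "\<And>u. cmod (1 / (complex_of_real u - w) ^ 3) * (2 * u^2 + 2) \<le> K * cmod (1 / (complex_of_real u - \<i>))"
proof -
  define C where "C = 2 + (1 + 2 * (cmod w)^2) / (Im w)^2"
  have C0: "0 < C" unfolding C_def by (simp add: add_pos_nonneg)
  define K where "K = C / Im w + 2 * C * sqrt C"
  show thesis
  proof (rule that)
    show "0 \<le> K" using C0 w by (simp add: K_def)
    fix u
    define v where "v = cmod (complex_of_real u - w)"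
    have v: "Im w \<le> v" "0 < v" using Im_le_cmod_of_real_minus[of w u] w by (auto simp: v_def)
    have p: "0 < 1 + u^2" by (simp add: add_pos_nonneg)
    have uv: "1 + u^2 \<le> C * v^2" unfolding C_def v_def by (rule one_plus_square_le[OF w])
    have hn: "cmod (1 / (complex_of_real u - w) ^ 3) = 1 / v ^ 3" by (simp add: v_def norm_divide norm_power)
    have "Im w * (1 + u^2) \<le> v * (C * v^2)" using v w p uv by (intro mult_mono) auto
    then have "1 / v ^ 3 \<le> C / Im w * (1 / (1 + u^2))"
      using v w p by (simp add: divide_simps) (simp add: power2_eq_square power3_eq_cube mult_ac)
    also have "\<dots> \<le> K * (1 / (1 + u^2))" unfolding K_def using C0 p by (intro mult_right_mono) auto
    finally show "cmod (1 / (complex_of_real u - w) ^ 3) \<le> K * (1 / (1 + u^2))" by (simp only: hn)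
    have sp: "0 < sqrt (1 + u^2)" using p by simp
    have "sqrt (1 + u^2) \<le> sqrt (C * v^2)" using uv by (rule real_sqrt_le_mono)
    also have "\<dots> = sqrt C * v" using v by (simp add: real_sqrt_mult)
    finally have inv: "1 / v \<le> sqrt C * (1 / sqrt (1 + u^2))" using sp v by (simp add: field_simps)
    have "1 / v ^ 3 * (2 * (1 + u^2)) \<le> 1 / v ^ 3 * (2 * (C * v^2))"
      using v uv by (intro mult_left_mono) auto
    also have "\<dots> = 2 * C * (1 / v)" using v by (simp add: power2_eq_square power3_eq_cube)
    also have "\<dots> \<le> 2 * C * (sqrt C * (1 / sqrt (1 + u^2)))" using inv C0 by (intro mult_left_mono) auto
    also have "\<dots> = (2 * C * sqrt C) * (1 / sqrt (1 + u^2))" by simp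
    also have "\<dots> \<le> K * (1 / sqrt (1 + u^2))" unfolding K_def using C0 w sp by (intro mult_right_mono) auto
    finally show "cmod (1 / (complex_of_real u - w) ^ 3) * (2 * u^2 + 2) \<le> K * cmod (1 / (complex_of_real u - \<i>))"
      by (simp add: hn cmod_resolvent_kernel_i algebra_simps)
  qed
qed

context cauchy_process
begin

lemma Fubini_resolvent:
  assumes h: "h \<in> L2" and \<phi>: "\<phi> \<in> L2" and t: "0 < t"
  shows "(LINT \<omega>|M. LINT y|lborel. h (y - X t \<omega>) * \<phi> y) = (LINT y|lborel. (LINT \<omega>|M. h (y - X t \<omega>)) * \<phi> y)"
proof -
  interpret P: pair_sigma_finite lborel M ..
  have [measurable]: "X t \<in> borel_measurable M" using t by (intro measurable_X) simp
  have [measurable]: "h \<in> borel_measurable borel" "\<phi> \<in> borel_measurable borel" using h \<phi> by (auto intro: L2_measurable)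
  define k where "k = (\<lambda>y \<omega>. h (y - X t \<omega>) * \<phi> y)"
  have km[measurable]: "case_prod k \<in> borel_measurable (lborel \<Otimes>\<^sub>M M)"
    unfolding k_def case_prod_beta by measurable
  have "(\<integral>\<^sup>+p. ennreal (norm (case_prod k p)) \<partial>(lborel \<Otimes>\<^sub>M M))
      = (\<integral>\<^sup>+\<omega>. (\<integral>\<^sup>+y. ennreal (norm (k y \<omega>)) \<partial>lborel) \<partial>M)"
    by (subst P.nn_integral_snd[symmetric]) (simp_all add: case_prod_beta)
  also have "\<dots> \<le> (\<integral>\<^sup>+\<omega>. ennreal (sqrt (l2sq h) * sqrt (l2sq \<phi>)) \<partial>M)"
  proof (intro nn_integral_mono)
    fix \<omega>
    show "(\<integral>\<^sup>+y. ennreal (norm (k y \<omega>)) \<partial>lborel) \<le> ennreal (sqrt (l2sq h) * sqrt (l2sq \<phi>))"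
      using L2_Cauchy_Schwarz(3)[OF L2_translate(1)[OF h, of "- X t \<omega>"] \<phi>] unfolding L2_translate(2)[OF h]
      by (simp add: k_def norm_mult)
  qed
  also have "\<dots> < \<infinity>" by (simp add: emeasure_space_1)
  finally have "integrable (lborel \<Otimes>\<^sub>M M) (case_prod k)"
    by (intro integrableI_bounded km) auto
  from P.Fubini_integral[OF this] show ?thesis by (simp add: k_def)
qed

text \<open>
  The pairing of \<open>h\<close> with \<open>c x * \<phi> (x + X t)\<close>, written in the end point \<open>y = x + X t\<close> of the path.
\<close>

definition shifted_pairing ::
    "(real \<Rightarrow> complex) \<Rightarrow> (real \<Rightarrow> complex) \<Rightarrow> real \<Rightarrow> (real \<Rightarrow> 'a \<Rightarrow> real) \<Rightarrow> 'a \<Rightarrow> complex" where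
  "shifted_pairing h \<phi> t c \<omega> = (LINT y|lborel. h (y - X t \<omega>) * (of_real (c (y - X t \<omega>) \<omega>) * \<phi> y))"

lemma shifted_product_integrable:
  assumes h: "h \<in> L2" and \<phi>: "\<phi> \<in> L2" and \<omega>: "\<omega> \<in> space M"
    and c: "(\<lambda>p. c (fst p) (snd p)) \<in> borel_measurable (borel \<Otimes>\<^sub>M M)" and C: "\<And>u. \<bar>c u \<omega>\<bar> \<le> (C::real)"
  shows "integrable lborel (\<lambda>y. h (y - a) * (of_real (c (y - a) \<omega>) * \<phi> y))"
proof -
  have [measurable]: "h \<in> borel_measurable borel" "\<phi> \<in> borel_measurable borel" using h \<phi> by (auto intro: L2_measurable)
  have cs: "integrable lborel (\<lambda>y. h (y - a) * \<phi> y)"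
    using L2_Cauchy_Schwarz(1)[OF L2_translate(1)[OF h, of "- a"] \<phi>] by simp
  have "(\<lambda>u. (u, \<omega>)) \<in> borel \<rightarrow>\<^sub>M borel \<Otimes>\<^sub>M M" using \<omega> by measurable
  from measurable_compose[OF this c] have [measurable]: "(\<lambda>u. c u \<omega>) \<in> borel_measurable borel" by simp
  have C0: "0 \<le> C" using C[of 0] by linarith
  show ?thesis
  proof (rule Bochner_Integration.integrable_bound[OF integrable_mult_right[OF cs, of "of_real C"]])
    show "AE y in lborel. norm (h (y - a) * (of_real (c (y - a) \<omega>) * \<phi> y)) \<le> norm (of_real C * (h (y - a) * \<phi> y))"
    proof (rule AE_I2)
      fix y
      show "norm (h (y - a) * (of_real (c (y - a) \<omega>) * \<phi> y)) \<le> norm (of_real C * (h (y - a) * \<phi> y))"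
        using mult_right_mono[OF C[of "y - a"], of "cmod (h (y - a)) * cmod (\<phi> y)"] C0
        by (simp add: norm_mult mult_ac)
    qed
  qed measurable
qed

text \<open>
  The cap makes dominated convergence available, and it does not change the limit \<open>u\<^sup>2\<close> of the rate, which lies
  below it.
\<close>

definition truncated_rate :: "real \<Rightarrow> real \<Rightarrow> 'a \<Rightarrow> real" where
  "truncated_rate t u \<omega> = min (rate t u \<omega>) (2 * u^2 + 2)"

lemma truncated_rate_bounds:
  assumes "0 < t"
  shows "0 \<le> truncated_rate t u \<omega>" "truncated_rate t u \<omega> \<le> 1 / t" "truncated_rate t u \<omega> \<le> 2 * u^2 + 2"
    "truncated_rate t u \<omega> \<le> rate t u \<omega>"
    "\<bar>rate t u \<omega>\<bar> \<le> 1 / t" "\<bar>truncated_rate t u \<omega>\<bar> \<le> 1 / t" "\<bar>rate t u \<omega> - truncated_rate t u \<omega>\<bar> \<le> 1 / t"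
proof -
  have "0 \<le> 2 * u^2 + 2" by simp
  then have "0 \<le> truncated_rate t u \<omega>" "truncated_rate t u \<omega> \<le> rate t u \<omega>" "truncated_rate t u \<omega> \<le> 2 * u^2 + 2"
    using rate_bounds(1)[OF assms, of u \<omega>] by (auto simp: truncated_rate_def)
  then show "0 \<le> truncated_rate t u \<omega>" "truncated_rate t u \<omega> \<le> 1 / t" "truncated_rate t u \<omega> \<le> 2 * u^2 + 2"
    "truncated_rate t u \<omega> \<le> rate t u \<omega>"
    "\<bar>rate t u \<omega>\<bar> \<le> 1 / t" "\<bar>truncated_rate t u \<omega>\<bar> \<le> 1 / t" "\<bar>rate t u \<omega> - truncated_rate t u \<omega>\<bar> \<le> 1 / t"
    using rate_bounds[OF assms, of u \<omega>] by linarith+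
qed

lemma truncated_rate_measurable [measurable]:
  "(\<lambda>p. truncated_rate t (fst p) (snd p)) \<in> borel_measurable (borel \<Otimes>\<^sub>M M)"
  unfolding truncated_rate_def by measurable

text \<open>
  Dominated convergence is used twice, first in \<open>y\<close> for a fixed path and then over the paths. In the first
  step the majorant may depend on the path, through a bound for the null sequence \<open>X (t n)\<close>; in the second
  step Cauchy--Schwarz gives a constant majorant, because translations preserve the \<open>L\<^sup>2\<close> norm.
\<close>

lemma truncated_potential_term_limit:
  assumes \<phi>: "\<phi> \<in> L2" and w: "0 < Im w"
    and t: "\<And>n. 0 < t n" "t \<longlonglongrightarrow> 0"
  defines "h \<equiv> \<lambda>y. 1 / (complex_of_real y - w) ^ 3"
  shows "(\<lambda>n. LINT \<omega>|M. shifted_pairing h \<phi> (t n) (truncated_rate (t n)) \<omega>)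
       \<longlonglongrightarrow> (LINT y|lborel. h y * (of_real (y^2) * \<phi> y))"
proof -
  have [measurable]: "\<phi> \<in> borel_measurable borel" using \<phi> by (rule L2_measurable)
  have h3: "h = (\<lambda>y. 1 / (complex_of_real y - w) ^ Suc 2)" by (simp add: h_def numeral_3_eq_3)
  have hL: "h \<in> L2" unfolding h3 using w by (intro cauchy_kernel_L2(1)) simp
  have hm[measurable]: "h \<in> borel_measurable borel" using hL by (rule L2_measurable)
  define m where "m = (\<lambda>u. 1 / (complex_of_real u - \<i>) ^ Suc 0)"
  have mL: "m \<in> L2" unfolding m_def by (rule cauchy_kernel_L2(1)) simp
  obtain K where K: "0 \<le> K" "\<And>u. cmod (h u) * (2 * u^2 + 2) \<le> K * cmod (m u)"
    using cubic_kernel_decay[OF w] unfolding h_def m_def power_Suc0_right by metis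
  define g where "g = (\<lambda>n \<omega> y. h (y - X (t n) \<omega>) * (of_real (truncated_rate (t n) (y - X (t n) \<omega>) \<omega>) * \<phi> y))"
  have gb: "cmod (g n \<omega> y) \<le> K * (cmod (m (y - X (t n) \<omega>)) * cmod (\<phi> y))" for n \<omega> y
  proof -
    define u where "u = y - X (t n) \<omega>"
    have "cmod (h u) * \<bar>truncated_rate (t n) u \<omega>\<bar> \<le> cmod (h u) * (2 * u^2 + 2)"
      using truncated_rate_bounds[OF t(1)] by (intro mult_left_mono) auto
    also note K(2)
    finally have "cmod (h u) * \<bar>truncated_rate (t n) u \<omega>\<bar> * cmod (\<phi> y) \<le> K * cmod (m u) * cmod (\<phi> y)"
      by (rule mult_right_mono) simp
    then show ?thesis unfolding g_def u_def by (simp only: norm_mult norm_of_real mult.assoc)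
  qed
  have gi: "integrable lborel (g n \<omega>)" if "\<omega> \<in> space M" for n \<omega>
    unfolding g_def
    by (rule shifted_product_integrable[OF hL \<phi> that truncated_rate_measurable truncated_rate_bounds(6)[OF t(1)]])
  define L where "L = (LINT y|lborel. h y * (of_real (y^2) * \<phi> y))"
  have "(\<lambda>n. LINT \<omega>|M. shifted_pairing h \<phi> (t n) (truncated_rate (t n)) \<omega>) \<longlonglongrightarrow> (LINT \<omega>|M. L)"
  proof (rule integral_dominated_convergence[where w="\<lambda>_. K * (sqrt (l2sq m) * sqrt (l2sq \<phi>))"])
    show "shifted_pairing h \<phi> (t n) (truncated_rate (t n)) \<in> borel_measurable M" for n
      using Fubini_shift(2)[OF hL \<phi> t(1) truncated_rate_measurable truncated_rate_bounds(6)[OF t(1)]]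
      unfolding shifted_pairing_def[abs_def] by (rule borel_measurable_integrable)
    show "AE \<omega> in M. norm (shifted_pairing h \<phi> (t n) (truncated_rate (t n)) \<omega>) \<le> K * (sqrt (l2sq m) * sqrt (l2sq \<phi>))" for n
    proof (rule AE_I2)
      fix \<omega> assume \<omega>: "\<omega> \<in> space M"
      have mT: "(\<lambda>y. m (y - X (t n) \<omega>)) \<in> L2" "l2sq (\<lambda>y. m (y - X (t n) \<omega>)) = l2sq m"
        using L2_translate[OF mL, of "- X (t n) \<omega>"] by simp_all
      have "norm (shifted_pairing h \<phi> (t n) (truncated_rate (t n)) \<omega>) \<le> (LINT y|lborel. norm (g n \<omega> y))"
        unfolding shifted_pairing_def g_def by (rule integral_norm_bound)
      also have "\<dots> \<le> (LINT y|lborel. K * (cmod (m (y - X (t n) \<omega>)) * cmod (\<phi> y)))"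
        using integrable_norm[OF L2_Cauchy_Schwarz(1)[OF mT(1) \<phi>]]
        by (intro integral_mono gb integrable_norm gi \<omega> integrable_mult_right) (simp add: norm_mult)
      also have "\<dots> = K * (LINT y|lborel. cmod (m (y - X (t n) \<omega>)) * cmod (\<phi> y))"
        by (rule integral_mult_right_zero)
      also have "\<dots> \<le> K * (sqrt (l2sq m) * sqrt (l2sq \<phi>))"
        using L2_Cauchy_Schwarz(2)[OF mT(1) \<phi>] unfolding mT(2) by (rule mult_left_mono[OF _ K(1)])
      finally show "norm (shifted_pairing h \<phi> (t n) (truncated_rate (t n)) \<omega>) \<le> K * (sqrt (l2sq m) * sqrt (l2sq \<phi>))" .
    qed
    show "AE \<omega> in M. (\<lambda>n. shifted_pairing h \<phi> (t n) (truncated_rate (t n)) \<omega>) \<longlonglongrightarrow> L"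
      using start AE_space
    proof eventually_elim
      fix \<omega> assume X0: "X 0 \<omega> = 0" and \<omega>: "\<omega> \<in> space M"
      have tr: "filterlim t (at_right 0) sequentially"
        using t less_imp_neq[OF t(1), THEN not_sym] by (auto simp: filterlim_at intro!: always_eventually)
      have Xt: "(\<lambda>n. X (t n) \<omega>) \<longlonglongrightarrow> 0"
        using filterlim_compose[OF right_continuous[OF \<omega>, of 0] tr] X0 by simp
      then have "Bseq (\<lambda>n. X (t n) \<omega>)" by (rule convergent_imp_Bseq[OF convergentI])
      then obtain b where b: "0 < b" "\<And>n. \<bar>X (t n) \<omega>\<bar> \<le> b" by (auto elim!: BseqE)
      define Q where "Q = sqrt (2 + 2 * b^2)"
      have dom: "cmod (m (y - X (t n) \<omega>)) \<le> Q * cmod (m y)" for y n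
      proof -
        define u where "u = y - X (t n) \<omega>"
        have "\<bar>y\<bar> \<le> \<bar>u\<bar> + b" using b(2)[of n] unfolding u_def by linarith
        then have "y^2 \<le> (\<bar>u\<bar> + b)^2" by (metis abs_ge_zero power2_abs power_mono)
        also have "\<dots> \<le> 2 * u^2 + 2 * b^2" using sum_squares_bound[of "\<bar>u\<bar>" b] by (simp add: power2_sum)
        finally have "y^2 \<le> 2 * u^2 + 2 * b^2" .
        moreover have "0 \<le> b^2 * u^2" by simp
        moreover have "(2 + 2 * b^2) * (1 + u^2) = 2 + 2 * u^2 + 2 * b^2 + 2 * (b^2 * u^2)"
          by (simp add: algebra_simps)
        ultimately have "1 + y^2 \<le> (2 + 2 * b^2) * (1 + u^2)" by linarith
        then have "sqrt (1 + y^2) \<le> Q * sqrt (1 + u^2)"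
          unfolding Q_def real_sqrt_mult[symmetric] by (rule real_sqrt_le_mono)
        moreover have "0 < sqrt (1 + y^2)" "0 < sqrt (1 + u^2)" by (auto simp: add_pos_nonneg)
        ultimately have "1 / sqrt (1 + u^2) \<le> Q * (1 / sqrt (1 + y^2))" by (simp add: field_simps)
        then show ?thesis by (simp only: m_def u_def power_Suc0_right cmod_resolvent_kernel_i)
      qed
      show "(\<lambda>n. shifted_pairing h \<phi> (t n) (truncated_rate (t n)) \<omega>) \<longlonglongrightarrow> L"
        unfolding shifted_pairing_def L_def g_def[symmetric]
      proof (rule integral_dominated_convergence[where w="\<lambda>y. K * Q * cmod (m y * \<phi> y)"])
        show "integrable lborel (\<lambda>y. K * Q * cmod (m y * \<phi> y))"
          by (intro integrable_mult_right integrable_norm L2_Cauchy_Schwarz(1) mL \<phi>)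
        show "(\<lambda>y. h (y - X (t n) \<omega>) * (of_real (truncated_rate (t n) (y - X (t n) \<omega>) \<omega>) * \<phi> y)) \<in> borel_measurable lborel" for n
          using gi[OF \<omega>, of n] unfolding g_def by (rule borel_measurable_integrable)
        show "AE y in lborel. (\<lambda>n. h (y - X (t n) \<omega>) * (of_real (truncated_rate (t n) (y - X (t n) \<omega>) \<omega>) * \<phi> y)) \<longlonglongrightarrow> h y * (of_real (y^2) * \<phi> y)"
        proof (rule AE_I2)
          fix y
          have u: "(\<lambda>n. y - X (t n) \<omega>) \<longlonglongrightarrow> y" using tendsto_diff[OF tendsto_const Xt, of y] by simp
          have "(\<lambda>n. truncated_rate (t n) (y - X (t n) \<omega>) \<omega>) \<longlonglongrightarrow> min (y^2) (2 * y^2 + 2)"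
            unfolding truncated_rate_def by (intro tendsto_min rate_short_time[OF \<omega> X0 t u] tendsto_intros u)
          then have r: "(\<lambda>n. truncated_rate (t n) (y - X (t n) \<omega>) \<omega>) \<longlonglongrightarrow> y^2" by simp
          have nz: "complex_of_real y - w \<noteq> 0" using w by (auto simp: complex_eq_iff)
          have "(\<lambda>n. h (y - X (t n) \<omega>)) \<longlonglongrightarrow> h y"
            unfolding h_def by (intro tendsto_intros u) (use nz in simp)
          then show "(\<lambda>n. h (y - X (t n) \<omega>) * (of_real (truncated_rate (t n) (y - X (t n) \<omega>) \<omega>) * \<phi> y)) \<longlonglongrightarrow> h y * (of_real (y^2) * \<phi> y)"
            by (intro tendsto_mult tendsto_of_real r tendsto_const)
        qed
        show "AE y in lborel. norm (h (y - X (t n) \<omega>) * (of_real (truncated_rate (t n) (y - X (t n) \<omega>) \<omega>) * \<phi> y)) \<le> K * Q * cmod (m y * \<phi> y)" for n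
        proof (rule AE_I2)
          fix y
          have "K * (cmod (m (y - X (t n) \<omega>)) * cmod (\<phi> y)) \<le> K * (Q * cmod (m y) * cmod (\<phi> y))"
            by (intro mult_left_mono mult_right_mono dom K) auto
          with gb[of n \<omega> y] have "cmod (g n \<omega> y) \<le> K * (Q * cmod (m y) * cmod (\<phi> y))" by (rule order_trans)
          then show "norm (h (y - X (t n) \<omega>) * (of_real (truncated_rate (t n) (y - X (t n) \<omega>) \<omega>) * \<phi> y)) \<le> K * Q * cmod (m y * \<phi> y)"
            by (simp only: g_def norm_mult mult.assoc)
        qed
      qed (simp add: h_def)
    qed
  qed simp_all
  then show ?thesis by (simp add: L_def prob_space)
qed

text \<open>
  The part cut off by the truncation is at most the excess, whose expectation against the decaying kernel has
  \<open>L\<^sup>2\<close> norm of order \<open>\<surd>t\<close>.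
\<close>

lemma potential_term_remainder:
  assumes \<phi>: "\<phi> \<in> L2" and h: "h \<in> L2" and hK: "\<And>u. cmod (h u) \<le> K * (1 / (1 + u^2))" and K: "0 \<le> K"
    and t: "0 < t" "t \<le> 1"
  shows "cmod (LINT \<omega>|M. shifted_pairing h \<phi> t (\<lambda>u \<omega>. rate t u \<omega> - truncated_rate t u \<omega>) \<omega>)
      \<le> K * (sqrt (l2sq \<phi>) * sqrt (16 * pi * t))"
proof -
  interpret P: pair_sigma_finite lborel M ..
  have [measurable]: "X t \<in> borel_measurable M" using t by (intro measurable_X) simp
  have [measurable]: "\<phi> \<in> borel_measurable borel" using \<phi> by (rule L2_measurable)
  define d where "d = (\<lambda>u \<omega>. rate t u \<omega> - truncated_rate t u \<omega>)"
  have dm: "(\<lambda>p. d (fst p) (snd p)) \<in> borel_measurable (borel \<Otimes>\<^sub>M M)" unfolding d_def by measurable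
  have db: "\<bar>d u \<omega>\<bar> \<le> 1 / t" "0 \<le> d u \<omega>" for u \<omega>
    using truncated_rate_bounds[OF t(1), of u \<omega>] by (auto simp: d_def)
  define j where "j = (\<lambda>u. 1 / (1 + u^2) :: real)"
  have [measurable]: "j \<in> borel_measurable borel" unfolding j_def by measurable
  have j0: "0 \<le> j u" for u by (simp add: j_def)
  define G where "G = (\<lambda>y. complex_of_real (4 * t / (1 + t^2 * y^2)))"
  have Gn: "cmod (G y) = 4 * t / (1 + t^2 * y^2)" for y
  proof -
    have "0 < 1 + t^2 * y^2" by (simp add: add_pos_nonneg)
    then show ?thesis unfolding G_def norm_of_real using t by simp
  qed
  have Gm[measurable]: "G \<in> borel_measurable borel" unfolding G_def by measurable
  have "ennreal (cmod (LINT \<omega>|M. shifted_pairing h \<phi> t d \<omega>)) \<le> (\<integral>\<^sup>+\<omega>. ennreal (cmod (shifted_pairing h \<phi> t d \<omega>)) \<partial>M)"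
    by (rule integral_norm_bound_ennreal)
       (use Fubini_shift(2)[OF h \<phi> t(1) dm db(1)] in \<open>simp add: shifted_pairing_def[abs_def]\<close>)
  also have "\<dots> \<le> (\<integral>\<^sup>+\<omega>. (\<integral>\<^sup>+y. ennreal (K * cmod (\<phi> y)) * (ennreal (j (y - X t \<omega>)) * excess t \<omega>) \<partial>lborel) \<partial>M)"
  proof (intro nn_integral_mono)
    fix \<omega> assume \<omega>: "\<omega> \<in> space M"
    have "ennreal (cmod (shifted_pairing h \<phi> t d \<omega>))
       \<le> (\<integral>\<^sup>+y. ennreal (cmod (h (y - X t \<omega>) * (of_real (d (y - X t \<omega>) \<omega>) * \<phi> y))) \<partial>lborel)"
      unfolding shifted_pairing_def by (rule integral_norm_bound_ennreal[OF shifted_product_integrable[OF h \<phi> \<omega> dm db(1)]])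
    also have "\<dots> \<le> (\<integral>\<^sup>+y. ennreal (K * cmod (\<phi> y)) * (ennreal (j (y - X t \<omega>)) * excess t \<omega>) \<partial>lborel)"
    proof (intro nn_integral_mono)
      fix y
      define u where "u = y - X t \<omega>"
      have "cmod (h u) * (d u \<omega> * cmod (\<phi> y)) \<le> (K * j u) * (d u \<omega> * cmod (\<phi> y))"
        using hK[of u] db by (intro mult_right_mono) (auto simp: j_def)
      then have "cmod (h u * (of_real (d u \<omega>) * \<phi> y)) \<le> (K * cmod (\<phi> y)) * (j u * d u \<omega>)"
        using db by (simp add: norm_mult mult_ac)
      then have "ennreal (cmod (h u * (of_real (d u \<omega>) * \<phi> y))) \<le> ennreal (K * cmod (\<phi> y)) * (ennreal (j u) * ennreal (d u \<omega>))"
        using K j0 db by (simp flip: ennreal_mult add: ennreal_leI)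
      also have "\<dots> \<le> ennreal (K * cmod (\<phi> y)) * (ennreal (j u) * excess t \<omega>)"
        using rate_excess[OF t(1) \<omega>, of u] by (intro mult_left_mono) (auto simp: d_def truncated_rate_def)
      finally show "ennreal (cmod (h (y - X t \<omega>) * (of_real (d (y - X t \<omega>) \<omega>) * \<phi> y)))
        \<le> ennreal (K * cmod (\<phi> y)) * (ennreal (j (y - X t \<omega>)) * excess t \<omega>)" by (simp add: u_def)
    qed
    finally show "ennreal (cmod (shifted_pairing h \<phi> t d \<omega>))
       \<le> (\<integral>\<^sup>+y. ennreal (K * cmod (\<phi> y)) * (ennreal (j (y - X t \<omega>)) * excess t \<omega>) \<partial>lborel)" .
  qed
  also have "\<dots> = (\<integral>\<^sup>+y. (\<integral>\<^sup>+\<omega>. ennreal (K * cmod (\<phi> y)) * (ennreal (j (y - X t \<omega>)) * excess t \<omega>) \<partial>M) \<partial>lborel)"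
    by (rule P.Fubini') measurable
  also have "\<dots> \<le> (\<integral>\<^sup>+y. ennreal K * ennreal (cmod (\<phi> y) * cmod (G y)) \<partial>lborel)"
  proof (intro nn_integral_mono)
    fix y
    have "(\<integral>\<^sup>+\<omega>. ennreal (K * cmod (\<phi> y)) * (ennreal (j (y - X t \<omega>)) * excess t \<omega>) \<partial>M)
       = ennreal (K * cmod (\<phi> y)) * (\<integral>\<^sup>+\<omega>. ennreal (j (y - X t \<omega>)) * excess t \<omega> \<partial>M)"
      by (rule nn_integral_cmult) measurable
    also have "\<dots> \<le> ennreal (K * cmod (\<phi> y)) * ennreal (cmod (G y))"
      unfolding j_def Gn by (intro mult_left_mono expectation_excess t) auto
    also have "\<dots> = ennreal K * ennreal (cmod (\<phi> y) * cmod (G y))"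
      using K by (simp flip: ennreal_mult add: mult.assoc)
    finally show "(\<integral>\<^sup>+\<omega>. ennreal (K * cmod (\<phi> y)) * (ennreal (j (y - X t \<omega>)) * excess t \<omega>) \<partial>M)
      \<le> ennreal K * ennreal (cmod (\<phi> y) * cmod (G y))" .
  qed
  also have "\<dots> = ennreal K * (\<integral>\<^sup>+y. ennreal (cmod (\<phi> y) * cmod (G y)) \<partial>lborel)"
    by (rule nn_integral_cmult) measurable
  also have "\<dots> \<le> ennreal K * ennreal (sqrt (l2sq \<phi>) * sqrt (16 * pi * t))"
  proof (rule mult_left_mono)
    have N: "0 < 1 / t" using t by simp
    note pk = poisson_kernel_total[OF N, of 0]
    have Gi: "integrable lborel (\<lambda>y. 16 * (1 / ((y - 0)^2 + (1 / t)^2)))" by (rule integrable_mult_right[OF pk(1)])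
    have Gb: "(cmod (G y))^2 \<le> 16 * (1 / ((y - 0)^2 + (1 / t)^2))" for y
    proof -
      define q where "q = 1 + t^2 * y^2"
      have q: "1 \<le> q" by (simp add: q_def)
      have "(cmod (G y))^2 = 16 * t^2 / q / q"
        unfolding Gn q_def by (simp add: power_divide power_mult_distrib power2_eq_square)
      also have "\<dots> \<le> 16 * t^2 / q / 1" using q by (intro divide_left_mono) auto
      also have "\<dots> = 16 * (1 / ((y - 0)^2 + (1 / t)^2))"
      proof -
        have "y^2 + (1 / t)^2 = q / t^2" using t by (simp add: q_def field_simps)
        then show ?thesis by simp
      qed
      finally show ?thesis .
    qed
    have "l2sq G \<le> (LINT y|lborel. 16 * (1 / ((y - 0)^2 + (1 / t)^2)))" by (rule L2I(2)[OF Gm Gi Gb])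
    also have "\<dots> = 16 * (pi / (1 / t))" by (simp only: integral_mult_right_zero pk(2))
    finally have "l2sq G \<le> 16 * pi * t" by simp
    then have "sqrt (l2sq \<phi>) * sqrt (l2sq G) \<le> sqrt (l2sq \<phi>) * sqrt (16 * pi * t)"
      by (intro mult_left_mono real_sqrt_le_mono) auto
    then show "(\<integral>\<^sup>+y. ennreal (cmod (\<phi> y) * cmod (G y)) \<partial>lborel) \<le> ennreal (sqrt (l2sq \<phi>) * sqrt (16 * pi * t))"
      using L2_Cauchy_Schwarz(3)[OF \<phi> L2I(1)[OF Gm Gi Gb]] by (meson ennreal_leI order_trans)
  qed simp
  also have "\<dots> = ennreal (K * (sqrt (l2sq \<phi>) * sqrt (16 * pi * t)))"
    using K t by (simp add: ennreal_mult)
  finally have le: "ennreal (cmod (LINT \<omega>|M. shifted_pairing h \<phi> t d \<omega>)) \<le> ennreal (K * (sqrt (l2sq \<phi>) * sqrt (16 * pi * t)))" .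
  have "0 \<le> K * (sqrt (l2sq \<phi>) * sqrt (16 * pi * t))" using K t by simp
  with le show ?thesis unfolding d_def by (simp only: ennreal_le_iff)
qed

lemma potential_term_limit:
  assumes \<phi>: "\<phi> \<in> L2" and w: "0 < Im w"
    and t: "\<And>n. 0 < t n" "\<And>n. t n \<le> 1" "t \<longlonglongrightarrow> 0"
  defines "h \<equiv> \<lambda>y. 1 / (complex_of_real y - w) ^ 3"
  shows "(\<lambda>n. LINT \<omega>|M. shifted_pairing h \<phi> (t n) (rate (t n)) \<omega>)
       \<longlonglongrightarrow> (LINT y|lborel. h y * (of_real (y^2) * \<phi> y))"
proof -
  have h3: "h = (\<lambda>y. 1 / (complex_of_real y - w) ^ Suc 2)" by (simp add: h_def numeral_3_eq_3)
  have hL: "h \<in> L2" unfolding h3 using w by (intro cauchy_kernel_L2(1)) simp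
  obtain K where K: "0 \<le> K" "\<And>u. cmod (h u) \<le> K * (1 / (1 + u^2))"
    using cubic_kernel_decay[OF w] unfolding h_def by metis
  define d where "d = (\<lambda>n u \<omega>. rate (t n) u \<omega> - truncated_rate (t n) u \<omega>)"
  have dm: "(\<lambda>p. d n (fst p) (snd p)) \<in> borel_measurable (borel \<Otimes>\<^sub>M M)" for n unfolding d_def by measurable
  have db: "\<bar>d n u \<omega>\<bar> \<le> 1 / t n" for n u \<omega> unfolding d_def by (rule truncated_rate_bounds(7)[OF t(1)])
  define E where "E = (\<lambda>n. LINT \<omega>|M. shifted_pairing h \<phi> (t n) (d n) \<omega>)"
  have split: "(LINT \<omega>|M. shifted_pairing h \<phi> (t n) (rate (t n)) \<omega>)
     = (LINT \<omega>|M. shifted_pairing h \<phi> (t n) (truncated_rate (t n)) \<omega>) + E n" for n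
  proof -
    note m = truncated_rate_measurable[of "t n"] and b = truncated_rate_bounds(6)[OF t(1)[of n]]
    have "(LINT \<omega>|M. shifted_pairing h \<phi> (t n) (truncated_rate (t n)) \<omega>) + E n
       = (LINT \<omega>|M. shifted_pairing h \<phi> (t n) (truncated_rate (t n)) \<omega> + shifted_pairing h \<phi> (t n) (d n) \<omega>)"
      unfolding E_def shifted_pairing_def
      by (rule Bochner_Integration.integral_add[OF Fubini_shift(2)[OF hL \<phi> t(1) m b] Fubini_shift(2)[OF hL \<phi> t(1) dm db], symmetric])
    also have "\<dots> = (LINT \<omega>|M. shifted_pairing h \<phi> (t n) (rate (t n)) \<omega>)"
    proof (intro Bochner_Integration.integral_cong refl)
      fix \<omega> assume \<omega>: "\<omega> \<in> space M"
      show "shifted_pairing h \<phi> (t n) (truncated_rate (t n)) \<omega> + shifted_pairing h \<phi> (t n) (d n) \<omega> = shifted_pairing h \<phi> (t n) (rate (t n)) \<omega>"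
        unfolding shifted_pairing_def
        by (subst Bochner_Integration.integral_add[OF shifted_product_integrable[OF hL \<phi> \<omega> m b] shifted_product_integrable[OF hL \<phi> \<omega> dm db], symmetric])
           (auto intro!: Bochner_Integration.integral_cong simp: d_def algebra_simps)
    qed
    finally show ?thesis ..
  qed
  have "E \<longlonglongrightarrow> 0"
  proof (rule Lim_null_comparison[OF always_eventually])
    show "\<forall>n. norm (E n) \<le> K * (sqrt (l2sq \<phi>) * sqrt (16 * pi * t n))"
      unfolding E_def d_def using potential_term_remainder[OF \<phi> hL K(2,1) t(1,2)] by blast
    have "(\<lambda>n. K * (sqrt (l2sq \<phi>) * sqrt (16 * pi * t n))) \<longlonglongrightarrow> K * (sqrt (l2sq \<phi>) * sqrt (16 * pi * 0))"
      by (intro tendsto_intros t)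
    then show "(\<lambda>n. K * (sqrt (l2sq \<phi>) * sqrt (16 * pi * t n))) \<longlonglongrightarrow> 0" by simp
  qed
  moreover have "(\<lambda>n. LINT \<omega>|M. shifted_pairing h \<phi> (t n) (truncated_rate (t n)) \<omega>) \<longlonglongrightarrow> (LINT y|lborel. h y * (of_real (y^2) * \<phi> y))"
    unfolding h_def by (rule truncated_potential_term_limit[OF \<phi> w t(1,3)])
  ultimately show ?thesis using tendsto_add by (fastforce simp: split)
qed


text \<open>
  Since \<open>exp (- action) = 1 - t * rate\<close>, pairing with \<open>T\<^sub>t \<phi>\<close> splits into the free motion and a term of order
  \<open>t\<close> due to the potential.
\<close>

lemma resolvent_generator_pairing:
  assumes \<phi>: "\<phi> \<in> L2" and w: "0 < Im w" and t: "0 < t"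
  defines "h \<equiv> \<lambda>y. 1 / (complex_of_real y - w) ^ 3"
  shows "integrable lborel (\<lambda>x. h x * FK_semigroup M X t \<phi> x)"
    and "(LINT x|lborel. h x * FK_semigroup M X t \<phi> x) = cauchy_transform 3 \<phi> (w + \<i> * of_real t)
      - of_real t * (LINT \<omega>|M. shifted_pairing h \<phi> t (rate t) \<omega>)"
proof -
  have h3: "h = (\<lambda>y. 1 / (complex_of_real y - w) ^ Suc 2)" by (simp add: h_def numeral_3_eq_3)
  have hL: "h \<in> L2" unfolding h3 using w by (intro cauchy_kernel_L2(1)) simp
  define c1 c2 c3 :: "real \<Rightarrow> 'a \<Rightarrow> real" where "c1 = (\<lambda>u \<omega>. exp (- action t u \<omega>))" and "c2 = (\<lambda>u \<omega>. 1)" and "c3 = rate t"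
  have m: "(\<lambda>p. c1 (fst p) (snd p)) \<in> borel_measurable (borel \<Otimes>\<^sub>M M)"
    "(\<lambda>p. c2 (fst p) (snd p)) \<in> borel_measurable (borel \<Otimes>\<^sub>M M)"
    "(\<lambda>p. c3 (fst p) (snd p)) \<in> borel_measurable (borel \<Otimes>\<^sub>M M)"
    unfolding c1_def c2_def c3_def by measurable
  have b: "\<bar>c1 u \<omega>\<bar> \<le> 1" "\<bar>c2 u \<omega>\<bar> \<le> 1" "\<bar>c3 u \<omega>\<bar> \<le> 1 / t" for u \<omega>
    using action_nonneg[of t u \<omega>] rate_bounds[OF t, of u \<omega>] by (auto simp: c1_def c2_def c3_def)
  note F1 = Fubini_shift[OF hL \<phi> t m(1) b(1)] and F2 = Fubini_shift[OF hL \<phi> t m(2) b(2)]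
    and F3 = Fubini_shift[OF hL \<phi> t m(3) b(3)]
  have FK: "FK_semigroup M X t \<phi> x = (LINT \<omega>|M. of_real (c1 x \<omega>) * \<phi> (x + X t \<omega>))" for x
    by (simp add: FK_semigroup_eq c1_def)
  show "integrable lborel (\<lambda>x. h x * FK_semigroup M X t \<phi> x)"
    unfolding FK by (rule F1(1))
  define J where "J = shifted_pairing h \<phi> t"
  have Ji: "integrable M (J c1)" "integrable M (J c2)" "integrable M (J c3)"
    unfolding J_def shifted_pairing_def[abs_def] by (rule F1(2) F2(2) F3(2))+
  have J: "J c1 \<omega> = J c2 \<omega> - of_real t * J c3 \<omega>" if \<omega>: "\<omega> \<in> space M" for \<omega>
  proof -
    note I = shifted_product_integrable[OF hL \<phi> \<omega>, of _ _ "X t \<omega>"]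
    have "J c2 \<omega> - of_real t * J c3 \<omega>
      = (LINT y|lborel. h (y - X t \<omega>) * (of_real (c2 (y - X t \<omega>) \<omega>) * \<phi> y) - of_real t * (h (y - X t \<omega>) * (of_real (c3 (y - X t \<omega>) \<omega>) * \<phi> y)))"
      unfolding J_def shifted_pairing_def
      by (subst Bochner_Integration.integral_diff[OF I[OF m(2) b(2)] integrable_mult_right[OF I[OF m(3) b(3)]]])
         (simp only: integral_mult_right_zero)
    also have "\<dots> = J c1 \<omega>"
      unfolding J_def shifted_pairing_def
    proof (intro Bochner_Integration.integral_cong refl)
      fix y
      define u where "u = y - X t \<omega>"
      have "c1 u \<omega> = c2 u \<omega> - t * c3 u \<omega>" using t by (simp add: c1_def c2_def c3_def rate_def)
      then have e: "complex_of_real (c1 u \<omega>) = of_real (c2 u \<omega>) - of_real t * of_real (c3 u \<omega>)" by simp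
      show "h (y - X t \<omega>) * (of_real (c2 (y - X t \<omega>) \<omega>) * \<phi> y) - of_real t * (h (y - X t \<omega>) * (of_real (c3 (y - X t \<omega>) \<omega>) * \<phi> y))
         = h (y - X t \<omega>) * (of_real (c1 (y - X t \<omega>) \<omega>) * \<phi> y)"
        unfolding u_def[symmetric] e by (simp add: algebra_simps)
    qed
    finally show ?thesis ..
  qed
  have "(LINT x|lborel. h x * FK_semigroup M X t \<phi> x) = (LINT \<omega>|M. J c1 \<omega>)"
    unfolding FK J_def shifted_pairing_def by (rule F1(3))
  also have "\<dots> = (LINT \<omega>|M. J c2 \<omega> - of_real t * J c3 \<omega>)"
    by (intro Bochner_Integration.integral_cong refl J)
  also have "\<dots> = (LINT \<omega>|M. J c2 \<omega>) - of_real t * (LINT \<omega>|M. J c3 \<omega>)"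
    by (subst Bochner_Integration.integral_diff[OF Ji(2) integrable_mult_right[OF Ji(3)]])
       (simp only: integral_mult_right_zero)
  also have "(LINT \<omega>|M. J c2 \<omega>) = (LINT y|lborel. (LINT \<omega>|M. h (y - X t \<omega>)) * \<phi> y)"
    using Fubini_resolvent[OF hL \<phi> t] by (simp add: J_def shifted_pairing_def c2_def)
  also have "\<dots> = cauchy_transform 3 \<phi> (w + \<i> * of_real t)"
    unfolding cauchy_transform_def h_def expectation_resolvent_kernel[OF t w]
    by (simp only: mult.commute)
  finally show "(LINT x|lborel. h x * FK_semigroup M X t \<phi> x) = cauchy_transform 3 \<phi> (w + \<i> * of_real t)
      - of_real t * (LINT \<omega>|M. shifted_pairing h \<phi> t (rate t) \<omega>)"
    by (simp only: J_def c3_def)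
qed

lemma FK_semigroup_measurable:
  assumes \<phi>: "\<phi> \<in> L2" and t: "0 < t"
  shows "FK_semigroup M X t \<phi> \<in> borel_measurable borel"
proof -
  have [measurable]: "X t \<in> borel_measurable M" using t by (intro measurable_X) simp
  have [measurable]: "\<phi> \<in> borel_measurable borel" using \<phi> by (rule L2_measurable)
  have "(\<lambda>(x, \<omega>). complex_of_real (exp (- action t x \<omega>)) * \<phi> (x + X t \<omega>)) \<in> borel_measurable (borel \<Otimes>\<^sub>M M)"
    unfolding case_prod_beta by measurable
  from borel_measurable_lebesgue_integral[OF this]
  show ?thesis unfolding FK_semigroup_eq[abs_def] .
qed

text \<open>
  The eigenvalue equation tested with \<open>(y - w)\<^sup>-\<^sup>3\<close>. The free part is a difference quotient of the Cauchy
  transform in the direction \<open>\<i>\<close>, and the potential part is rewritten with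
  \<open>y\<^sup>2 = (y - w)\<^sup>2 + 2 w (y - w) + w\<^sup>2\<close>. The exponent 3 is the smallest for which the test function
  multiplied by \<open>y\<^sup>2\<close> lies in \<open>L\<^sup>2\<close>.
\<close>

lemma eigenfunction_weak_equation:
  assumes graph: "oscillator_graph M X \<phi> (\<lambda>x. of_real lam * \<phi> x)" and w: "0 < Im w"
  shows "- \<i> * (3 * cauchy_transform (Suc (Suc (Suc (Suc 0)))) \<phi> w)
      + (cauchy_transform (Suc 0) \<phi> w + 2 * w * cauchy_transform (Suc (Suc 0)) \<phi> w
         + w^2 * cauchy_transform (Suc (Suc (Suc 0))) \<phi> w)
      = of_real lam * cauchy_transform (Suc (Suc (Suc 0))) \<phi> w"
proof -
  have \<phi>: "\<phi> \<in> L2" using graph by (simp add: oscillator_graph_def)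
  have [measurable]: "\<phi> \<in> borel_measurable borel" using \<phi> by (rule L2_measurable)
  have wn: "Im w \<noteq> 0" using w by simp
  define h where "h = (\<lambda>y. 1 / (complex_of_real y - w) ^ 3)"
  have h3: "h = (\<lambda>y. 1 / (complex_of_real y - w) ^ Suc 2)" by (simp add: h_def numeral_3_eq_3)
  have hL: "h \<in> L2" unfolding h3 by (rule cauchy_kernel_L2(1)[OF wn])
  define t where "t = (\<lambda>n. 1 / real (Suc n))"
  have t: "0 < t n" "t n \<le> 1" for n by (auto simp: t_def)
  have t0: "t \<longlonglongrightarrow> 0" unfolding t_def by real_asymp
  define CT where "CT = cauchy_transform 3 \<phi>"
  define Pn where "Pn = (\<lambda>n. LINT \<omega>|M. shifted_pairing h \<phi> (t n) (rate (t n)) \<omega>)"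
  define g where "g = (\<lambda>n x. (\<phi> x - FK_semigroup M X (t n) \<phi> x) / of_real (t n) - of_real lam * \<phi> x)"
  have hphi: "integrable lborel (\<lambda>x. h x * \<phi> x)" by (rule L2_Cauchy_Schwarz(1)[OF hL \<phi>])
  have hphiCT: "(LINT x|lborel. h x * \<phi> x) = CT w"
    unfolding CT_def cauchy_transform_def h_def by (simp only: mult.commute)
  have pair: "(LINT x|lborel. h x * g n x) = - ((CT (w + \<i> * of_real (t n)) - CT w) / of_real (t n)) + Pn n - of_real lam * CT w" for n
  proof -
    have R: "integrable lborel (\<lambda>x. h x * FK_semigroup M X (t n) \<phi> x)"
      "(LINT x|lborel. h x * FK_semigroup M X (t n) \<phi> x) = CT (w + \<i> * of_real (t n)) - of_real (t n) * Pn n"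
      using resolvent_generator_pairing[OF \<phi> w t(1)[of n]] by (simp_all only: h_def CT_def Pn_def)
    have "(LINT x|lborel. h x * g n x)
       = (LINT x|lborel. (h x * \<phi> x - h x * FK_semigroup M X (t n) \<phi> x) / of_real (t n) - of_real lam * (h x * \<phi> x))"
      by (intro Bochner_Integration.integral_cong refl) (simp add: g_def algebra_simps diff_divide_distrib)
    also have "\<dots> = (CT w - (LINT x|lborel. h x * FK_semigroup M X (t n) \<phi> x)) / of_real (t n) - of_real lam * CT w"
      using hphi R(1) by (simp add: hphiCT)
    also have "\<dots> = - ((CT (w + \<i> * of_real (t n)) - CT w) / of_real (t n)) + Pn n - of_real lam * CT w"
      unfolding R(2) using t(1)[of n] by (simp add: field_simps)
    finally show ?thesis .
  qed
  have pair0: "(\<lambda>n. LINT x|lborel. h x * g n x) \<longlonglongrightarrow> 0"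
  proof -
    have "filterlim t (at_right 0) sequentially"
      using t0 t(1) less_imp_neq[OF t(1), THEN not_sym] by (auto simp: filterlim_at intro!: always_eventually)
    then have lim: "(\<lambda>n. L2_normsq (g n)) \<longlonglongrightarrow> 0"
      using graph unfolding oscillator_graph_def g_def by (auto dest: filterlim_compose)
    have gm: "g n \<in> borel_measurable borel" for n
      using FK_semigroup_measurable[OF \<phi> t(1)[of n]] unfolding g_def by measurable
    have "eventually (\<lambda>n. L2_normsq (g n) < \<infinity>) sequentially"
      using lim by (rule order_tendstoD) simp
    then have ev: "eventually (\<lambda>n. norm (LINT x|lborel. h x * g n x) \<le> sqrt (l2sq h) * sqrt (l2sq (g n))) sequentially"
      by eventually_elim (use gm in \<open>auto intro!: L2_Cauchy_Schwarz(4)[OF hL] simp: L2_def\<close>)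
    have "(\<lambda>n. l2sq (g n)) \<longlonglongrightarrow> 0"
      unfolding l2sq_def by (rule tendsto_enn2real) (use lim in simp_all)
    then have "(\<lambda>n. sqrt (l2sq h) * sqrt (l2sq (g n))) \<longlonglongrightarrow> sqrt (l2sq h) * sqrt 0"
      by (intro tendsto_intros)
    then show ?thesis by (intro Lim_null_comparison[OF ev]) simp
  qed
  have dCT: "(CT has_field_derivative 3 * cauchy_transform 4 \<phi> w) (at w)"
    using cauchy_transform_has_derivative[OF \<phi> wn, of 2] by (simp add: CT_def numeral_3_eq_3 eval_nat_numeral)
  have diffq: "(\<lambda>n. (CT (w + \<i> * of_real (t n)) - CT w) / of_real (t n)) \<longlonglongrightarrow> \<i> * (3 * cauchy_transform 4 \<phi> w)"
  proof -
    have "(\<lambda>n. \<i> * complex_of_real (t n)) \<longlonglongrightarrow> \<i> * of_real 0" by (intro tendsto_intros t0)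
    moreover have "\<i> * complex_of_real (t n) \<noteq> 0" for n using t(1)[of n] by simp
    ultimately have "filterlim (\<lambda>n. \<i> * complex_of_real (t n)) (at 0) sequentially"
      by (simp add: filterlim_at)
    from filterlim_compose[OF dCT[unfolded DERIV_def] this]
    have "(\<lambda>n. (CT (w + \<i> * of_real (t n)) - CT w) / (\<i> * of_real (t n))) \<longlonglongrightarrow> 3 * cauchy_transform 4 \<phi> w" .
    from tendsto_mult[OF tendsto_const[of \<i>] this] show ?thesis by simp
  qed
  have "Pn \<longlonglongrightarrow> (LINT y|lborel. h y * (of_real (y^2) * \<phi> y))"
    unfolding Pn_def h_def by (rule potential_term_limit[OF \<phi> w t t0])
  from tendsto_diff[OF tendsto_add[OF tendsto_minus[OF diffq] this] tendsto_const[of "of_real lam * CT w"]]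
  have "(\<lambda>n. LINT x|lborel. h x * g n x) \<longlonglongrightarrow>
      - (\<i> * (3 * cauchy_transform 4 \<phi> w)) + (LINT y|lborel. h y * (of_real (y^2) * \<phi> y)) - of_real lam * CT w"
    by (simp only: pair)
  from LIMSEQ_unique[OF this pair0]
  have eq: "- (\<i> * (3 * cauchy_transform 4 \<phi> w)) + (LINT y|lborel. h y * (of_real (y^2) * \<phi> y)) - of_real lam * CT w = 0" .
  have "(LINT y|lborel. h y * (of_real (y^2) * \<phi> y))
     = cauchy_transform (Suc 0) \<phi> w + 2 * w * cauchy_transform (Suc (Suc 0)) \<phi> w + w^2 * cauchy_transform (Suc (Suc (Suc 0))) \<phi> w"
  proof -
    note I = cauchy_transform_integrable[OF \<phi> wn]
    have "cauchy_transform (Suc 0) \<phi> w + 2 * w * cauchy_transform (Suc (Suc 0)) \<phi> w + w^2 * cauchy_transform (Suc (Suc (Suc 0))) \<phi> w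
      = (LINT y|lborel. \<phi> y * (1 / (of_real y - w) ^ Suc 0) + 2 * w * (\<phi> y * (1 / (of_real y - w) ^ Suc (Suc 0)))
           + w^2 * (\<phi> y * (1 / (of_real y - w) ^ Suc (Suc (Suc 0)))))"
      unfolding cauchy_transform_def integral_mult_right_zero[symmetric]
      by (subst Bochner_Integration.integral_add[symmetric], (intro Bochner_Integration.integrable_add integrable_mult_right I)+)+ (rule refl)
    also have "\<dots> = (LINT y|lborel. h y * (of_real (y^2) * \<phi> y))"
    proof (intro Bochner_Integration.integral_cong refl)
      fix y
      define z where "z = complex_of_real y - w"
      have z: "z \<noteq> 0" using wn by (auto simp: z_def complex_eq_iff)
      have "complex_of_real (y^2) = (z + w)^2" by (simp add: z_def)
      moreover have "1 / z ^ 3 * (z + w)^2 = 1 / z ^ Suc 0 + 2 * w * (1 / z ^ Suc (Suc 0)) + w^2 * (1 / z ^ Suc (Suc (Suc 0)))"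
        using z by (simp add: field_simps power2_eq_square power3_eq_cube)
      ultimately have "h y * of_real (y^2) = 1 / z ^ Suc 0 + 2 * w * (1 / z ^ Suc (Suc 0)) + w^2 * (1 / z ^ Suc (Suc (Suc 0)))"
        by (simp only: h_def z_def)
      then have "h y * (of_real (y^2) * \<phi> y) = (1 / z ^ Suc 0 + 2 * w * (1 / z ^ Suc (Suc 0)) + w^2 * (1 / z ^ Suc (Suc (Suc 0)))) * \<phi> y"
        by (simp only: mult.assoc[symmetric])
      then show "\<phi> y * (1 / (of_real y - w) ^ Suc 0) + 2 * w * (\<phi> y * (1 / (of_real y - w) ^ Suc (Suc 0)))
           + w^2 * (\<phi> y * (1 / (of_real y - w) ^ Suc (Suc (Suc 0)))) = h y * (of_real (y^2) * \<phi> y)"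
        unfolding z_def[symmetric] by (simp only: distrib_right) (simp only: mult_ac)
    qed
    finally show ?thesis ..
  qed
  with eq show ?thesis by (simp add: CT_def numeral_3_eq_3 eval_nat_numeral)
qed

text \<open>
  The semigroup is real. This transfers bounds from the upper to the lower half-plane.
\<close>

lemma oscillator_graph_cnj:
  assumes "oscillator_graph M X \<phi> (\<lambda>x. of_real lam * \<phi> x)"
  shows "oscillator_graph M X (\<lambda>x. cnj (\<phi> x)) (\<lambda>x. of_real lam * cnj (\<phi> x))"
proof -
  have FK: "FK_semigroup M X t (\<lambda>x. cnj (\<phi> x)) x = cnj (FK_semigroup M X t \<phi> x)" for t x
    unfolding FK_semigroup_eq by (subst Bochner_Integration.integral_cnj[symmetric]) simp
  have "L2_normsq (\<lambda>x. (cnj (\<phi> x) - cnj (FK_semigroup M X t \<phi> x)) / of_real t - of_real lam * cnj (\<phi> x))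
     = L2_normsq (\<lambda>x. (\<phi> x - FK_semigroup M X t \<phi> x) / of_real t - of_real lam * \<phi> x)" for t
  proof -
    have "(cnj (\<phi> x) - cnj (FK_semigroup M X t \<phi> x)) / of_real t - of_real lam * cnj (\<phi> x)
      = cnj ((\<phi> x - FK_semigroup M X t \<phi> x) / of_real t - of_real lam * \<phi> x)" for x by simp
    then show ?thesis unfolding L2_normsq_def by (simp only: complex_mod_cnj)
  qed
  moreover have "(\<lambda>x. of_real lam * cnj (\<phi> x)) \<in> L2"
    using L2_cnj(1)[of "\<lambda>x. of_real lam * \<phi> x"] assms by (simp add: oscillator_graph_def)
  ultimately show ?thesis using assms unfolding oscillator_graph_def by (auto simp: FK intro: L2_cnj)
qed


section \<open>Uniform boundedness of the eigenfunctions\<close>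

text \<open>
  The jump of the Cauchy transform across the real line at \<open>x\<close> is at most twice the uniform bound, and it
  tends to \<open>2 \<pi> \<i> \<phi> x\<close>.
\<close>

lemma eigenfunction_bound:
  assumes graph: "oscillator_graph M X \<phi> (\<lambda>x. of_real lam * \<phi> x)"
    and cont: "continuous_on UNIV \<phi>" and norm: "l2sq \<phi> \<le> 1" and lam: "0 < lam0" "lam0 \<le> lam"
  shows "cmod (\<phi> x) \<le> uniform_bound lam0 / pi"
proof -
  define C where "C = uniform_bound lam0"
  have half: "eventually (\<lambda>e. cmod (cauchy_transform (Suc 0) \<psi> (Complex x e)) \<le> C) (at_right 0)"
    if g: "oscillator_graph M X \<psi> (\<lambda>x. of_real lam * \<psi> x)" and n: "l2sq \<psi> \<le> 1" for \<psi>
  proof -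
    have \<psi>: "\<psi> \<in> L2" using g by (simp add: oscillator_graph_def)
    obtain \<alpha> \<beta> where "\<And>w. 0 < Im w \<Longrightarrow>
        cauchy_transform (Suc (Suc 0)) \<psi> w = \<i> * (of_real lam - w^2) * cauchy_transform (Suc 0) \<psi> w + \<alpha> + \<beta> * w"
      using cauchy_transform_ODE[OF \<psi> eigenfunction_weak_equation[OF g]] by metis
    from cauchy_transform_uniform_bound[OF \<psi> n lam this] show ?thesis by (simp add: C_def)
  qed
  have \<phi>: "\<phi> \<in> L2" using graph by (simp add: oscillator_graph_def)
  define e where "e = (\<lambda>n. 1 / real (Suc n))"
  have e: "0 < e n" for n by (simp add: e_def)
  have e0: "e \<longlonglongrightarrow> 0" unfolding e_def by real_asymp
  have ef: "filterlim e (at_right 0) sequentially"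
    using e0 e less_imp_neq[OF e, THEN not_sym] by (auto simp: filterlim_at intro!: always_eventually)
  have up: "eventually (\<lambda>n. cmod (cauchy_transform (Suc 0) \<phi> (Complex x (e n))) \<le> C) sequentially"
    by (rule eventually_compose_filterlim[OF half[OF graph norm] ef])
  have "eventually (\<lambda>n. cmod (cauchy_transform (Suc 0) (\<lambda>x. cnj (\<phi> x)) (Complex x (e n))) \<le> C) sequentially"
    by (rule eventually_compose_filterlim[OF half[OF oscillator_graph_cnj[OF graph]] ef]) (simp add: L2_cnj \<phi> norm)
  moreover have "cmod (cauchy_transform (Suc 0) (\<lambda>x. cnj (\<phi> x)) (Complex x d)) = cmod (cauchy_transform (Suc 0) \<phi> (Complex x (- d)))" for d
  proof -
    have "cnj (Complex x (- d)) = Complex x d" by (simp add: complex_eq_iff)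
    then show ?thesis by (metis cnj_cauchy_transform complex_mod_cnj)
  qed
  ultimately have down: "eventually (\<lambda>n. cmod (cauchy_transform (Suc 0) \<phi> (Complex x (- e n))) \<le> C) sequentially"
    by simp
  define p where "p = (\<lambda>n. LINT y|lborel. \<phi> y * of_real (e n / ((y - x)^2 + (e n)^2)))"
  have "eventually (\<lambda>n. cmod (p n) \<le> C) sequentially"
    using up down
  proof eventually_elim
    case (elim n)
    have "2 * cmod (p n) = cmod (2 * \<i> * p n)" by (simp add: norm_mult)
    also have "\<dots> \<le> C + C"
      unfolding p_def jump_eq_poisson(2)[OF \<phi> e, symmetric]
      by (rule order_trans[OF norm_triangle_ineq4 add_mono[OF elim]])
    finally show ?case by simp
  qed
  moreover have "p \<longlonglongrightarrow> of_real pi * \<phi> x"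
    unfolding p_def by (rule poisson_integral_tendsto[OF \<phi> cont e e0])
  ultimately have "cmod (of_real pi * \<phi> x) \<le> C"
    by (intro tendsto_upperbound[OF tendsto_norm]) auto
  then show ?thesis by (simp add: norm_mult C_def pos_le_divide_eq mult.commute)
qed

end

theorem theorem3p13:
  fixes M :: "'a measure" and X :: "real \<Rightarrow> 'a \<Rightarrow> real"
    and \<mu> :: "nat \<Rightarrow> real" and \<phi> :: "nat \<Rightarrow> real \<Rightarrow> complex"
  assumes "cauchy_process M X"
    and "oscillator_eigensystem M X \<mu> \<phi>"
  shows "\<exists>C::real. \<forall>n\<ge>1. \<forall>x. cmod (\<phi> n x) \<le> C"
proof (intro exI allI impI)
  interpret cauchy_process M X by (rule assms(1))
  fix n :: nat and x :: real assume n: "1 \<le> n"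
  have eig: "0 < \<mu> 1" "\<And>n. 1 \<le> n \<Longrightarrow> \<mu> n \<le> \<mu> (Suc n)" "L2_orthonormal_basis \<phi>"
      "continuous_on UNIV (\<phi> n)" "oscillator_graph M X (\<phi> n) (\<lambda>x. of_real (\<mu> n) * \<phi> n x)"
    using assms(2) n by (auto simp: oscillator_eigensystem_def)
  have mono: "\<mu> 1 \<le> \<mu> n" using n
  proof (induction n rule: dec_induct)
    case (step n)
    then show ?case using eig(2)[of n] by linarith
  qed simp
  have L2: "\<phi> n \<in> L2" and inner: "L2_inner (\<phi> n) (\<phi> n) = 1"
    using eig(3) n by (auto simp: L2_orthonormal_basis_def)
  have "complex_of_real (l2sq (\<phi> n)) = (LINT x|lborel. complex_of_real ((cmod (\<phi> n x))^2))"
    unfolding integral_complex_of_real L2_integrable_square(2)[OF L2] ..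
  also have "\<dots> = L2_inner (\<phi> n) (\<phi> n)"
    unfolding L2_inner_def
    by (intro Bochner_Integration.integral_cong refl) (metis complex_norm_square mult.commute)
  finally have "l2sq (\<phi> n) = 1" using inner by simp
  then show "cmod (\<phi> n x) \<le> uniform_bound (\<mu> 1) / pi"
    using eigenfunction_bound[OF eig(5,4) _ eig(1) mono] by simp
qed

end
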